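(* Suppose that the Standing Assumption (stated in full in the context) holds. Then $\alpha(\boldsymbol\theta)=\pi(\boldsymbol\theta)f$ is differentiable at $\boldsymbol\theta_0$ and $$E_{\boldsymbol\theta_0}\left[\alpha_n\,\nabla L_n(\boldsymbol\theta_0)\right]\to\nabla\alpha(\boldsymbol\theta_0)\qquad\text{as } n\to\infty .$$
   Context: Setting. $\mathsf X$ is a general state space with a countably generated $\sigma$-field $\mathcal B(\mathsf X)$; $\boldsymbol\Theta\subseteq\mathbb R^d$ is a set of continuous parameters and $\boldsymbol\theta_0\in\boldsymbol\Theta$ is fixed; for each $\boldsymbol\theta\in\boldsymbol\Theta$, $P(\boldsymbol\theta)=\{P(\boldsymbol\theta,x,A)\}$ is a Markov transition kernel on $\mathsf X$; $\boldsymbol\Phi=\{\Phi_k:k\ge0\}$ is the discrete-time Markov chain on $\mathsf X$ with one-step transition kernel $P(\boldsymbol\theta)$. $\pi(\boldsymbol\theta)$ denotes the unique invariant (stationary) probability distribution of the chain under $P(\boldsymbol\theta)$, and $f:\mathsf X\to\mathbb R$ is a function with $\pi(\boldsymbol\theta)|f|<\infty$. For a measure $\nu$ and a kernel $P$, $\nu g=\int_{\mathsf X} g(x)\,\nu(dx)$ and $Pg(x)=\int_{\mathsf X} g(y)P(x,dy)$. Norms. For $h:\mathsf X\to[1,\infty)$: $|g|_h=\sup_{x\in\mathsf X}|g(x)|/h(x)$, and $L_h^\infty$ is the space of measurable $g$ on $\mathsf X$ with $|g|_h<\infty$. For $V:\mathsf X\to[1,\infty)$ and a (signed) kernel $Q$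 (e.g. a difference of two Markov kernels), $|||Q|||_V=\sup_{g\in L_V^\infty,\,|g|_V=1}|Qg|_V$. Standing Assumption. Fix $\epsilon>0$, let $B_\epsilon(\boldsymbol\theta_0)=\{\boldsymbol\theta\in\boldsymbol\Theta:\max_{1\le i\le d}|\theta_i-\theta_{0,i}|<\epsilon\}$, and let $\mathbf e_i$ be the vector of $\mathbb R^d$ with a 1 in the $i$th component and zeros elsewhere. (i) $\boldsymbol\Phi$ is $\psi$-irreducible for all $\boldsymbol\theta\in B_\epsilon(\boldsymbol\theta_0)$. (ii) For all $\boldsymbol\theta\in B_\epsilon(\boldsymbol\theta_0)$ there exist densities $p(\boldsymbol\theta,x,y)$, differentiable at $\boldsymbol\theta_0$, such that $P(\boldsymbol\theta,x,dy)=p(\boldsymbol\theta,x,y)P(\boldsymbol\theta_0,x,dy)$. (iii) There exist a set $K\in\mathcal B(\mathsf X)$, $\delta>0$, $m\in\mathbb N$ and a probability measure $\nu$ such that $P^m(\boldsymbol\theta,x,dy)\ge\delta\nu(dy)$ for all $x\in K$ and all $\boldsymbol\theta\in B_\epsilon(\boldsymbol\theta_0)$. (iv) For this set $K$ there exist a function $V:\mathsf X\to[1,\infty)$ and constants $0<\lambda<1$, $b<\infty$ such that $P(\boldsymbol\theta)V(x)\le\lambda V(x)+b1_K(x)$ for all $\boldsymbol\theta\in B_\epsilon(\boldsymbol\theta_0)$. (v) With $P^{(i)}(\boldsymbol\theta_0,x,dy)=\frac{\partial}{\partial\theta_i}p(\boldsymbol\theta,x,y)|_{\boldsymbol\theta=\boldsymbol\theta_0}P(\boldsymbol\theta_0,x,dy)$,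 for each $1\le i\le d$: $|||P^{(i)}(\boldsymbol\theta_0)|||_V<\infty$ and $\lim_{h\to0}\left|\left|\left|\frac{P(\boldsymbol\theta_0+h\mathbf e_i)-P(\boldsymbol\theta_0)}{h}-P^{(i)}(\boldsymbol\theta_0)\right|\right|\right|_V=0$. (vi) For each $1\le i\le d$, $|g_{ii}|_V<\infty$, where $g_{ii}(x)=\int_{\mathsf X}\left(\frac{\partial}{\partial\theta_i}p(\boldsymbol\theta_0,x,y)\right)^2P(\boldsymbol\theta_0,x,dy)$. (vii) $|f|_{\sqrt V}<\infty$. Further notation. $\alpha_n=\frac1n\sum_{j=0}^{n-1}f(\Phi_j)$; $L_n(\boldsymbol\theta)=\prod_{j=1}^np(\boldsymbol\theta,\Phi_{j-1},\Phi_j)$ for $n\ge1$; $\nabla$ is the gradient in $\boldsymbol\theta$. $E_{\boldsymbol\theta_0}$ is expectation for the chain with transition kernel $P(\boldsymbol\theta_0)$ started according to some fixed distribution $\mu$.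
   Formalization: The initial distribution μ is assumed to satisfy μV<∞, without which the expectation need not exist, and "differentiable" means that all partial derivatives exist, since (v) only controls coordinate directions and total differentiability can fail for d≥2. *)

theory Defs
  imports "HOL-Probability.Probability"
begin

text \<open>The functions to be differentiated are only meaningful on a parameter set; their values
  elsewhere do not matter, provided the parameter set contains a short segment through the base
  point in every coordinate direction.\<close>

definition coord_line :: "real^'d \<Rightarrow> 'd \<Rightarrow> real \<Rightarrow> real^'d" where
  "coord_line \<theta> i h = \<theta> + h *\<^sub>R axis i 1"

definition partial_deriv :: "'d \<Rightarrow> (real^'d \<Rightarrow> real) \<Rightarrow> real^'d \<Rightarrow> real" where
  "partial_deriv i F \<theta> = deriv (\<lambda>h. F (coord_line \<theta> i h)) 0"

text \<open>Differentiability at a point in the sense that all partial derivatives, hence the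
  gradient, exist.\<close>

definition grad_exists :: "(real^'d \<Rightarrow> real) \<Rightarrow> real^'d \<Rightarrow> bool" where
  "grad_exists F \<theta> \<longleftrightarrow> (\<forall>i. (\<lambda>h. F (coord_line \<theta> i h)) field_differentiable at 0)"

definition grad :: "(real^'d \<Rightarrow> real) \<Rightarrow> real^'d \<Rightarrow> real^'d" where
  "grad F \<theta> = (\<chi> i. partial_deriv i F \<theta>)"

definition param_box :: "(real^'d) set \<Rightarrow> real^'d \<Rightarrow> real \<Rightarrow> (real^'d) set" where
  "param_box \<Theta> \<theta>\<^sub>0 \<epsilon> = {\<theta>\<in>\<Theta>. (MAX i\<in>UNIV. \<bar>\<theta> $ i - \<theta>\<^sub>0 $ i\<bar>) < \<epsilon>}"

text \<open>A Markov kernel on \<^term>\<open>M\<close> is a member of \<^term>\<open>M \<rightarrow>\<^sub>M prob_algebra M\<close>.\<close>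

definition countably_generated :: "'x measure \<Rightarrow> bool" where
  "countably_generated M \<longleftrightarrow>
    (\<exists>G. countable G \<and> G \<subseteq> Pow (space M) \<and> sets M = sigma_sets (space M) G)"

primrec kernel_pow :: "'x measure \<Rightarrow> ('x \<Rightarrow> 'x measure) \<Rightarrow> nat \<Rightarrow> 'x \<Rightarrow> 'x measure" where
  "kernel_pow M Q 0 x = return M x"
| "kernel_pow M Q (Suc n) x = Q x \<bind> kernel_pow M Q n"

definition kernel_app :: "('x \<Rightarrow> 'x measure) \<Rightarrow> ('x \<Rightarrow> real) \<Rightarrow> 'x \<Rightarrow> real" where
  "kernel_app Q g x = (\<integral>y. g y \<partial>(Q x))"

definition invariant_dist :: "'x measure \<Rightarrow> ('x \<Rightarrow> 'x measure) \<Rightarrow> 'x measure \<Rightarrow> bool" where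
  "invariant_dist M Q \<rho> \<longleftrightarrow> \<rho> \<in> space (prob_algebra M) \<and> \<rho> \<bind> Q = \<rho>"

definition irreducibility_measure :: "'x measure \<Rightarrow> ('x \<Rightarrow> 'x measure) \<Rightarrow> 'x measure \<Rightarrow> bool" where
  "irreducibility_measure M Q \<phi> \<longleftrightarrow>
    sets \<phi> = sets M \<and> sigma_finite_measure \<phi> \<and> emeasure \<phi> (space M) > 0 \<and>
    (\<forall>A\<in>sets M. emeasure \<phi> A > 0 \<longrightarrow>
      (\<forall>x\<in>space M. \<exists>n\<ge>1. emeasure (kernel_pow M Q n x) A > 0))"

text \<open>As in Meyn and Tweedie, the symbol \<open>\<psi>\<close> stands for a maximal irreducibility measure.\<close>

definition psi_irreducible :: "'x measure \<Rightarrow> ('x \<Rightarrow> 'x measure) \<Rightarrow> 'x measure \<Rightarrow> bool" where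
  "psi_irreducible M Q \<psi> \<longleftrightarrow> irreducibility_measure M Q \<psi> \<and>
    (\<forall>\<phi>. irreducibility_measure M Q \<phi> \<longrightarrow> absolutely_continuous \<psi> \<phi>)"

text \<open>The last conjunct says that, given \<open>\<Phi> 0, \<dots>, \<Phi> n\<close>, the next state has conditional law
  \<open>Q (\<Phi> n)\<close>.\<close>

definition markov_chain ::
  "'w measure \<Rightarrow> 'x measure \<Rightarrow> ('x \<Rightarrow> 'x measure) \<Rightarrow> 'x measure \<Rightarrow> (nat \<Rightarrow> 'w \<Rightarrow> 'x) \<Rightarrow> bool" where
  "markov_chain \<Omega> M Q \<mu> \<Phi> \<longleftrightarrow>
    prob_space \<Omega> \<and> (\<forall>k. \<Phi> k \<in> \<Omega> \<rightarrow>\<^sub>M M) \<and> distr \<Omega> M (\<Phi> 0) = \<mu> \<and>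
    (\<forall>n. \<forall>A\<in>sets M. \<forall>B\<in>sets (PiM {..n} (\<lambda>_. M)).
      emeasure \<Omega> {\<omega>\<in>space \<Omega>. (\<lambda>k\<in>{..n}. \<Phi> k \<omega>) \<in> B \<and> \<Phi> (Suc n) \<omega> \<in> A} =
      (\<integral>\<^sup>+\<omega>. indicator B (\<lambda>k\<in>{..n}. \<Phi> k \<omega>) * emeasure (Q (\<Phi> n \<omega>)) A \<partial>\<Omega>))"

definition wnorm :: "'x measure \<Rightarrow> ('x \<Rightarrow> real) \<Rightarrow> ('x \<Rightarrow> real) \<Rightarrow> ennreal" where
  "wnorm M h g = (SUP x\<in>space M. ennreal (\<bar>g x\<bar> / h x))"

text \<open>Signed kernels enter through their action \<^term>\<open>T\<close> on functions. This action is given by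
  Bochner integrals, so the integrability of the functions involved has to be required separately.\<close>

definition kernel_norm ::
  "'x measure \<Rightarrow> ('x \<Rightarrow> real) \<Rightarrow> (('x \<Rightarrow> real) \<Rightarrow> 'x \<Rightarrow> real) \<Rightarrow> ennreal" where
  "kernel_norm M V T = (SUP g\<in>{g \<in> borel_measurable M. wnorm M V g = 1}. wnorm M V (T g))"

text \<open>Throughout, \<open>p \<theta> x\<close> is a density of \<open>P \<theta> x\<close> with respect to \<open>P \<theta>\<^sub>0 x\<close>.\<close>

definition dens_deriv ::
  "(real^'d \<Rightarrow> 'x \<Rightarrow> 'x \<Rightarrow> real) \<Rightarrow> real^'d \<Rightarrow> 'd \<Rightarrow> 'x \<Rightarrow> 'x \<Rightarrow> real" where
  "dens_deriv p \<theta>\<^sub>0 i x y = partial_deriv i (\<lambda>\<theta>. p \<theta> x y) \<theta>\<^sub>0"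

definition deriv_kernel_app ::
  "(real^'d \<Rightarrow> 'x \<Rightarrow> 'x measure) \<Rightarrow> (real^'d \<Rightarrow> 'x \<Rightarrow> 'x \<Rightarrow> real) \<Rightarrow> real^'d \<Rightarrow> 'd
    \<Rightarrow> ('x \<Rightarrow> real) \<Rightarrow> 'x \<Rightarrow> real" where
  "deriv_kernel_app P p \<theta>\<^sub>0 i g x = (\<integral>y. g y * dens_deriv p \<theta>\<^sub>0 i x y \<partial>(P \<theta>\<^sub>0 x))"

definition likelihood ::
  "(real^'d \<Rightarrow> 'x \<Rightarrow> 'x \<Rightarrow> real) \<Rightarrow> (nat \<Rightarrow> 'w \<Rightarrow> 'x) \<Rightarrow> nat \<Rightarrow> real^'d \<Rightarrow> 'w \<Rightarrow> real" where
  "likelihood p \<Phi> n \<theta> \<omega> = (\<Prod>j=1..n. p \<theta> (\<Phi> (j - 1) \<omega>) (\<Phi> j \<omega>))"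

definition time_avg :: "('x \<Rightarrow> real) \<Rightarrow> (nat \<Rightarrow> 'w \<Rightarrow> 'x) \<Rightarrow> nat \<Rightarrow> 'w \<Rightarrow> real" where
  "time_avg f \<Phi> n \<omega> = (1 / real n) * (\<Sum>j<n. f (\<Phi> j \<omega>))"

end

theory Submission
  imports Defs
begin

text \<open>
  Both sides of the convergence are computed from one object: a solution \<open>g\<close> of Poisson's equation
  \<open>g - P g = f - \<pi> f\<close> for the base kernel \<open>P = P \<theta>\<^sub>0\<close>. Fix a coordinate, write \<open>P\<^sub>h\<close> and \<open>\<pi>\<^sub>h\<close> for
  kernel and invariant law at distance \<open>h\<close> along it, \<open>q\<close> for the partial derivative of the density at
  the base point, and \<open>D g x = \<integral> g y q x y P(x, dy)\<close>. The common value is \<open>\<pi> D g\<close>.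

  The derivative. Since \<open>\<pi>\<^sub>h g = \<pi>\<^sub>h P\<^sub>h g\<close>, integrating Poisson's equation against \<open>\<pi>\<^sub>h\<close> gives
  \<open>(\<pi>\<^sub>h f - \<pi> f) / h = \<pi>\<^sub>h ((P\<^sub>h g - P g) / h)\<close>. The difference quotient converges to \<open>D g\<close> in the
  weighted norm, the drift condition bounds \<open>\<pi>\<^sub>h V\<close> uniformly in \<open>h\<close>, and \<open>\<pi>\<^sub>h u \<longrightarrow> \<pi> u\<close> for
  every \<open>u\<close> of order \<open>V\<close> by the same identity applied to the Poisson solution of \<open>u\<close>. This is
  \<open>stationary_derivative\<close>.

  The score. Almost surely the densities along the path equal one at the base point, so the partial
  derivative of the likelihood is \<open>S\<^sub>n = (\<Sum>j<n. q (\<Phi> j) (\<Phi> (j + 1)))\<close>; this is a martingale, because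
  all \<open>P\<^sub>h\<close> have mass one and hence \<open>\<integral> q x y P(x, dy) = 0\<close>. Poisson's equation writes
  \<open>(\<Sum>j<n. f (\<Phi> j)) - n \<pi> f\<close> as \<open>g (\<Phi> 0) - g (\<Phi> n)\<close> plus the martingale \<open>A\<^sub>n\<close> with increments
  \<open>g (\<Phi> (j + 1)) - P g (\<Phi> j)\<close>. Increments at different times are orthogonal, so
  \<open>E (A\<^sub>n S\<^sub>n) = (\<Sum>j<n. E (D g (\<Phi> j)))\<close>; divided by \<open>n\<close> this converges to \<open>\<pi> D g\<close> by Poisson's
  equation for \<open>D g\<close>. The boundary term contributes \<open>O(1 / sqrt n)\<close> if \<open>g (\<Phi> n)\<close> is bounded in mean square.
  For this reason \<open>g\<close> is constructed of order \<open>sqrt V\<close>; by Jensen's inequality \<open>sqrt V\<close> satisfies a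
  drift condition too. This is \<open>score_covariance_limit\<close>.

  Solving Poisson's equation. The chain may be periodic, so the series of the powers \<open>P\<^sup>k (f - \<pi> f)\<close>
  may diverge. Let \<open>A\<close> be the average of \<open>P\<^sup>m, \<dots>, P\<^sup>m\<^sup>+\<^sup>N\<^sup>-\<^sup>1\<close>. The drift forces a
  visit to \<open>K\<close> in bounded time from any sublevel set of \<open>V\<close>, hence \<open>A\<close> dominates a rank-one kernel
  \<open>s \<otimes> \<nu>\<close> with \<open>s\<close> a multiple of the indicator of that sublevel set. What remains, \<open>T = A - s \<otimes> \<nu>\<close>,
  is positive and satisfies \<open>T W \<le> r W\<close> with \<open>r < 1\<close> and \<open>W = 1 + \<beta> V\<close>: on the sublevel set the
  removed mass gives the gain, outside of it the drift does. So the Neumann series of \<open>T\<close> converges;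
  integration against \<open>\<pi>\<close> shows that its sum solves the equation for \<open>A\<close>, and since \<open>I - A\<close> is
  \<open>I - P\<close> times a polynomial in \<open>P\<close>, the equation for \<open>P\<close> is solved as well. This is
  \<open>poisson_equation\<close>.
\<close>

section \<open>Integration against kernels\<close>

lemma measurable_integral_kernel:
  fixes k :: "'a \<Rightarrow> 'b \<Rightarrow> real"
  assumes k [measurable]: "(\<lambda>(x, y). k x y) \<in> borel_measurable (N \<Otimes>\<^sub>M B)"
    and L [measurable]: "L \<in> N \<rightarrow>\<^sub>M subprob_algebra B"
  shows "(\<lambda>x. \<integral>y. k x y \<partial>(L x)) \<in> borel_measurable N"
proof -
  note measurable_distr2[measurable]
  have "(\<lambda>x. integral\<^sup>L (distr (L x) (N \<Otimes>\<^sub>M B) (\<lambda>y. (x, y))) (\<lambda>(x, y). k x y)) \<in> borel_measurable N"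
    by (rule measurable_compose[OF _ integral_measurable_subprob_algebra[OF k]]) measurable
  then show ?thesis
    by (rule measurable_cong[THEN iffD1, rotated]) (simp add: integral_distr)
qed

lemma integral_bind_kernel_nonneg:
  fixes u :: "'b \<Rightarrow> real"
  assumes L: "L \<in> N \<rightarrow>\<^sub>M subprob_algebra B" and ne: "space N \<noteq> {}"
    and u: "u \<in> borel_measurable B" "\<And>y. y \<in> space B \<Longrightarrow> 0 \<le> u y"
    and inner: "\<And>x. x \<in> space N \<Longrightarrow> integrable (L x) u"
    and outer: "integrable (N \<bind> L) u"
  shows "integrable N (\<lambda>x. \<integral>y. u y \<partial>(L x))"
    and "(\<integral>y. u y \<partial>(N \<bind> L)) = (\<integral>x. (\<integral>y. u y \<partial>(L x)) \<partial>N)"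
proof -
  have spL: "space (L x) = space B" if "x \<in> space N" for x
    using measurable_space[OF L that] by (auto simp: space_subprob_algebra dest: sets_eq_imp_space_eq)
  have pos: "0 \<le> (\<integral>y. u y \<partial>(L x))" if "x \<in> space N" for x
    by (rule Bochner_Integration.integral_nonneg) (use u spL that in auto)
  have meas: "(\<lambda>x. \<integral>y. u y \<partial>(L x)) \<in> borel_measurable N"
    by (rule measurable_compose[OF L integral_measurable_subprob_algebra[OF u(1)]])
  have spb: "space (N \<bind> L) = space B"
    by (rule space_bind[OF sets_kernel[OF L] ne])
  have "(\<integral>\<^sup>+y. u y \<partial>(N \<bind> L)) = (\<integral>\<^sup>+x. (\<integral>\<^sup>+y. u y \<partial>(L x)) \<partial>N)"
    by (rule nn_integral_bind[OF _ L]) (use u(1) in measurable)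
  also have "\<dots> = (\<integral>\<^sup>+x. ennreal (\<integral>y. u y \<partial>(L x)) \<partial>N)"
    by (intro nn_integral_cong nn_integral_eq_integral inner) (use u spL in auto)
  finally have eq: "ennreal (\<integral>y. u y \<partial>(N \<bind> L)) = (\<integral>\<^sup>+x. ennreal (\<integral>y. u y \<partial>(L x)) \<partial>N)"
    using nn_integral_eq_integral[OF outer AE_I2] u(2) spb by simp
  show int: "integrable N (\<lambda>x. \<integral>y. u y \<partial>(L x))"
    using eq[symmetric] pos by (intro integrableI_nonneg meas) (auto simp: AE_I2)
  have "ennreal (\<integral>y. u y \<partial>(N \<bind> L)) = ennreal (\<integral>x. (\<integral>y. u y \<partial>(L x)) \<partial>N)"
    unfolding eq using pos by (intro nn_integral_eq_integral int) auto
  then show "(\<integral>y. u y \<partial>(N \<bind> L)) = (\<integral>x. (\<integral>y. u y \<partial>(L x)) \<partial>N)"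
    using u spb pos by (subst (asm) ennreal_inj) (auto intro!: Bochner_Integration.integral_nonneg)
qed

lemma integral_bind_kernel:
  fixes u :: "'b \<Rightarrow> real"
  assumes L: "L \<in> N \<rightarrow>\<^sub>M subprob_algebra B" and ne: "space N \<noteq> {}"
    and u: "u \<in> borel_measurable B"
    and inner: "\<And>x. x \<in> space N \<Longrightarrow> integrable (L x) u"
    and outer: "integrable (N \<bind> L) u"
  shows "integrable N (\<lambda>x. \<integral>y. u y \<partial>(L x))"
    and "(\<integral>y. u y \<partial>(N \<bind> L)) = (\<integral>x. (\<integral>y. u y \<partial>(L x)) \<partial>N)"
proof -
  let ?p = "\<lambda>y. max 0 (u y)" and ?n = "\<lambda>y. max 0 (- u y)"
  have split: "u y = ?p y - ?n y" for y by auto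
  have in_p: "integrable (L x) ?p" and in_n: "integrable (L x) ?n" if "x \<in> space N" for x
    using inner[OF that] by auto
  have out_p: "integrable (N \<bind> L) ?p" and out_n: "integrable (N \<bind> L) ?n"
    using outer by auto
  note p = integral_bind_kernel_nonneg[OF L ne _ _ in_p out_p]
    and n = integral_bind_kernel_nonneg[OF L ne _ _ in_n out_n]
  have eq: "(\<integral>y. u y \<partial>(L x)) = (\<integral>y. ?p y \<partial>(L x)) - (\<integral>y. ?n y \<partial>(L x))" if "x \<in> space N" for x
    by (subst split, rule Bochner_Integration.integral_diff[OF in_p[OF that] in_n[OF that]])
  have p1: "integrable N (\<lambda>x. \<integral>y. ?p y \<partial>(L x))" and n1: "integrable N (\<lambda>x. \<integral>y. ?n y \<partial>(L x))"
    and p2: "(\<integral>y. ?p y \<partial>(N \<bind> L)) = (\<integral>x. (\<integral>y. ?p y \<partial>(L x)) \<partial>N)"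
    and n2: "(\<integral>y. ?n y \<partial>(N \<bind> L)) = (\<integral>x. (\<integral>y. ?n y \<partial>(L x)) \<partial>N)"
    using u by (auto intro!: p n)
  have "integrable N (\<lambda>x. \<integral>y. u y \<partial>(L x)) \<longleftrightarrow>
    integrable N (\<lambda>x. (\<integral>y. ?p y \<partial>(L x)) - (\<integral>y. ?n y \<partial>(L x)))"
    by (rule Bochner_Integration.integrable_cong) (auto simp: eq)
  then show "integrable N (\<lambda>x. \<integral>y. u y \<partial>(L x))"
    using p1 n1 by simp
  have "(\<integral>y. u y \<partial>(N \<bind> L)) = (\<integral>y. ?p y \<partial>(N \<bind> L)) - (\<integral>y. ?n y \<partial>(N \<bind> L))"
    by (subst split, rule Bochner_Integration.integral_diff[OF out_p out_n])
  also have "\<dots> = (\<integral>x. (\<integral>y. ?p y \<partial>(L x)) - (\<integral>y. ?n y \<partial>(L x)) \<partial>N)"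
    unfolding p2 n2 by (rule Bochner_Integration.integral_diff[symmetric, OF p1 n1])
  also have "\<dots> = (\<integral>x. (\<integral>y. u y \<partial>(L x)) \<partial>N)"
    by (rule Bochner_Integration.integral_cong) (auto simp: eq)
  finally show "(\<integral>y. u y \<partial>(N \<bind> L)) = (\<integral>x. (\<integral>y. u y \<partial>(L x)) \<partial>N)" .
qed

section \<open>Kernels with a geometric drift\<close>

text \<open>The weighted space \<open>L\<^sub>V\<^sup>\<infinity>\<close>, with an explicit constant instead of the norm, so that its
  elements can be added without case distinctions on infinite suprema.\<close>
definition dominated :: "'x measure \<Rightarrow> ('x \<Rightarrow> real) \<Rightarrow> ('x \<Rightarrow> real) \<Rightarrow> bool" where
  "dominated M V g \<longleftrightarrow> g \<in> borel_measurable M \<and> (\<exists>c\<ge>0. \<forall>x\<in>space M. \<bar>g x\<bar> \<le> c * V x)"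

lemma dominatedI:
  "g \<in> borel_measurable M \<Longrightarrow> 0 \<le> c \<Longrightarrow> (\<And>x. x \<in> space M \<Longrightarrow> \<bar>g x\<bar> \<le> c * V x) \<Longrightarrow> dominated M V g"
  by (auto simp: dominated_def)

lemma dominatedD: "dominated M V g \<Longrightarrow> g \<in> borel_measurable M"
  by (simp add: dominated_def)

lemma dominatedE:
  assumes "dominated M V g"
  obtains c where "0 \<le> c" "\<And>x. x \<in> space M \<Longrightarrow> \<bar>g x\<bar> \<le> c * V x"
  using assms by (auto simp: dominated_def)

lemma dominated_add:
  assumes f: "dominated M V f" and g: "dominated M V g"
  shows "dominated M V (\<lambda>x. f x + g x)"
proof -
  obtain c where c: "0 \<le> c" "\<And>x. x \<in> space M \<Longrightarrow> \<bar>f x\<bar> \<le> c * V x" using f by (auto elim: dominatedE)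
  obtain d where d: "0 \<le> d" "\<And>x. x \<in> space M \<Longrightarrow> \<bar>g x\<bar> \<le> d * V x" using g by (auto elim: dominatedE)
  show ?thesis
  proof (rule dominatedI[where c = "c + d"])
    show "\<bar>f x + g x\<bar> \<le> (c + d) * V x" if "x \<in> space M" for x
      using c(2)[OF that] d(2)[OF that] by (simp add: distrib_right)
  qed (use c d in \<open>auto intro!: borel_measurable_add dominatedD[OF f] dominatedD[OF g]\<close>)
qed

lemma dominated_cmult:
  assumes g: "dominated M V g"
  shows "dominated M V (\<lambda>x. a * g x)"
proof -
  obtain d where d: "0 \<le> d" "\<And>x. x \<in> space M \<Longrightarrow> \<bar>g x\<bar> \<le> d * V x" using g by (auto elim: dominatedE)
  show ?thesis
  proof (rule dominatedI[where c = "\<bar>a\<bar> * d"])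
    show "\<bar>a * g x\<bar> \<le> (\<bar>a\<bar> * d) * V x" if "x \<in> space M" for x
      using mult_left_mono[OF d(2)[OF that], of "\<bar>a\<bar>"] by (simp add: abs_mult mult.assoc)
  qed (use d in \<open>auto intro!: borel_measurable_times dominatedD[OF g]\<close>)
qed

lemma dominated_diff:
  assumes "dominated M V f" and "dominated M V g"
  shows "dominated M V (\<lambda>x. f x - g x)"
  using dominated_add[OF assms(1) dominated_cmult[OF assms(2), of "-1"]] by simp

lemma dominated_sum:
  assumes "\<And>i. i \<in> I \<Longrightarrow> dominated M V (g i)"
  shows "dominated M V (\<lambda>x. \<Sum>i\<in>I. g i x)"
proof (cases "finite I")
  case True
  then show ?thesis using assms
  proof (induction I rule: finite_induct)
    case empty then show ?case by (intro dominatedI[of _ _ 0]) auto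
  next
    case (insert i I) then show ?case by (simp add: dominated_add)
  qed
qed (auto intro!: dominatedI[of _ _ 0])

lemma dominated_mono:
  assumes g: "g \<in> borel_measurable M" and h: "dominated M V h"
    and le: "\<And>x. x \<in> space M \<Longrightarrow> \<bar>g x\<bar> \<le> h x"
  shows "dominated M V g"
proof -
  obtain d where d: "0 \<le> d" "\<And>x. x \<in> space M \<Longrightarrow> \<bar>h x\<bar> \<le> d * V x" using h by (auto elim: dominatedE)
  show ?thesis
    by (rule dominatedI[OF g d(1)]) (use d(2) le in fastforce)
qed

lemmas dominated_intros = dominated_add dominated_diff dominated_cmult dominated_sum

lemma dominated_integrable:
  assumes g: "dominated M V g" and V: "integrable N V" and N: "sets N = sets M"
  shows "integrable N g"
proof -
  obtain c where c: "0 \<le> c" "\<And>x. x \<in> space M \<Longrightarrow> \<bar>g x\<bar> \<le> c * V x" using g by (auto elim: dominatedE)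
  have sp: "space N = space M" using N by (rule sets_eq_imp_space_eq)
  show ?thesis
  proof (rule Bochner_Integration.integrable_bound[where f = "\<lambda>x. c * V x"])
    show "AE x in N. norm (g x) \<le> norm (c * V x)"
      using c(2) sp by (intro AE_I2) (simp, meson abs_ge_self order_trans)
    show "g \<in> borel_measurable N"
      using dominatedD[OF g] N by (simp cong: measurable_cong_sets)
  qed (use V in simp)
qed

locale drift_kernel =
  fixes M :: "'x measure" and Q :: "'x \<Rightarrow> 'x measure" and V :: "'x \<Rightarrow> real"
    and K :: "'x set" and lam b :: real
  assumes kernel [measurable]: "Q \<in> M \<rightarrow>\<^sub>M prob_algebra M"
    and V_meas [measurable]: "V \<in> borel_measurable M"
    and V_ge_1: "x \<in> space M \<Longrightarrow> 1 \<le> V x"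
    and lam: "0 < lam" "lam < 1"
    and b_pos: "0 < b"
    and K_sets [measurable]: "K \<in> sets M"
    and drift: "x \<in> space M \<Longrightarrow> (\<integral>\<^sup>+y. ennreal (V y) \<partial>(Q x)) \<le> ennreal (lam * V x + b * indicator K x)"
begin

abbreviation E :: "('x \<Rightarrow> real) \<Rightarrow> 'x \<Rightarrow> real" where "E \<equiv> kernel_app Q"

lemma kernel_sub [measurable]: "Q \<in> M \<rightarrow>\<^sub>M subprob_algebra M"
  by (rule measurable_prob_algebraD[OF kernel])

lemma
  assumes "x \<in> space M"
  shows sets_Q: "sets (Q x) = sets M" and space_Q: "space (Q x) = space M"
    and prob_Q: "prob_space (Q x)"
  using measurable_space[OF kernel assms] by (auto simp: space_prob_algebra dest: sets_eq_imp_space_eq)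

lemma V_pos: "x \<in> space M \<Longrightarrow> 0 < V x"
  using V_ge_1[of x] by simp

lemma V_nonneg: "x \<in> space M \<Longrightarrow> 0 \<le> V x"
  using V_ge_1[of x] by simp

lemma integrable_V: "x \<in> space M \<Longrightarrow> integrable (Q x) V"
proof (rule integrableI_nonneg)
  assume x: "x \<in> space M"
  show "V \<in> borel_measurable (Q x)" using sets_Q[OF x] V_meas by (simp cong: measurable_cong_sets)
  show "AE y in Q x. 0 \<le> V y" using V_nonneg by (intro AE_I2) (auto simp: space_Q[OF x])
  show "(\<integral>\<^sup>+y. ennreal (V y) \<partial>Q x) < \<infinity>" using drift[OF x] by (auto simp: le_less_trans)
qed

lemma E_V_le: 
  assumes x: "x \<in> space M" shows "E V x \<le> lam * V x + b * indicator K x"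
proof -
  have "ennreal (E V x) = (\<integral>\<^sup>+y. ennreal (V y) \<partial>(Q x))"
    unfolding kernel_app_def using V_nonneg
    by (intro nn_integral_eq_integral[symmetric] integrable_V x AE_I2) (auto simp: space_Q[OF x])
  with drift[OF x] have "ennreal (E V x) \<le> ennreal (lam * V x + b * indicator K x)" by simp
  then show ?thesis
    using lam b_pos V_nonneg[OF x] by (subst (asm) ennreal_le_iff) auto
qed

lemma integrable_dominated: "dominated M V g \<Longrightarrow> x \<in> space M \<Longrightarrow> integrable (Q x) g"
  by (rule dominated_integrable[OF _ integrable_V sets_Q])

lemma dominated_bounded:
  assumes g: "g \<in> borel_measurable M" and c: "\<And>x. x \<in> space M \<Longrightarrow> \<bar>g x\<bar> \<le> c"
  shows "dominated M V g"
proof (rule dominatedI[where c = "\<bar>c\<bar>", OF g])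
  show "\<bar>g x\<bar> \<le> \<bar>c\<bar> * V x" if "x \<in> space M" for x
    using c[OF that] mult_left_mono[OF V_ge_1[OF that], of "\<bar>c\<bar>"] by linarith
qed simp

lemma dominated_V: "dominated M V V"
  by (rule dominatedI[where c = 1]) (use V_nonneg in auto)

lemma dominated_const: "dominated M V (\<lambda>_. a)"
  by (rule dominated_bounded[where c = "\<bar>a\<bar>"]) auto

lemma dominated_indicator: "A \<in> sets M \<Longrightarrow> dominated M V (indicator A)"
  by (rule dominated_bounded[where c = 1]) (auto split: split_indicator)

lemma E_mono:
  assumes "dominated M V f" "dominated M V g" "\<And>y. y \<in> space M \<Longrightarrow> f y \<le> g y" "x \<in> space M"
  shows "E f x \<le> E g x"
  unfolding kernel_app_def using assms
  by (intro integral_mono integrable_dominated) (auto simp: space_Q)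

lemma E_cong:
  assumes "\<And>y. y \<in> space M \<Longrightarrow> f y = g y" "x \<in> space M"
  shows "E f x = E g x"
  unfolding kernel_app_def using assms
  by (intro Bochner_Integration.integral_cong) (auto simp: space_Q)

lemma E_add:
  assumes "dominated M V f" "dominated M V g" "x \<in> space M"
  shows "E (\<lambda>y. f y + g y) x = E f x + E g x"
  unfolding kernel_app_def using assms
  by (intro Bochner_Integration.integral_add integrable_dominated)

lemma E_diff:
  assumes "dominated M V f" "dominated M V g" "x \<in> space M"
  shows "E (\<lambda>y. f y - g y) x = E f x - E g x"
  unfolding kernel_app_def using assms
  by (intro Bochner_Integration.integral_diff integrable_dominated)

lemma E_cmult: "E (\<lambda>y. a * f y) x = a * E f x"
  unfolding kernel_app_def by simp

lemma E_const: "x \<in> space M \<Longrightarrow> E (\<lambda>_. a) x = a"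
  unfolding kernel_app_def using prob_Q by (simp add: prob_space.prob_space)

lemma E_sum:
  assumes "\<And>i. i \<in> I \<Longrightarrow> dominated M V (f i)" "x \<in> space M"
  shows "E (\<lambda>y. \<Sum>i\<in>I. f i y) x = (\<Sum>i\<in>I. E (f i) x)"
  unfolding kernel_app_def using assms
  by (intro Bochner_Integration.integral_sum integrable_dominated)

lemma E_nonneg:
  assumes "\<And>y. y \<in> space M \<Longrightarrow> 0 \<le> f y" "x \<in> space M"
  shows "0 \<le> E f x"
  unfolding kernel_app_def using assms
  by (intro Bochner_Integration.integral_nonneg_AE AE_I2) (auto simp: space_Q)

lemma E_measurable: "g \<in> borel_measurable M \<Longrightarrow> E g \<in> borel_measurable M"
  unfolding kernel_app_def[abs_def]
  by (rule measurable_compose[OF kernel_sub integral_measurable_subprob_algebra])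

lemma dominated_E:
  assumes g: "dominated M V g"
  shows "dominated M V (E g)"
proof -
  obtain c where c: "0 \<le> c" "\<And>x. x \<in> space M \<Longrightarrow> \<bar>g x\<bar> \<le> c * V x" using g by (auto elim: dominatedE)
  have bound: "\<bar>E g x\<bar> \<le> (c * (lam + b)) * V x" if x: "x \<in> space M" for x
  proof -
    have "\<bar>E g x\<bar> \<le> E (\<lambda>y. \<bar>g y\<bar>) x"
      unfolding kernel_app_def by (rule integral_abs_bound)
    also have "\<dots> \<le> E (\<lambda>y. c * V y) x"
      by (rule E_mono[OF _ dominated_cmult[OF dominated_V] c(2) x])
        (use g c in \<open>auto intro!: dominatedI[of _ _ c] dest: dominatedD\<close>)
    also have "\<dots> = c * E V x" by (rule E_cmult)
    also have "\<dots> \<le> c * (lam * V x + b * indicator K x)"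
      by (intro mult_left_mono E_V_le x c)
    also have "\<dots> \<le> c * (lam * V x + b * V x)"
      using V_ge_1[OF x] b_pos c by (intro mult_left_mono add_left_mono) (auto split: split_indicator)
    finally show ?thesis by (simp add: algebra_simps)
  qed
  show ?thesis
    by (rule dominatedI[where c = "c * (lam + b)", OF E_measurable[OF dominatedD[OF g]] _ bound])
      (use c lam b_pos in auto)
qed

text \<open>Integrating the drift inequality against \<open>\<rho>\<close> directly would presuppose that \<open>V\<close> is
  integrable. For the truncation \<open>w = min V n\<close> invariance gives \<open>\<rho> (w - E w) = 0\<close>, while
  \<open>w - E w\<close> is nonnegative up to the error \<open>b\<close> everywhere and at least \<open>(1 - lam) V - b\<close> where
  \<open>V < n\<close>. Monotone convergence in \<open>n\<close> finishes the argument.\<close>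
lemma integrable_V_invariant:
  assumes inv: "invariant_dist M Q \<rho>"
  shows "integrable \<rho> V" and "(\<integral>x. V x \<partial>\<rho>) \<le> b / (1 - lam)"
proof -
  have \<rho>: "sets \<rho> = sets M" "prob_space \<rho>" "\<rho> \<bind> Q = \<rho>" and sp: "space \<rho> = space M"
    using inv by (auto simp: invariant_dist_def space_prob_algebra dest: sets_eq_imp_space_eq)
  interpret prob_space \<rho> by (rule \<rho>(2))
  have meas\<rho>: "g \<in> borel_measurable \<rho>" if "g \<in> borel_measurable M" for g :: "'x \<Rightarrow> real"
    using that \<rho>(1) by (simp cong: measurable_cong_sets)
  have Q\<rho>: "Q \<in> \<rho> \<rightarrow>\<^sub>M subprob_algebra M"
    using kernel_sub \<rho>(1) by (simp cong: measurable_cong_sets)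
  define t where "t n x = (if V x < real n then (1 - lam) * max 0 (V x) else 0)" for n x
  have t [measurable]: "t n \<in> borel_measurable M" for n
    unfolding t_def[abs_def] by measurable
  have t_nonneg: "0 \<le> t n x" if "x \<in> space M" for n x
    using lam V_nonneg[OF that] by (simp add: t_def)
  have t_le: "\<bar>t n x\<bar> \<le> real n" if "x \<in> space M" for n x
  proof -
    have "(1 - lam) * V x \<le> 1 * V x" by (rule mult_right_mono) (use lam V_nonneg that in auto)
    then show ?thesis using lam V_nonneg[OF that] by (auto simp: t_def split: split_indicator)
  qed
  have intb: "integrable \<rho> g" if "g \<in> borel_measurable M" "\<And>x. x \<in> space M \<Longrightarrow> \<bar>g x\<bar> \<le> c" for g and c :: real
    by (rule integrable_const_bound[where B = c, OF AE_I2 meas\<rho>[OF that(1)]]) (simp add: sp that(2))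
  have int_t: "integrable \<rho> (t n)" for n by (rule intb[OF t t_le])
  have *: "(\<integral>x. t n x \<partial>\<rho>) \<le> b" for n :: nat
  proof -
    define w where "w x = min (V x) (real n)" for x
    have w [measurable]: "w \<in> borel_measurable M" unfolding w_def[abs_def] by measurable
    have w_le: "\<bar>w x\<bar> \<le> real n" if "x \<in> space M" for x
      using V_nonneg[OF that] by (auto simp: w_def)
    have dw: "dominated M V w" by (rule dominated_bounded[OF w w_le])
    have intw: "integrable \<rho> w" by (rule intb[OF w w_le])
    have inv_w: "integrable \<rho> (E w)" "(\<integral>x. w x \<partial>\<rho>) = (\<integral>x. E w x \<partial>\<rho>)"
      using integral_bind_kernel[OF Q\<rho> not_empty w] integrable_dominated[OF dw] sp \<rho>(3) intw
      by (auto simp: kernel_app_def[abs_def])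
    have le: "t n x - b \<le> w x - E w x" if x: "x \<in> space M" for x
    proof -
      have "E w x \<le> E V x"
        by (rule E_mono[OF dw dominated_V _ x]) (auto simp: w_def)
      also have "\<dots> \<le> lam * V x + b"
        using E_V_le[OF x] b_pos by (auto split: split_indicator_asm)
      finally have 1: "E w x \<le> lam * V x + b" .
      have "E w x \<le> E (\<lambda>_. real n) x"
        by (rule E_mono[OF dw dominated_const _ x]) (auto simp: w_def)
      then have 2: "E w x \<le> real n" using E_const[OF x] by simp
      from 1 2 x b_pos V_nonneg[OF x] show ?thesis
        by (auto simp: w_def t_def algebra_simps)
    qed
    have "(\<integral>x. t n x - b \<partial>\<rho>) \<le> (\<integral>x. w x - E w x \<partial>\<rho>)"
      by (intro integral_mono Bochner_Integration.integrable_diff int_t intw inv_w integrable_const le) (simp add: sp)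
    also have "\<dots> = 0" using inv_w intw by simp
    finally show ?thesis
      using int_t by (simp add: prob_space)
  qed
  have up: "(\<lambda>n. ennreal (t n x)) \<longlonglongrightarrow> ennreal ((1 - lam) * max 0 (V x))" for x
  proof (rule tendsto_eventually)
    obtain N :: nat where "V x < real N" using reals_Archimedean2 by blast
    then show "\<forall>\<^sub>F n in sequentially. ennreal (t n x) = ennreal ((1 - lam) * max 0 (V x))"
      by (intro eventually_sequentiallyI[of N]) (auto simp: t_def)
  qed
  have inc: "ennreal (t n x) \<le> ennreal (t n' x)" if "n \<le> n'" for n n' x
    using that lam by (intro ennreal_leI) (auto simp: t_def)
  have fin: "(\<integral>\<^sup>+x. ennreal ((1 - lam) * V x) \<partial>\<rho>) \<le> ennreal b"
  proof (rule LIMSEQ_le_const2)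
    have "(\<integral>\<^sup>+x. ennreal ((1 - lam) * V x) \<partial>\<rho>) = (\<integral>\<^sup>+x. ennreal ((1 - lam) * max 0 (V x)) \<partial>\<rho>)"
      by (rule nn_integral_cong) (use V_nonneg sp in simp)
    moreover have "(\<lambda>n. \<integral>\<^sup>+x. ennreal (t n x) \<partial>\<rho>) \<longlonglongrightarrow> (\<integral>\<^sup>+x. ennreal ((1 - lam) * max 0 (V x)) \<partial>\<rho>)"
      by (intro nn_integral_LIMSEQ up measurable_compose[OF meas\<rho>[OF t] measurable_ennreal])
        (auto simp: incseq_def le_fun_def intro: inc)
    ultimately show "(\<lambda>n. \<integral>\<^sup>+x. ennreal (t n x) \<partial>\<rho>) \<longlonglongrightarrow> (\<integral>\<^sup>+x. ennreal ((1 - lam) * V x) \<partial>\<rho>)"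
      by simp
    have "(\<integral>\<^sup>+x. ennreal (t n x) \<partial>\<rho>) = ennreal (\<integral>x. t n x \<partial>\<rho>)" for n
      by (rule nn_integral_eq_integral[OF int_t AE_I2]) (simp add: sp t_nonneg)
    then show "\<exists>N. \<forall>n\<ge>N. (\<integral>\<^sup>+x. ennreal (t n x) \<partial>\<rho>) \<le> ennreal b"
      using * by (simp add: ennreal_leI)
  qed
  have nonneg: "AE x in \<rho>. 0 \<le> (1 - lam) * V x"
    by (rule AE_I2) (use lam V_nonneg sp in simp)
  have int: "integrable \<rho> (\<lambda>x. (1 - lam) * V x)"
    by (rule integrableI_nonneg[OF meas\<rho> nonneg]) (use fin in \<open>auto simp: le_less_trans\<close>)
  then show "integrable \<rho> V" using lam by simp
  have "ennreal (\<integral>x. (1 - lam) * V x \<partial>\<rho>) \<le> ennreal b"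
    using fin unfolding nn_integral_eq_integral[OF int nonneg] .
  then have "(1 - lam) * (\<integral>x. V x \<partial>\<rho>) \<le> b"
    using b_pos by (subst (asm) ennreal_le_iff) auto
  then show "(\<integral>x. V x \<partial>\<rho>) \<le> b / (1 - lam)"
    using lam by (simp add: pos_le_divide_eq mult.commute)
qed

lemma invariant_integrable:
  assumes inv: "invariant_dist M Q \<rho>" and g: "dominated M V g"
  shows "integrable \<rho> g"
  by (rule dominated_integrable[OF g integrable_V_invariant(1)[OF inv]])
    (use inv in \<open>simp add: invariant_dist_def space_prob_algebra\<close>)

lemma invariant_E:
  assumes inv: "invariant_dist M Q \<rho>" and g: "dominated M V g"
  shows "(\<integral>x. E g x \<partial>\<rho>) = (\<integral>x. g x \<partial>\<rho>)"
proof -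
  have \<rho>: "sets \<rho> = sets M" "prob_space \<rho>" "\<rho> \<bind> Q = \<rho>" and sp: "space \<rho> = space M"
    using inv by (auto simp: invariant_dist_def space_prob_algebra dest: sets_eq_imp_space_eq)
  interpret prob_space \<rho> by (rule \<rho>(2))
  have Q\<rho>: "Q \<in> \<rho> \<rightarrow>\<^sub>M subprob_algebra M"
    using kernel_sub \<rho>(1) by (simp cong: measurable_cong_sets)
  show ?thesis
    using integral_bind_kernel(2)[OF Q\<rho> not_empty dominatedD[OF g]] integrable_dominated[OF g] sp \<rho>(3)
      invariant_integrable[OF inv g]
    by (auto simp: kernel_app_def)
qed

lemma invariant_abs_le:
  assumes inv: "invariant_dist M Q \<rho>" and g: "g \<in> borel_measurable M" and c: "0 \<le> c"
    "\<And>x. x \<in> space M \<Longrightarrow> \<bar>g x\<bar> \<le> c * V x"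
  shows "\<bar>\<integral>x. g x \<partial>\<rho>\<bar> \<le> c * (b / (1 - lam))"
proof -
  have sp: "space \<rho> = space M"
    using inv by (auto simp: invariant_dist_def space_prob_algebra dest: sets_eq_imp_space_eq)
  have dg: "dominated M V g" using g c by (rule dominatedI)
  have "\<bar>\<integral>x. g x \<partial>\<rho>\<bar> \<le> (\<integral>x. \<bar>g x\<bar> \<partial>\<rho>)" by (rule integral_abs_bound)
  also have "\<dots> \<le> (\<integral>x. c * V x \<partial>\<rho>)"
    by (intro integral_mono) (use invariant_integrable[OF inv] dg integrable_V_invariant(1)[OF inv] c sp in auto)
  also have "\<dots> \<le> c * (b / (1 - lam))"
    using mult_left_mono[OF integrable_V_invariant(2)[OF inv] c(1)] by simp
  finally show ?thesis .
qed

end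

lemma dominated_sub_weight:
  assumes "dominated M V g" "0 \<le> a" "\<And>x. x \<in> space M \<Longrightarrow> V x \<le> a * W x"
  shows "dominated M W g"
proof -
  obtain c where c: "0 \<le> c" "\<And>x. x \<in> space M \<Longrightarrow> \<bar>g x\<bar> \<le> c * V x" using assms(1) by (auto elim: dominatedE)
  show ?thesis
  proof (rule dominatedI[where c = "c * a"])
    show "\<bar>g x\<bar> \<le> (c * a) * W x" if "x \<in> space M" for x
      using c(2)[OF that] mult_left_mono[OF assms(3)[OF that] c(1)] by (simp add: mult.assoc)
  qed (use assms c in \<open>auto intro: dominatedD\<close>)
qed

section \<open>Poisson's equation\<close>

text \<open>The sum \<open>h\<close> of the series \<open>\<Sum>k. T\<^sup>k u\<close> solves \<open>h - T h = u\<close>. The interchange of \<open>T\<close> with the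
  limit of the partial sums uses only the contraction bound, applied to the tails of the series.\<close>
lemma neumann_series_weighted:
  fixes T :: "('x \<Rightarrow> real) \<Rightarrow> 'x \<Rightarrow> real"
  assumes meas: "\<And>g. dominated M W g \<Longrightarrow> T g \<in> borel_measurable M"
    and diff: "\<And>f g x. dominated M W f \<Longrightarrow> dominated M W g \<Longrightarrow> x \<in> space M \<Longrightarrow>
        T (\<lambda>y. f y - g y) x = T f x - T g x"
    and contr: "\<And>g c x. dominated M W g \<Longrightarrow> 0 \<le> c \<Longrightarrow> (\<And>y. y \<in> space M \<Longrightarrow> \<bar>g y\<bar> \<le> c * W y) \<Longrightarrow>
        x \<in> space M \<Longrightarrow> \<bar>T g x\<bar> \<le> c * r * W x"
    and r: "0 \<le> r" "r < 1"
    and u: "dominated M W u"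
  obtains h where "dominated M W h" "\<And>x. x \<in> space M \<Longrightarrow> h x - T h x = u x"
proof -
  obtain c where c: "0 \<le> c" "\<And>x. x \<in> space M \<Longrightarrow> \<bar>u x\<bar> \<le> c * W x" using u by (auto elim: dominatedE)
  define v where "v k = (T ^^ k) u" for k
  define s where "s n x = (\<Sum>k<n. v k x)" for n x
  define h where "h x = (\<Sum>k. v k x)" for x
  have v: "dominated M W (v k) \<and> (\<forall>x\<in>space M. \<bar>v k x\<bar> \<le> c * r ^ k * W x)" for k
  proof (induction k)
    case 0 then show ?case using u c by (simp add: v_def)
  next
    case (Suc k)
    have "\<bar>v (Suc k) x\<bar> \<le> (c * r ^ k) * r * W x" if "x \<in> space M" for x
      unfolding v_def funpow.simps comp_def
      by (rule contr) (use Suc c r that in \<open>auto simp: v_def\<close>)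
    then have le: "\<bar>v (Suc k) x\<bar> \<le> c * r ^ Suc k * W x" if "x \<in> space M" for x
      using that by (simp add: mult_ac)
    moreover have "v (Suc k) \<in> borel_measurable M"
      using meas[of "v k"] Suc by (simp add: v_def)
    ultimately show ?case
      using c r by (auto intro!: dominatedI[where c = "c * r ^ Suc k"])
  qed
  have dv: "dominated M W (v k)" for k using v by blast
  have ds: "dominated M W (s n)" for n
    unfolding s_def[abs_def] by (rule dominated_sum) (rule dv)
  have sm: "summable (\<lambda>k. v k x)" if "x \<in> space M" for x
  proof (rule summable_comparison_test')
    show "summable (\<lambda>k. c * r ^ k * W x)"
      using r by (intro summable_mult2 summable_mult summable_geometric) auto
    show "norm (v k x) \<le> c * r ^ k * W x" if "0 \<le> k" for k
      using v[of k] \<open>x \<in> space M\<close> by simp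
  qed
  have lim: "(\<lambda>n. s n x) \<longlonglongrightarrow> h x" if "x \<in> space M" for x
    using summable_LIMSEQ[OF sm[OF that]] by (simp add: s_def h_def)
  have tail: "\<bar>h x - s n x\<bar> \<le> (c * r ^ n / (1 - r)) * W x" if x: "x \<in> space M" for n x
  proof -
    have geo: "summable (\<lambda>k. c * r ^ (k + n) * W x)"
      using r by (simp add: power_add) (intro summable_mult2 summable_mult summable_geometric; simp)
    have "h x - s n x = (\<Sum>k. v (k + n) x)"
      unfolding h_def s_def using suminf_split_initial_segment[OF sm[OF x], of n] by simp
    moreover have "\<bar>\<Sum>k. v (k + n) x\<bar> \<le> (\<Sum>k. c * r ^ (k + n) * W x)"
    proof (rule order_trans[OF summable_rabs[OF summable_comparison_test'[OF geo]]])
      show "norm \<bar>v (k + n) x\<bar> \<le> c * r ^ (k + n) * W x" if "0 \<le> k" for k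
        using v[of "k + n"] x by simp
      show "(\<Sum>k. \<bar>v (k + n) x\<bar>) \<le> (\<Sum>k. c * r ^ (k + n) * W x)"
        by (rule suminf_le[OF _ summable_comparison_test'[OF geo] geo]) (use v x in auto)
    qed
    moreover have "(\<Sum>k. c * r ^ (k + n) * W x) = (\<Sum>k. (c * r ^ n * W x) * r ^ k)"
      by (simp add: power_add mult_ac)
    moreover have "\<dots> = (c * r ^ n * W x) * (1 / (1 - r))"
      using r by (subst suminf_mult) (auto simp: suminf_geometric)
    ultimately show ?thesis by simp
  qed
  have dh: "dominated M W h"
  proof (rule dominatedI[where c = "c / (1 - r)"])
    show "h \<in> borel_measurable M"
      unfolding h_def[abs_def] by (rule borel_measurable_suminf) (rule dominatedD[OF dv])
    show "\<bar>h x\<bar> \<le> c / (1 - r) * W x" if "x \<in> space M" for x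
      using tail[OF that, of 0] by (simp add: s_def)
  qed (use c r in simp)
  have Ts: "T (s n) x = s (Suc n) x - u x" if x: "x \<in> space M" for n x
  proof (induction n)
    case 0
    have "\<bar>T (s 0) x\<bar> \<le> 0 * r * W x" by (rule contr[OF ds _ _ x]) (auto simp: s_def)
    then have "T (s 0) x = 0" by simp
    moreover have "s (Suc 0) x - u x = 0" by (simp add: s_def v_def)
    ultimately show ?case by (simp only:)
  next
    case (Suc n)
    have "s n = (\<lambda>y. s (Suc n) y - v n y)" by (auto simp: s_def)
    then have "T (s n) x = T (s (Suc n)) x - T (v n) x"
      using diff[OF ds dv x] by simp
    moreover have "T (v n) x = s (Suc (Suc n)) x - s (Suc n) x" by (simp add: s_def v_def)
    ultimately show ?case using Suc by linarith
  qed
  have "h x - T h x = u x" if x: "x \<in> space M" for x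
  proof -
    have "(\<lambda>n. T h x - T (s n) x) \<longlonglongrightarrow> 0"
    proof (rule Lim_null_comparison)
      show "\<forall>\<^sub>F n in sequentially. norm (T h x - T (s n) x) \<le> r ^ n * (c / (1 - r) * r * W x)"
      proof (intro always_eventually allI)
        fix n
        have "\<bar>T (\<lambda>y. h y - s n y) x\<bar> \<le> (c * r ^ n / (1 - r)) * r * W x"
          by (rule contr[OF dominated_diff[OF dh ds] _ tail x]) (use c r in auto)
        then show "norm (T h x - T (s n) x) \<le> r ^ n * (c / (1 - r) * r * W x)"
          using diff[OF dh ds x] by (simp add: mult_ac)
      qed
      show "(\<lambda>n. r ^ n * (c / (1 - r) * r * W x)) \<longlonglongrightarrow> 0"
        using r by (intro tendsto_mult_left_zero LIMSEQ_realpow_zero)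
    qed
    then have "(\<lambda>n. T h x - (s (Suc n) x - u x)) \<longlonglongrightarrow> 0" using Ts[OF x] by simp
    moreover have "(\<lambda>n. T h x - (s (Suc n) x - u x)) \<longlonglongrightarrow> T h x - (h x - u x)"
      by (intro tendsto_diff tendsto_const LIMSEQ_Suc[OF lim[OF x]])
    ultimately have "T h x - (h x - u x) = 0" by (metis LIMSEQ_unique)
    then show ?thesis by simp
  qed
  with dh show thesis by (rule that)
qed

context drift_kernel
begin

lemma dominated_iter: "dominated M V g \<Longrightarrow> dominated M V ((E ^^ k) g)"
  by (induction k) (simp_all add: dominated_E)

lemma iter_mono:
  assumes "dominated M V f" "dominated M V g" "\<And>y. y \<in> space M \<Longrightarrow> f y \<le> g y" "x \<in> space M"
  shows "(E ^^ k) f x \<le> (E ^^ k) g x"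
  using assms(4) by (induction k arbitrary: x) (auto intro!: E_mono dominated_iter assms)

lemma iter_cmult: "(E ^^ k) (\<lambda>y. a * f y) = (\<lambda>x. a * (E ^^ k) f x)"
  by (induction k) (simp_all add: E_cmult[abs_def])

lemma iter_diff:
  assumes f: "dominated M V f" and g: "dominated M V g"
  shows "x \<in> space M \<Longrightarrow> (E ^^ k) (\<lambda>y. f y - g y) x = (E ^^ k) f x - (E ^^ k) g x"
proof (induction k arbitrary: x)
  case (Suc k)
  have "(E ^^ Suc k) (\<lambda>y. f y - g y) x = E (\<lambda>y. (E ^^ k) f y - (E ^^ k) g y) x"
    using Suc.IH Suc.prems by (auto intro: E_cong)
  also have "\<dots> = (E ^^ Suc k) f x - (E ^^ Suc k) g x"
    using E_diff[OF dominated_iter[OF f] dominated_iter[OF g] Suc.prems] by simp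
  finally show ?case .
qed simp

lemma iter_add:
  assumes f: "dominated M V f" and g: "dominated M V g" and x: "x \<in> space M"
  shows "(E ^^ k) (\<lambda>y. f y + g y) x = (E ^^ k) f x + (E ^^ k) g x"
  using iter_diff[OF dominated_add[OF f g] g x, of k] by simp

lemma iter_const: "x \<in> space M \<Longrightarrow> (E ^^ k) (\<lambda>_. a) x = a"
proof (induction k arbitrary: x)
  case (Suc k)
  have "(E ^^ Suc k) (\<lambda>_. a) x = E (\<lambda>_. a) x"
    using Suc by (auto intro: E_cong)
  then show ?case using E_const[OF Suc.prems] by simp
qed simp

lemma iter_nonneg:
  "dominated M V g \<Longrightarrow> (\<And>y. y \<in> space M \<Longrightarrow> 0 \<le> g y) \<Longrightarrow> x \<in> space M \<Longrightarrow> 0 \<le> (E ^^ k) g x"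
  using iter_mono[OF dominated_const[of 0], of g x k] iter_const[of x k 0] by simp

lemma invariant_iter:
  "invariant_dist M Q \<rho> \<Longrightarrow> dominated M V g \<Longrightarrow> (\<integral>x. (E ^^ k) g x \<partial>\<rho>) = (\<integral>x. g x \<partial>\<rho>)"
  by (induction k) (simp_all add: invariant_E dominated_iter)

lemma iter_V_le:
  assumes "x \<in> space M"
  shows "(E ^^ k) V x \<le> lam ^ k * V x + (1 - lam ^ k) * (b / (1 - lam))"
  using assms
proof (induction k arbitrary: x)
  case (Suc k)
  define C where "C = (b / (1 - lam))"
  have eq: "b + lam * C = C" using lam by (simp add: C_def field_simps)
  have "(E ^^ Suc k) V x \<le> E (\<lambda>y. lam ^ k * V y + (1 - lam ^ k) * C) x"
    unfolding C_def using Suc by (auto intro!: E_mono dominated_intros dominated_iter dominated_V dominated_const)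
  also have "\<dots> = lam ^ k * E V x + (1 - lam ^ k) * C"
    using E_add[OF dominated_cmult[OF dominated_V] dominated_const Suc.prems] E_const[OF Suc.prems]
    by (simp add: E_cmult)
  also have "\<dots> \<le> lam ^ k * (lam * V x + b) + (1 - lam ^ k) * C"
    using E_V_le[OF Suc.prems] b_pos lam
    by (intro add_right_mono mult_left_mono) (auto split: split_indicator_asm)
  also have "\<dots> = lam ^ Suc k * V x + lam ^ k * (b + lam * C) + (1 - lam ^ k - lam ^ k * lam) * C"
    by (simp add: algebra_simps)
  also have "\<dots> = lam ^ Suc k * V x + (1 - lam ^ Suc k) * C"
    unfolding eq by (simp add: algebra_simps)
  finally show ?case unfolding C_def .
qed simp

text \<open>Each step multiplies \<open>V\<close> by \<open>lam\<close> except for a gain of \<open>b\<close> for every visit to \<open>K\<close>; so a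
  large number of steps without visits to \<open>K\<close> would push the mean of \<open>V\<close> below one.\<close>
lemma iter_V_le_occupation:
  assumes "x \<in> space M"
  shows "(E ^^ n) V x \<le> lam ^ n * V x + b * (\<Sum>k<n. (E ^^ k) (indicator K) x)"
  using assms
proof (induction n arbitrary: x)
  case (Suc n)
  note dK = dominated_indicator[OF K_sets]
  have "(E ^^ Suc n) V x = (E ^^ n) (E V) x" by (simp add: funpow_swap1)
  also have "\<dots> \<le> (E ^^ n) (\<lambda>y. lam * V y + b * indicator K y) x"
    using Suc.prems E_V_le
    by (intro iter_mono dominated_E dominated_intros dominated_V dK) auto
  also have "\<dots> = lam * (E ^^ n) V x + b * (E ^^ n) (indicator K) x"
    using iter_add[OF dominated_cmult[OF dominated_V] dominated_cmult[OF dK] Suc.prems]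
    by (simp add: iter_cmult)
  also have "\<dots> \<le> lam * (lam ^ n * V x + b * (\<Sum>k<n. (E ^^ k) (indicator K) x)) + b * (E ^^ n) (indicator K) x"
    using Suc lam by (intro add_right_mono mult_left_mono) auto
  also have "\<dots> \<le> lam ^ Suc n * V x + 1 * (b * (\<Sum>k<n. (E ^^ k) (indicator K) x)) + b * (E ^^ n) (indicator K) x"
  proof -
    have "0 \<le> b * (\<Sum>k<n. (E ^^ k) (indicator K) x)"
      using b_pos Suc.prems by (intro mult_nonneg_nonneg sum_nonneg iter_nonneg dK) auto
    then have "lam * (b * (\<Sum>k<n. (E ^^ k) (indicator K) x)) \<le> 1 * (b * (\<Sum>k<n. (E ^^ k) (indicator K) x))"
      using lam by (intro mult_right_mono) auto
    then show ?thesis by (simp add: algebra_simps)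
  qed
  finally show ?case by (simp add: algebra_simps)
qed simp

text \<open>Here that contradiction is made quantitative: \<open>N\<close> is chosen with \<open>lam ^ N * R < 1 / 2\<close>, and the
  other half of \<open>1 \<le> V\<close> must come from visits to \<open>K\<close>.\<close>
lemma occupation_lower_bound:
  obtains N where "1 \<le> N"
    "\<And>x. x \<in> space M \<Longrightarrow> V x \<le> R \<Longrightarrow> 1 / (2 * b) \<le> (\<Sum>k<N. (E ^^ k) (indicator K) x)"
proof -
  have "(\<lambda>n. lam ^ n * \<bar>R\<bar>) \<longlonglongrightarrow> 0 * \<bar>R\<bar>"
    using lam by (intro tendsto_mult LIMSEQ_realpow_zero tendsto_const) auto
  then have "\<forall>\<^sub>F n in sequentially. lam ^ n * \<bar>R\<bar> < 1 / 2"
    by (intro order_tendstoD) auto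
  then obtain N0 where N0: "\<And>n. n \<ge> N0 \<Longrightarrow> lam ^ n * \<bar>R\<bar> < 1 / 2"
    by (auto simp: eventually_sequentially)
  define N where "N = Suc N0"
  have "1 / (2 * b) \<le> (\<Sum>k<N. (E ^^ k) (indicator K) x)" if x: "x \<in> space M" "V x \<le> R" for x
  proof -
    have "1 \<le> (E ^^ N) V x"
      using iter_mono[OF dominated_const[of 1] dominated_V V_ge_1 x(1), of N] iter_const[OF x(1), of N 1] by simp
    moreover have "lam ^ N * V x \<le> lam ^ N * \<bar>R\<bar>"
      using x lam by (intro mult_left_mono) auto
    ultimately have "1 / 2 \<le> b * (\<Sum>k<N. (E ^^ k) (indicator K) x)"
      using iter_V_le_occupation[OF x(1), of N] N0[of N] by (simp add: N_def)
    then show ?thesis using b_pos by (simp add: field_simps)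
  qed
  with that[of N] show thesis by (simp add: N_def)
qed

lemma kernel_pow_measurable: "kernel_pow M Q k \<in> M \<rightarrow>\<^sub>M prob_algebra M"
proof (induction k)
  case 0
  have "kernel_pow M Q 0 = return M" by auto
  then show ?case using measurable_return_prob_space by simp
next
  case (Suc k)
  have "kernel_pow M Q (Suc k) = (\<lambda>x. Q x \<bind> kernel_pow M Q k)" by auto
  then show ?case using measurable_bind_prob_space[OF kernel Suc] by simp
qed

lemma nn_integral_kernel_pow:
  assumes g: "dominated M V g" and pos: "\<And>y. y \<in> space M \<Longrightarrow> 0 \<le> g y" and x: "x \<in> space M"
  shows "(\<integral>\<^sup>+y. ennreal (g y) \<partial>(kernel_pow M Q k x)) = ennreal ((E ^^ k) g x)"
  using x
proof (induction k arbitrary: x)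
  case 0
  then show ?case using dominatedD[OF g] by (simp add: nn_integral_return)
next
  case (Suc k)
  have gm: "(\<lambda>y. ennreal (g y)) \<in> borel_measurable M" using dominatedD[OF g] by measurable
  have kp: "kernel_pow M Q k \<in> Q x \<rightarrow>\<^sub>M subprob_algebra M"
    using measurable_prob_algebraD[OF kernel_pow_measurable[of k]] sets_Q[OF Suc.prems]
    by (simp cong: measurable_cong_sets)
  have "(\<integral>\<^sup>+y. ennreal (g y) \<partial>(kernel_pow M Q (Suc k) x))
      = (\<integral>\<^sup>+z. (\<integral>\<^sup>+y. ennreal (g y) \<partial>(kernel_pow M Q k z)) \<partial>(Q x))"
    unfolding kernel_pow.simps by (rule nn_integral_bind[OF gm kp])
  also have "\<dots> = (\<integral>\<^sup>+z. ennreal ((E ^^ k) g z) \<partial>(Q x))"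
    using Suc by (intro nn_integral_cong) (simp add: space_Q)
  also have "\<dots> = ennreal (E ((E ^^ k) g) x)"
    unfolding kernel_app_def[of Q "(E ^^ k) g"] using Suc.prems g pos
    by (intro nn_integral_eq_integral integrable_dominated dominated_iter AE_I2 iter_nonneg)
      (auto simp: space_Q)
  finally show ?case by simp
qed

end

locale small_drift_kernel = drift_kernel +
  fixes m :: nat and \<delta> :: real and \<nu> :: "'a measure"
  assumes m: "1 \<le> m" and \<delta>: "0 < \<delta>" and \<nu>: "\<nu> \<in> space (prob_algebra M)"
    and minorization: "x \<in> K \<Longrightarrow> A \<in> sets M \<Longrightarrow>
      ennreal \<delta> * emeasure \<nu> A \<le> emeasure (kernel_pow M Q m x) A"
    and nonempty: "space M \<noteq> {}"
begin

lemma sets_\<nu>: "sets \<nu> = sets M" and space_\<nu>: "space \<nu> = space M" and prob_\<nu>: "prob_space \<nu>"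
  using \<nu> by (auto simp: space_prob_algebra dest: sets_eq_imp_space_eq)

lemma minorization_nn:
  assumes g: "dominated M V g" and pos: "\<And>y. y \<in> space M \<Longrightarrow> 0 \<le> g y" and x: "x \<in> K"
  shows "ennreal \<delta> * (\<integral>\<^sup>+y. ennreal (g y) \<partial>\<nu>) \<le> ennreal ((E ^^ m) g x)"
proof -
  have xM: "x \<in> space M" using x sets.sets_into_space[OF K_sets] by auto
  have s: "sets (kernel_pow M Q m x) = sets M"
    using measurable_space[OF kernel_pow_measurable xM] by (simp add: space_prob_algebra)
  have "ennreal \<delta> * (\<integral>\<^sup>+y. ennreal (g y) \<partial>\<nu>) = (\<integral>\<^sup>+y. ennreal (g y) \<partial>(scale_measure (ennreal \<delta>) \<nu>))"
    using dominatedD[OF g] sets_\<nu>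
    by (intro nn_integral_scale_measure[symmetric]) (simp cong: measurable_cong_sets)
  also have "\<dots> \<le> (\<integral>\<^sup>+y. ennreal (g y) \<partial>(kernel_pow M Q m x))"
  proof (rule nn_integral_mono_measure)
    have "ennreal \<delta> * emeasure \<nu> A \<le> emeasure (kernel_pow M Q m x) A" for A
      using minorization[OF x] by (cases "A \<in> sets M") (simp_all add: emeasure_notin_sets sets_\<nu>)
    then show "scale_measure (ennreal \<delta>) \<nu> \<le> kernel_pow M Q m x"
      using s sets_\<nu> sets_eq_imp_space_eq[OF s] space_\<nu>
      by (simp add: le_measure_iff le_fun_def space_scale_measure)
  qed (simp add: s sets_\<nu>)
  also have "\<dots> = ennreal ((E ^^ m) g x)" by (rule nn_integral_kernel_pow[OF g pos xM])
  finally show ?thesis .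
qed

text \<open>Needed to see that \<open>V\<close> is integrable under \<open>\<nu>\<close>: the minorization at a single point of \<open>K\<close>
  bounds the integral.\<close>
lemma K_nonempty: "K \<noteq> {}"
proof
  assume "K = {}"
  then have ind: "(indicator K :: 'a \<Rightarrow> real) = (\<lambda>_. 0)" by auto
  obtain x where x: "x \<in> space M" using nonempty by auto
  obtain N where "1 / (2 * b) \<le> (\<Sum>k<N. (E ^^ k) (indicator K) x)"
    using occupation_lower_bound[of "V x"] x by (metis order_refl)
  then show False using b_pos by (simp add: ind iter_const[OF x])
qed

lemma integrable_\<nu>:
  assumes g: "dominated M V g"
  shows "integrable \<nu> g"
proof (rule dominated_integrable[OF g _ sets_\<nu>], rule integrableI_nonneg)
  show "V \<in> borel_measurable \<nu>" using sets_\<nu> V_meas by (simp cong: measurable_cong_sets)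
  show "AE x in \<nu>. 0 \<le> V x" using V_nonneg space_\<nu> by (intro AE_I2) auto
  obtain x where "x \<in> K" using K_nonempty by auto
  then have "ennreal \<delta> * (\<integral>\<^sup>+y. ennreal (V y) \<partial>\<nu>) < \<infinity>"
    using minorization_nn[OF dominated_V V_nonneg] by (metis ennreal_less_top infinity_ennreal_def le_less_trans)
  then show "(\<integral>\<^sup>+y. ennreal (V y) \<partial>\<nu>) < \<infinity>"
    using \<delta> by (auto simp: ennreal_mult_less_top)
qed

lemma minorization_integral:
  assumes g: "dominated M V g" and pos: "\<And>y. y \<in> space M \<Longrightarrow> 0 \<le> g y" and x: "x \<in> K"
  shows "\<delta> * (\<integral>y. g y \<partial>\<nu>) \<le> (E ^^ m) g x"
proof -
  have xM: "x \<in> space M" using x sets.sets_into_space[OF K_sets] by auto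
  have "(\<integral>\<^sup>+y. ennreal (g y) \<partial>\<nu>) = ennreal (\<integral>y. g y \<partial>\<nu>)"
    using pos space_\<nu> by (intro nn_integral_eq_integral integrable_\<nu> g AE_I2) auto
  then have "ennreal (\<delta> * (\<integral>y. g y \<partial>\<nu>)) \<le> ennreal ((E ^^ m) g x)"
    using minorization_nn[OF assms] \<delta> by (simp add: ennreal_mult')
  then show ?thesis using iter_nonneg[OF g pos xM] by (simp add: ennreal_le_iff)
qed

text \<open>Averaging over \<open>N\<close> consecutive times, after a delay of \<open>m\<close>, removes the effect of periodicity:
  from a sublevel set of \<open>V\<close> some time below \<open>N\<close> sees the chain in \<open>K\<close>, and \<open>m\<close> steps later
  it has a component \<open>\<nu>\<close>.\<close>
definition sampled :: "nat \<Rightarrow> ('a \<Rightarrow> real) \<Rightarrow> 'a \<Rightarrow> real" where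
  "sampled N g x = (1 / real N) * (\<Sum>k<N. (E ^^ (k + m)) g x)"

lemma dominated_sampled: "dominated M V g \<Longrightarrow> dominated M V (sampled N g)"
  unfolding sampled_def[abs_def] by (intro dominated_intros dominated_iter)

lemma sampled_diff:
  assumes "dominated M V f" "dominated M V g" "x \<in> space M"
  shows "sampled N (\<lambda>y. f y - g y) x = sampled N f x - sampled N g x"
  using assms by (simp add: sampled_def iter_diff sum_subtractf right_diff_distrib)

lemma sampled_mono:
  assumes "dominated M V f" "dominated M V g" "\<And>y. y \<in> space M \<Longrightarrow> f y \<le> g y" "x \<in> space M"
  shows "sampled N f x \<le> sampled N g x"
  unfolding sampled_def using assms by (intro mult_left_mono sum_mono iter_mono) auto

lemma sampled_cmult: "sampled N (\<lambda>y. a * f y) x = a * sampled N f x"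
  by (simp add: sampled_def iter_cmult sum_distrib_left mult_ac)

lemma sampled_add:
  assumes "dominated M V f" "dominated M V g" "x \<in> space M"
  shows "sampled N (\<lambda>y. f y + g y) x = sampled N f x + sampled N g x"
  using assms by (simp add: sampled_def iter_add sum.distrib distrib_left add_divide_distrib)

lemma sampled_const: "1 \<le> N \<Longrightarrow> x \<in> space M \<Longrightarrow> sampled N (\<lambda>_. a) x = a"
  by (simp add: sampled_def iter_const)

lemma invariant_sampled:
  assumes inv: "invariant_dist M Q \<rho>" and g: "dominated M V g" and N: "1 \<le> N"
  shows "(\<integral>x. sampled N g x \<partial>\<rho>) = (\<integral>x. g x \<partial>\<rho>)"
proof -
  have "(\<integral>x. sampled N g x \<partial>\<rho>) = (1 / real N) * (\<Sum>k<N. \<integral>x. (E ^^ (k + m)) g x \<partial>\<rho>)"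
    unfolding sampled_def by (simp add: invariant_integrable[OF inv dominated_iter[OF g]])
  then show ?thesis using N by (simp add: invariant_iter[OF inv g])
qed

lemma sampled_V_le:
  assumes N: "1 \<le> N" and x: "x \<in> space M"
  shows "sampled N V x \<le> lam * V x + b / (1 - lam)"
proof -
  have "(E ^^ (k + m)) V x \<le> lam * V x + b / (1 - lam)" for k
  proof -
    have pw: "0 \<le> lam ^ (k + m)" "lam ^ (k + m) \<le> lam"
      using lam m power_decreasing[of 1 "k + m" lam] by auto
    have "lam ^ (k + m) * V x + (1 - lam ^ (k + m)) * (b / (1 - lam)) \<le> lam * V x + 1 * (b / (1 - lam))"
      using pw V_nonneg[OF x] lam b_pos by (intro add_mono mult_right_mono) auto
    then show ?thesis using iter_V_le[OF x, of "k + m"] by simp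
  qed
  then have "(\<Sum>k<N. (E ^^ (k + m)) V x) \<le> (\<Sum>k<N. lam * V x + b / (1 - lam))"
    by (intro sum_mono)
  then show ?thesis using N by (simp add: sampled_def field_simps)
qed

lemma sampled_minorization:
  obtains N \<eta> where "1 \<le> N" "0 < \<eta>"
    "\<And>x g. x \<in> space M \<Longrightarrow> V x \<le> R \<Longrightarrow> dominated M V g \<Longrightarrow> (\<And>y. y \<in> space M \<Longrightarrow> 0 \<le> g y) \<Longrightarrow>
      \<eta> * (\<integral>y. g y \<partial>\<nu>) \<le> sampled N g x"
proof -
  obtain N where N: "1 \<le> N"
    "\<And>x. x \<in> space M \<Longrightarrow> V x \<le> R \<Longrightarrow> 1 / (2 * b) \<le> (\<Sum>k<N. (E ^^ k) (indicator K) x)"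
    using occupation_lower_bound[of R] by blast
  \<comment> \<open>weight of the average, times mass gained per visit to \<open>K\<close>, times the least expected number of visits\<close>
  define \<eta> where "\<eta> = (1 / real N) * (\<delta> * (1 / (2 * b)))"
  have "\<eta> * (\<integral>y. g y \<partial>\<nu>) \<le> sampled N g x"
    if x: "x \<in> space M" "V x \<le> R" and g: "dominated M V g" and pos: "\<And>y. y \<in> space M \<Longrightarrow> 0 \<le> g y" for x g
  proof -
    let ?c = "\<delta> * (\<integral>y. g y \<partial>\<nu>)"
    have c: "0 \<le> ?c" using pos space_\<nu> \<delta> by (intro mult_nonneg_nonneg Bochner_Integration.integral_nonneg_AE AE_I2) auto
    have "?c * (E ^^ k) (indicator K) x \<le> (E ^^ (k + m)) g x" for k
    proof -
      have "(E ^^ k) (\<lambda>y. ?c * indicator K y) x \<le> (E ^^ k) ((E ^^ m) g) x"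
      proof (rule iter_mono[OF _ _ _ x(1)])
        show "?c * indicator K y \<le> (E ^^ m) g y" if "y \<in> space M" for y
          using minorization_integral[OF g pos] iter_nonneg[OF g pos that]
          by (auto split: split_indicator)
      qed (intro dominated_intros dominated_iter dominated_indicator K_sets g)+
      then show ?thesis by (simp add: iter_cmult funpow_add)
    qed
    then have "?c * (\<Sum>k<N. (E ^^ k) (indicator K) x) \<le> (\<Sum>k<N. (E ^^ (k + m)) g x)"
      unfolding sum_distrib_left by (rule sum_mono)
    moreover have "?c * (1 / (2 * b)) \<le> ?c * (\<Sum>k<N. (E ^^ k) (indicator K) x)"
      by (rule mult_left_mono[OF N(2)[OF x] c])
    ultimately have "?c * (1 / (2 * b)) \<le> (\<Sum>k<N. (E ^^ (k + m)) g x)" by linarith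
    then have "(1 / real N) * (?c * (1 / (2 * b))) \<le> sampled N g x"
      unfolding sampled_def by (rule mult_left_mono) simp
    then show ?thesis by (simp add: \<eta>_def mult_ac)
  qed
  moreover have "0 < \<eta>" using N \<delta> b_pos by (simp add: \<eta>_def)
  ultimately show thesis using that N(1) by blast
qed

text \<open>The numerical core of the contraction, with \<open>v\<close> in the role of \<open>V x\<close>. For small \<open>v\<close> the removed
  mass \<open>\<eta>\<close> pays for the drift constant if \<open>\<beta> C = \<eta> / 2\<close>. For \<open>v > 2 C / (1 - lam)\<close> the drift
  alone contracts by the factor \<open>\<gamma> = (1 + lam) / 2\<close>. The contraction rate is \<open>r = 1 - t\<close>.\<close>
lemma drift_minus_atom_contracts:
  fixes C \<eta> :: real
  assumes C: "0 < C" and \<eta>: "0 < \<eta>"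
  obtains \<beta> r where "0 < \<beta>" "0 \<le> r" "r < 1"
    "\<And>v. 1 \<le> v \<Longrightarrow> v \<le> 2 * C / (1 - lam) \<Longrightarrow> 1 + \<beta> * (lam * v + C) - \<eta> \<le> r * (1 + \<beta> * v)"
    "\<And>v. 2 * C / (1 - lam) < v \<Longrightarrow> 1 + \<beta> * (lam * v + C) \<le> r * (1 + \<beta> * v)"
proof -
  define \<beta> where "\<beta> = \<eta> / (2 * C)"
  define R where "R = 2 * C / (1 - lam)"
  define \<gamma> where "\<gamma> = (1 + lam) / 2"
  \<comment> \<open>The first two bounds on \<open>t\<close> serve small \<open>v\<close>; the third is the inequality for large \<open>v\<close> at its worst
    point \<open>v = R\<close>.\<close>
  define t where "t = min (min (\<eta> / 2) (1 - lam)) (\<beta> * (1 - \<gamma>) * R / (1 + \<beta> * R))"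
  have \<beta>: "0 < \<beta>" "\<beta> * C = \<eta> / 2" using C \<eta> by (auto simp: \<beta>_def)
  have R: "0 < R" using C lam by (simp add: R_def)
  have \<gamma>: "0 < \<gamma>" "\<gamma> < 1" using lam by (auto simp: \<gamma>_def)
  have "0 < 1 + \<beta> * R" using \<beta> R by (simp add: add_pos_pos)
  then have t: "0 < t" "t \<le> \<eta> / 2" "t \<le> 1 - lam" "t * (1 + \<beta> * R) \<le> \<beta> * (1 - \<gamma>) * R"
  proof -
    assume pos: "0 < 1 + \<beta> * R"
    have "0 < \<beta> * (1 - \<gamma>) * R / (1 + \<beta> * R)" using pos \<beta> \<gamma> R by simp
    then show "0 < t" using \<eta> lam by (simp add: t_def)
    have "t \<le> \<beta> * (1 - \<gamma>) * R / (1 + \<beta> * R)" by (simp add: t_def)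
    then show "t * (1 + \<beta> * R) \<le> \<beta> * (1 - \<gamma>) * R" using pos by (simp add: pos_le_divide_eq)
    show "t \<le> \<eta> / 2" "t \<le> 1 - lam" unfolding t_def by linarith+
  qed
  have 1: "1 + \<beta> * (lam * v + C) - \<eta> \<le> (1 - t) * (1 + \<beta> * v)" if "1 \<le> v" for v
  proof -
    have "\<beta> * v * t \<le> \<beta> * v * (1 - lam)" using \<beta> that t by (intro mult_left_mono) auto
    then show ?thesis using t(2) \<beta>(2) by (simp add: algebra_simps)
  qed
  have 2: "1 + \<beta> * (lam * v + C) \<le> (1 - t) * (1 + \<beta> * v)" if v: "R < v" for v
  proof -
    have "2 * C \<le> (1 - lam) * v" using v lam by (simp add: R_def field_simps)
    then have "lam * v + C \<le> \<gamma> * v" by (simp add: \<gamma>_def algebra_simps)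
    then have a: "\<beta> * (lam * v + C) \<le> \<beta> * (\<gamma> * v)" using \<beta> by (intro mult_left_mono) auto
    have "t \<le> \<beta> * R * (1 - \<gamma> - t)" using t(4) by (simp add: algebra_simps)
    moreover have "0 \<le> 1 - \<gamma> - t"
    proof (rule ccontr)
      assume "\<not> 0 \<le> 1 - \<gamma> - t"
      then have "\<beta> * R * (1 - \<gamma> - t) < 0" using \<beta> R by (simp add: mult_pos_neg)
      with \<open>t \<le> \<beta> * R * (1 - \<gamma> - t)\<close> t(1) show False by simp
    qed
    moreover have "\<beta> * R \<le> \<beta> * v" using v \<beta> by (intro mult_left_mono) auto
    ultimately have "t \<le> \<beta> * v * (1 - \<gamma> - t)"
      using mult_right_mono[of "\<beta> * R" "\<beta> * v" "1 - \<gamma> - t"] by linarith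
    then show ?thesis using a by (simp add: algebra_simps)
  qed
  show thesis
    by (rule that[of \<beta> "1 - t"]) (use \<beta> t lam 1 2 in \<open>auto simp: R_def\<close>)
qed

text \<open>The residual operator \<open>T g = sampled N g - s (\<integral>g d\<nu>)\<close> is positive by the minorization,
  hence a bound on \<open>T W\<close> alone makes it a contraction in the weight \<open>W\<close>.\<close>
lemma residual_solution:
  obtains N s where "1 \<le> N" "dominated M V s"
    "\<And>u. dominated M V u \<Longrightarrow> \<exists>h. dominated M V h \<and>
      (\<forall>x\<in>space M. h x - sampled N h x + s x * (\<integral>y. h y \<partial>\<nu>) = u x)"
proof -
  define C where "C = b / (1 - lam)"
  define R where "R = 2 * C / (1 - lam)"
  have C: "0 < C" using b_pos lam by (simp add: C_def)
  obtain N \<eta> where N: "1 \<le> N" "0 < \<eta>"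
    and minor: "\<And>x g. x \<in> space M \<Longrightarrow> V x \<le> R \<Longrightarrow> dominated M V g \<Longrightarrow>
      (\<And>y. y \<in> space M \<Longrightarrow> 0 \<le> g y) \<Longrightarrow> \<eta> * (\<integral>y. g y \<partial>\<nu>) \<le> sampled N g x"
    using sampled_minorization[of R] by metis
  obtain \<beta> r where \<beta>: "0 < \<beta>" "0 \<le> r" "r < 1"
    and small: "\<And>v. 1 \<le> v \<Longrightarrow> v \<le> R \<Longrightarrow> 1 + \<beta> * (lam * v + C) - \<eta> \<le> r * (1 + \<beta> * v)"
    and large: "\<And>v. R < v \<Longrightarrow> 1 + \<beta> * (lam * v + C) \<le> r * (1 + \<beta> * v)"
    using drift_minus_atom_contracts[OF C N(2)] unfolding R_def by metis
  define W where "W x = 1 + \<beta> * V x" for x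
  define s where "s x = \<eta> * indicator {x\<in>space M. V x \<le> R} x" for x
  define T where "T g x = sampled N g x - s x * (\<integral>y. g y \<partial>\<nu>)" for g x
  have ds: "dominated M V s"
    unfolding s_def[abs_def] by (intro dominated_cmult dominated_indicator) measurable
  have dW: "dominated M V W"
    unfolding W_def[abs_def] by (intro dominated_intros dominated_const dominated_V)
  have domW: "dominated M W g \<longleftrightarrow> dominated M V g" for g
  proof
    assume "dominated M W g"
    then show "dominated M V g"
      by (rule dominated_sub_weight[where a = "1 + \<beta>"]) (use \<beta> V_ge_1 in \<open>auto simp: W_def algebra_simps\<close>)
  next
    assume "dominated M V g"
    then show "dominated M W g"
      by (rule dominated_sub_weight[where a = "1 / \<beta>"]) (use \<beta> in \<open>auto simp: W_def field_simps\<close>)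
  qed
  \<comment> \<open>On the sublevel set this is the minorization; elsewhere nothing has been subtracted.\<close>
  have T_nonneg: "0 \<le> T g x"
    if g: "dominated M V g" and pos: "\<And>y. y \<in> space M \<Longrightarrow> 0 \<le> g y" and x: "x \<in> space M" for g x
  proof (cases "V x \<le> R")
    case True
    then show ?thesis using minor[OF x True g pos] x by (simp add: T_def s_def)
  next
    case False
    then show ?thesis using sampled_mono[OF dominated_const[of 0] g pos x, of N] sampled_const[OF N(1) x, of 0]
      by (simp add: T_def s_def)
  qed
  have T_diff: "T (\<lambda>y. f y - g y) x = T f x - T g x"
    if "dominated M V f" "dominated M V g" "x \<in> space M" for f g x
    using that by (simp add: T_def sampled_diff integrable_\<nu> right_diff_distrib)
  have T_add: "T (\<lambda>y. f y + g y) x = T f x + T g x"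
    if "dominated M V f" "dominated M V g" "x \<in> space M" for f g x
    using that by (simp add: T_def sampled_add integrable_\<nu> distrib_left)
  have T_cmult: "T (\<lambda>y. a * g y) x = a * T g x" for a g x
    by (simp add: T_def sampled_cmult right_diff_distrib mult_ac)
  have T_W: "T W x \<le> r * W x" if x: "x \<in> space M" for x
  proof -
    have "1 \<le> (\<integral>y. W y \<partial>\<nu>)"
    proof -
      interpret prob_space \<nu> by (rule prob_\<nu>)
      have "(\<integral>y. 1 \<partial>\<nu>) \<le> (\<integral>y. W y \<partial>\<nu>)"
        by (intro integral_mono integrable_\<nu> dW dominated_const) (use \<beta> V_nonneg in \<open>auto simp: W_def space_\<nu>\<close>)
      then show ?thesis by (simp add: prob_space)
    qed
    then have atom: "s x * 1 \<le> s x * (\<integral>y. W y \<partial>\<nu>)"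
      using N(2) by (intro mult_left_mono) (auto simp: s_def)
    have "sampled N W x = 1 + \<beta> * sampled N V x"
      using sampled_add[OF dominated_const[of 1] dominated_cmult[OF dominated_V, of \<beta>] x, of N]
        sampled_const[OF N(1) x, of 1]
      by (simp add: W_def[abs_def] sampled_cmult)
    also have "\<dots> \<le> 1 + \<beta> * (lam * V x + C)"
      using sampled_V_le[OF N(1) x] \<beta> by (intro add_left_mono mult_left_mono) (auto simp: C_def)
    finally have "T W x \<le> 1 + \<beta> * (lam * V x + C) - s x" using atom by (simp add: T_def)
    also have "\<dots> \<le> r * W x"
      using small[OF V_ge_1[OF x]] large[of "V x"] x by (cases "V x \<le> R") (auto simp: s_def W_def)
    finally show ?thesis .
  qed
  have contr: "\<bar>T g x\<bar> \<le> c * r * W x"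
    if g: "dominated M V g" and c: "0 \<le> c" "\<And>y. y \<in> space M \<Longrightarrow> \<bar>g y\<bar> \<le> c * W y" and x: "x \<in> space M" for g c x
  proof -
    have "0 \<le> T (\<lambda>y. c * W y - g y) x" "0 \<le> T (\<lambda>y. c * W y + g y) x"
      using c(2) by (intro T_nonneg[OF _ _ x] dominated_intros dW g; force)+
    then have "\<bar>T g x\<bar> \<le> c * T W x"
      using T_diff[OF dominated_cmult[OF dW] g x, of c] T_add[OF dominated_cmult[OF dW] g x, of c]
      by (simp add: T_cmult)
    also have "\<dots> \<le> c * (r * W x)" using T_W[OF x] c(1) by (rule mult_left_mono)
    finally show ?thesis by (simp add: mult_ac)
  qed
  have "\<exists>h. dominated M V h \<and> (\<forall>x\<in>space M. h x - sampled N h x + s x * (\<integral>y. h y \<partial>\<nu>) = u x)"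
    if u: "dominated M V u" for u
  proof -
    obtain h where h: "dominated M W h" "\<And>x. x \<in> space M \<Longrightarrow> h x - T h x = u x"
    proof (rule neumann_series_weighted[where M = M and W = W and T = T and u = u and r = r])
      show "T g \<in> borel_measurable M" if "dominated M W g" for g
      proof -
        have "dominated M V (T g)"
          unfolding T_def[abs_def] mult.commute[of "s _"]
          using that by (intro dominated_intros dominated_sampled ds) (simp add: domW)
        then show ?thesis by (rule dominatedD)
      qed
    qed (use T_diff contr \<beta> u in \<open>auto simp: domW\<close>)
    have "h x - sampled N h x + s x * (\<integral>y. h y \<partial>\<nu>) = u x" if "x \<in> space M" for x
      using h(2)[OF that] by (simp add: T_def)
    then show ?thesis using h(1) domW by blast
  qed
  with that N(1) ds show thesis by blast
qed

text \<open>Integrating the residual equation against the invariant law leaves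
  \<open>(\<integral>s d\<rho>) (\<integral>h d\<nu>) = \<integral>u d\<rho>\<close>. The choice \<open>u = 1\<close> shows that \<open>\<integral>s d\<rho>\<close> is not zero; for centred
  \<open>u\<close> the rank-one term therefore vanishes.\<close>
lemma sampled_equation_solution:
  assumes inv: "invariant_dist M Q \<rho>" and u: "dominated M V u" and zero: "(\<integral>x. u x \<partial>\<rho>) = 0"
  obtains N h where "1 \<le> N" "dominated M V h" "\<And>x. x \<in> space M \<Longrightarrow> h x - sampled N h x = u x"
proof -
  have sp: "space \<rho> = space M" and pr: "prob_space \<rho>"
    using inv by (auto simp: invariant_dist_def space_prob_algebra dest: sets_eq_imp_space_eq)
  obtain N s where N: "1 \<le> N" and s: "dominated M V s"
    and sol: "\<And>u. dominated M V u \<Longrightarrow> \<exists>h. dominated M V h \<and>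
      (\<forall>x\<in>space M. h x - sampled N h x + s x * (\<integral>y. h y \<partial>\<nu>) = u x)"
    by (rule residual_solution) blast
  note int = invariant_integrable[OF inv]
  have balance: "(\<integral>x. s x \<partial>\<rho>) * (\<integral>y. h y \<partial>\<nu>) = (\<integral>x. w x \<partial>\<rho>)"
    if h: "dominated M V h" and w: "dominated M V w"
      and eq: "\<forall>x\<in>space M. h x - sampled N h x + s x * (\<integral>y. h y \<partial>\<nu>) = w x" for h w
  proof -
    have "(\<integral>x. w x \<partial>\<rho>) = (\<integral>x. h x - sampled N h x + s x * (\<integral>y. h y \<partial>\<nu>) \<partial>\<rho>)"
      by (rule Bochner_Integration.integral_cong) (use eq sp in auto)
    also have "\<dots> = (\<integral>x. h x \<partial>\<rho>) - (\<integral>x. sampled N h x \<partial>\<rho>) + (\<integral>x. s x \<partial>\<rho>) * (\<integral>y. h y \<partial>\<nu>)"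
      by (simp add: int h s dominated_sampled)
    finally show ?thesis using invariant_sampled[OF inv h N] by simp
  qed
  obtain h1 where "dominated M V h1" "\<forall>x\<in>space M. h1 x - sampled N h1 x + s x * (\<integral>y. h1 y \<partial>\<nu>) = 1"
    using sol[OF dominated_const[of 1]] by blast
  from balance[OF this(1) dominated_const this(2)] have s_pos: "(\<integral>x. s x \<partial>\<rho>) \<noteq> 0"
    using pr by (auto simp: prob_space.prob_space)
  obtain h where h: "dominated M V h" "\<forall>x\<in>space M. h x - sampled N h x + s x * (\<integral>y. h y \<partial>\<nu>) = u x"
    using sol[OF u] by blast
  from balance[OF h(1) u h(2)] s_pos zero have "(\<integral>y. h y \<partial>\<nu>) = 0" by simp
  with h N show thesis by (intro that) auto
qed

text \<open>For each \<open>n\<close>, \<open>I - E\<^sup>n\<close> is \<open>I - E\<close> applied to \<open>I + E + \<dots> + E\<^sup>n\<^sup>-\<^sup>1\<close>. Averaging over the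
  exponents \<open>n\<close> that enter \<open>sampled\<close> turns a solution for the sampled chain into one for the chain.\<close>
lemma poisson_equation:
  assumes inv: "invariant_dist M Q \<rho>" and u: "dominated M V u"
  obtains g where "dominated M V g" "\<And>x. x \<in> space M \<Longrightarrow> g x - E g x = u x - (\<integral>x. u x \<partial>\<rho>)"
proof -
  have pr: "prob_space \<rho>"
    using inv by (auto simp: invariant_dist_def space_prob_algebra)
  let ?u = "\<lambda>x. u x - (\<integral>x. u x \<partial>\<rho>)"
  have du: "dominated M V ?u" by (rule dominated_diff[OF u dominated_const])
  have "(\<integral>x. ?u x \<partial>\<rho>) = 0"
    using invariant_integrable[OF inv u] pr
    by (subst Bochner_Integration.integral_diff)
      (auto simp: prob_space.prob_space prob_space.finite_measure finite_measure.integrable_const)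
  then obtain N h where N: "1 \<le> N" and h: "dominated M V h" "\<And>x. x \<in> space M \<Longrightarrow> h x - sampled N h x = ?u x"
    by (rule sampled_equation_solution[OF inv du]) blast
  define g where "g x = (1 / real N) * (\<Sum>k<N. \<Sum>i<k + m. (E ^^ i) h x)" for x
  have dg: "dominated M V g"
    unfolding g_def[abs_def] by (intro dominated_intros dominated_iter h)
  have "g x - E g x = ?u x" if x: "x \<in> space M" for x
  proof -
    have "E g x = (1 / real N) * (\<Sum>k<N. \<Sum>i<k + m. (E ^^ Suc i) h x)"
      unfolding g_def[abs_def] E_cmult
      by (simp add: E_sum dominated_sum dominated_iter h x)
    then have "g x - E g x = (1 / real N) * (\<Sum>k<N. \<Sum>i<k + m. (E ^^ i) h x - (E ^^ Suc i) h x)"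
      unfolding g_def by (simp only: sum_subtractf right_diff_distrib)
    also have "\<dots> = (1 / real N) * (\<Sum>k<N. h x - (E ^^ (k + m)) h x)"
      by (subst sum_lessThan_telescope') simp
    also have "\<dots> = h x - sampled N h x"
      using N by (simp add: sampled_def sum_subtractf right_diff_distrib diff_divide_distrib)
    finally show ?thesis using h(2)[OF x] by simp
  qed
  with dg show thesis by (rule that)
qed

end

section \<open>The chain and its martingale increments\<close>

definition square_integrable :: "'a measure \<Rightarrow> ('a \<Rightarrow> real) \<Rightarrow> bool" where
  "square_integrable N f \<longleftrightarrow> f \<in> borel_measurable N \<and> integrable N (\<lambda>x. (f x)\<^sup>2)"

lemma square_integrable_mult:
  assumes "square_integrable N f" "square_integrable N g"
  shows "integrable N (\<lambda>x. f x * g x)"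
proof (rule Bochner_Integration.integrable_bound)
  show "integrable N (\<lambda>x. (f x)\<^sup>2 + (g x)\<^sup>2)"
    using assms by (simp add: square_integrable_def)
  show "(\<lambda>x. f x * g x) \<in> borel_measurable N"
    using assms by (intro borel_measurable_times) (auto simp: square_integrable_def)
  have "\<bar>a * b\<bar> \<le> a\<^sup>2 + b\<^sup>2" for a b :: real
  proof -
    have "2 * (\<bar>a\<bar> * \<bar>b\<bar>) \<le> \<bar>a\<bar>\<^sup>2 + \<bar>b\<bar>\<^sup>2" using sum_squares_bound[of "\<bar>a\<bar>" "\<bar>b\<bar>"] by simp
    moreover have "0 \<le> \<bar>a\<bar> * \<bar>b\<bar>" by simp
    ultimately show ?thesis unfolding abs_mult power2_abs by linarith
  qed
  then show "AE x in N. norm (f x * g x) \<le> norm ((f x)\<^sup>2 + (g x)\<^sup>2)" by simp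
qed

lemma square_integrable_add:
  assumes f: "square_integrable N f" and g: "square_integrable N g"
  shows "square_integrable N (\<lambda>x. f x + g x)"
  using assms square_integrable_mult[OF f g]
  by (auto simp: square_integrable_def power2_sum mult.assoc intro: borel_measurable_add)

lemma square_integrable_cmult:
  "square_integrable N f \<Longrightarrow> square_integrable N (\<lambda>x. a * f x)"
  by (auto simp: square_integrable_def power_mult_distrib intro: borel_measurable_times)

lemma square_integrable_diff:
  "square_integrable N f \<Longrightarrow> square_integrable N g \<Longrightarrow> square_integrable N (\<lambda>x. f x - g x)"
  using square_integrable_add[of N f "\<lambda>x. -1 * g x"] square_integrable_cmult[of N g "-1"] by simp

lemma square_integrable_sum:
  assumes "\<And>i. i \<in> I \<Longrightarrow> square_integrable N (f i)"
  shows "square_integrable N (\<lambda>x. \<Sum>i\<in>I. f i x)"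
proof (cases "finite I")
  case True
  then show ?thesis using assms
    by (induction I rule: finite_induct) (auto simp: square_integrable_add, simp add: square_integrable_def)
qed (simp add: square_integrable_def)

locale drift_chain = drift_kernel +
  fixes \<Omega> :: "'w measure" and \<Phi> :: "nat \<Rightarrow> 'w \<Rightarrow> 'a" and \<mu> :: "'a measure"
  assumes chain: "markov_chain \<Omega> M Q \<mu> \<Phi>"
    and initial: "(\<integral>\<^sup>+x. ennreal (V x) \<partial>\<mu>) < \<infinity>"
begin

lemma prob_\<Omega>: "prob_space \<Omega>" and \<Phi> [measurable]: "\<Phi> k \<in> \<Omega> \<rightarrow>\<^sub>M M"
  and \<Phi>_0: "distr \<Omega> M (\<Phi> 0) = \<mu>"
  using chain by (auto simp: markov_chain_def)

lemma \<Phi>_space: "\<omega> \<in> space \<Omega> \<Longrightarrow> \<Phi> k \<omega> \<in> space M"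
  by (rule measurable_space[OF \<Phi>])

definition hist :: "nat \<Rightarrow> 'w \<Rightarrow> nat \<Rightarrow> 'a" where
  "hist n \<omega> = (\<lambda>k\<in>{..n}. \<Phi> k \<omega>)"

abbreviation path_space :: "nat \<Rightarrow> (nat \<Rightarrow> 'a) measure" where
  "path_space n \<equiv> PiM {..n} (\<lambda>_. M)"

lemma hist_measurable [measurable]: "hist n \<in> \<Omega> \<rightarrow>\<^sub>M path_space n"
  unfolding hist_def[abs_def] by (rule measurable_restrict) (rule \<Phi>)

lemma step_kernel:
  "(\<lambda>\<omega>. distr (Q (\<Phi> n \<omega>)) (path_space n \<Otimes>\<^sub>M M) (\<lambda>y. (hist n \<omega>, y))) \<in> \<Omega> \<rightarrow>\<^sub>M prob_algebra (path_space n \<Otimes>\<^sub>M M)"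
proof (rule measurable_distr_prob_space2[where M = M])
  show "(\<lambda>\<omega>. Q (\<Phi> n \<omega>)) \<in> \<Omega> \<rightarrow>\<^sub>M prob_algebra M"
    by (rule measurable_compose[OF \<Phi> kernel])
  show "(\<lambda>(\<omega>, y). (hist n \<omega>, y)) \<in> \<Omega> \<Otimes>\<^sub>M M \<rightarrow>\<^sub>M path_space n \<Otimes>\<^sub>M M"
    unfolding split_beta by measurable
qed

text \<open>The defining property of the chain fixes the joint law of past and next state on rectangles,
  which generate the product \<open>\<sigma>\<close>-algebra.\<close>
lemma joint_law:
  "distr \<Omega> (path_space n \<Otimes>\<^sub>M M) (\<lambda>\<omega>. (hist n \<omega>, \<Phi> (Suc n) \<omega>)) =
    \<Omega> \<bind> (\<lambda>\<omega>. distr (Q (\<Phi> n \<omega>)) (path_space n \<Otimes>\<^sub>M M) (\<lambda>y. (hist n \<omega>, y)))" (is "?L = ?R")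
proof -
  let ?H = "path_space n"
  let ?G = "{a \<times> b |a b. a \<in> sets ?H \<and> b \<in> sets M}"
  let ?k = "\<lambda>\<omega>. distr (Q (\<Phi> n \<omega>)) (?H \<Otimes>\<^sub>M M) (\<lambda>y. (hist n \<omega>, y))"
  interpret prob_space \<Omega> by (rule prob_\<Omega>)
  have \<Omega>: "\<Omega> \<in> space (prob_algebra \<Omega>)" by (simp add: space_prob_algebra prob_\<Omega>)
  have setsR: "sets ?R = sets (?H \<Otimes>\<^sub>M M)" by (rule sets_bind'[OF \<Omega> step_kernel])
  interpret R: prob_space ?R by (rule prob_space_bind'[OF \<Omega> step_kernel])
  have rect: "emeasure ?L (B \<times> A) = emeasure ?R (B \<times> A)" if B: "B \<in> sets ?H" and A: "A \<in> sets M" for A B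
  proof -
    have BA: "B \<times> A \<in> sets (?H \<Otimes>\<^sub>M M)" using A B by simp
    have "emeasure ?L (B \<times> A) = emeasure \<Omega> {\<omega>\<in>space \<Omega>. hist n \<omega> \<in> B \<and> \<Phi> (Suc n) \<omega> \<in> A}"
      by (subst emeasure_distr[OF _ BA]) (auto intro!: arg_cong[where f = "emeasure \<Omega>"])
    also have "\<dots> = (\<integral>\<^sup>+\<omega>. indicator B (hist n \<omega>) * emeasure (Q (\<Phi> n \<omega>)) A \<partial>\<Omega>)"
      using chain A B unfolding markov_chain_def hist_def by blast
    also have "\<dots> = (\<integral>\<^sup>+\<omega>. emeasure (?k \<omega>) (B \<times> A) \<partial>\<Omega>)"
    proof (rule nn_integral_cong)
      fix \<omega> assume \<omega>: "\<omega> \<in> space \<Omega>"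
      note sQ = sets_Q[OF \<Phi>_space[OF \<omega>, of n]] and spQ = space_Q[OF \<Phi>_space[OF \<omega>, of n]]
      have h: "hist n \<omega> \<in> space ?H" by (rule measurable_space[OF hist_measurable \<omega>])
      have mm: "(\<lambda>y. (hist n \<omega>, y)) \<in> Q (\<Phi> n \<omega>) \<rightarrow>\<^sub>M ?H \<Otimes>\<^sub>M M"
        using measurable_Pair1'[OF h] sQ by (simp cong: measurable_cong_sets)
      have "emeasure (?k \<omega>) (B \<times> A) = emeasure (Q (\<Phi> n \<omega>)) ((\<lambda>y. (hist n \<omega>, y)) -` (B \<times> A) \<inter> space (Q (\<Phi> n \<omega>)))"
        by (rule emeasure_distr[OF mm BA])
      also have "(\<lambda>y. (hist n \<omega>, y)) -` (B \<times> A) \<inter> space (Q (\<Phi> n \<omega>)) = (if hist n \<omega> \<in> B then A else {})"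
        using sets.sets_into_space[OF A] spQ by auto
      finally show "indicator B (hist n \<omega>) * emeasure (Q (\<Phi> n \<omega>)) A = emeasure (?k \<omega>) (B \<times> A)"
        by (auto split: split_indicator)
    qed
    also have "\<dots> = emeasure ?R (B \<times> A)"
      by (rule emeasure_bind_prob_algebra[symmetric, OF \<Omega> step_kernel BA])
    finally show ?thesis .
  qed
  show ?thesis
  proof (rule measure_eqI_generator_eq[OF Int_stable_pair_measure_generator[of ?H M] pair_measure_closed])
    show "sets ?L = sigma_sets (space ?H \<times> space M) ?G" by (simp add: sets_pair_measure)
    show "sets ?R = sigma_sets (space ?H \<times> space M) ?G" unfolding setsR by (simp add: sets_pair_measure)
    show "emeasure ?L X = emeasure ?R X" if "X \<in> ?G" for X using that rect by blast
    show "range (\<lambda>_::nat. space ?H \<times> space M) \<subseteq> ?G" by blast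
    show "(\<Union>i::nat. space ?H \<times> space M) = space ?H \<times> space M" by simp
    show "emeasure ?L (space ?H \<times> space M) \<noteq> \<infinity>" for i :: nat
      unfolding rect[OF sets.top sets.top] using R.emeasure_finite by simp
  qed
qed

lemma nn_integral_step:
  assumes k [measurable]: "(\<lambda>(h, y). k h y) \<in> borel_measurable (path_space n \<Otimes>\<^sub>M M)"
  shows "(\<integral>\<^sup>+\<omega>. k (hist n \<omega>) (\<Phi> (Suc n) \<omega>) \<partial>\<Omega>) = (\<integral>\<^sup>+\<omega>. (\<integral>\<^sup>+y. k (hist n \<omega>) y \<partial>Q (\<Phi> n \<omega>)) \<partial>\<Omega>)"
proof -
  have "(\<integral>\<^sup>+\<omega>. k (hist n \<omega>) (\<Phi> (Suc n) \<omega>) \<partial>\<Omega>)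
    = (\<integral>\<^sup>+z. (case z of (h, y) \<Rightarrow> k h y) \<partial>distr \<Omega> (path_space n \<Otimes>\<^sub>M M) (\<lambda>\<omega>. (hist n \<omega>, \<Phi> (Suc n) \<omega>)))"
    by (subst nn_integral_distr) (use k in simp_all)
  also have "\<dots> = (\<integral>\<^sup>+\<omega>. (\<integral>\<^sup>+z. (case z of (h, y) \<Rightarrow> k h y) \<partial>distr (Q (\<Phi> n \<omega>)) (path_space n \<Otimes>\<^sub>M M) (\<lambda>y. (hist n \<omega>, y))) \<partial>\<Omega>)"
    unfolding joint_law by (rule nn_integral_bind[OF k measurable_prob_algebraD[OF step_kernel]])
  also have "\<dots> = (\<integral>\<^sup>+\<omega>. (\<integral>\<^sup>+y. k (hist n \<omega>) y \<partial>Q (\<Phi> n \<omega>)) \<partial>\<Omega>)"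
  proof (rule nn_integral_cong)
    fix \<omega> assume \<omega>: "\<omega> \<in> space \<Omega>"
    have "(\<lambda>y. (hist n \<omega>, y)) \<in> Q (\<Phi> n \<omega>) \<rightarrow>\<^sub>M path_space n \<Otimes>\<^sub>M M"
      using measurable_Pair1'[OF measurable_space[OF hist_measurable \<omega>]] sets_Q[OF \<Phi>_space[OF \<omega>]]
      by (simp cong: measurable_cong_sets)
    from nn_integral_distr[OF this, of "\<lambda>(h, y). k h y"] k
    show "(\<integral>\<^sup>+z. (case z of (h, y) \<Rightarrow> k h y) \<partial>distr (Q (\<Phi> n \<omega>)) (path_space n \<Otimes>\<^sub>M M) (\<lambda>y. (hist n \<omega>, y)))
      = (\<integral>\<^sup>+y. k (hist n \<omega>) y \<partial>Q (\<Phi> n \<omega>))"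
      by simp
  qed
  finally show ?thesis .
qed

lemma integral_step:
  fixes k :: "(nat \<Rightarrow> 'a) \<Rightarrow> 'a \<Rightarrow> real"
  assumes k [measurable]: "(\<lambda>(h, y). k h y) \<in> borel_measurable (path_space n \<Otimes>\<^sub>M M)"
    and inner: "\<And>\<omega>. \<omega> \<in> space \<Omega> \<Longrightarrow> integrable (Q (\<Phi> n \<omega>)) (k (hist n \<omega>))"
    and outer: "integrable \<Omega> (\<lambda>\<omega>. k (hist n \<omega>) (\<Phi> (Suc n) \<omega>))"
  shows "(\<integral>\<omega>. k (hist n \<omega>) (\<Phi> (Suc n) \<omega>) \<partial>\<Omega>) = (\<integral>\<omega>. (\<integral>y. k (hist n \<omega>) y \<partial>Q (\<Phi> n \<omega>)) \<partial>\<Omega>)"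
proof -
  let ?k = "\<lambda>z. case z of (h, y) \<Rightarrow> k h y"
  let ?L = "\<lambda>\<omega>. distr (Q (\<Phi> n \<omega>)) (path_space n \<Otimes>\<^sub>M M) (\<lambda>y. (hist n \<omega>, y))"
  let ?J = "\<lambda>\<omega>. (hist n \<omega>, \<Phi> (Suc n) \<omega>)"
  have mm: "(\<lambda>y. (hist n \<omega>, y)) \<in> Q (\<Phi> n \<omega>) \<rightarrow>\<^sub>M path_space n \<Otimes>\<^sub>M M" if "\<omega> \<in> space \<Omega>" for \<omega>
    using measurable_Pair1'[OF measurable_space[OF hist_measurable that]] sets_Q[OF \<Phi>_space[OF that]]
    by (simp cong: measurable_cong_sets)
  have J: "?J \<in> \<Omega> \<rightarrow>\<^sub>M path_space n \<Otimes>\<^sub>M M" by measurable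
  have "(\<integral>\<omega>. k (hist n \<omega>) (\<Phi> (Suc n) \<omega>) \<partial>\<Omega>) = (\<integral>z. ?k z \<partial>distr \<Omega> (path_space n \<Otimes>\<^sub>M M) ?J)"
    by (subst integral_distr[OF J k]) simp
  also have "\<dots> = (\<integral>\<omega>. (\<integral>z. ?k z \<partial>?L \<omega>) \<partial>\<Omega>)"
    unfolding joint_law
  proof (rule integral_bind_kernel(2)[OF measurable_prob_algebraD[OF step_kernel] prob_space.not_empty[OF prob_\<Omega>] k])
    show "integrable (?L \<omega>) ?k" if "\<omega> \<in> space \<Omega>" for \<omega>
      using integrable_distr_eq[OF mm[OF that] k] inner[OF that] by simp
    show "integrable (\<Omega> \<bind> ?L) ?k"
      unfolding joint_law[symmetric] using integrable_distr_eq[OF J k] outer by simp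
  qed
  also have "\<dots> = (\<integral>\<omega>. (\<integral>y. k (hist n \<omega>) y \<partial>Q (\<Phi> n \<omega>)) \<partial>\<Omega>)"
    by (rule Bochner_Integration.integral_cong) (simp_all add: integral_distr[OF mm k])
  finally show ?thesis .
qed

lemma hist_at [simp]: "j \<le> n \<Longrightarrow> hist n \<omega> j = \<Phi> j \<omega>"
  by (simp add: hist_def)

text \<open>A bound for the mean of \<open>V (\<Phi> n)\<close> that is uniform in \<open>n\<close>: it is preserved under
  \<open>v \<mapsto> lam * v + b\<close>.\<close>
definition V_bound :: real where
  "V_bound = enn2real (\<integral>\<^sup>+x. ennreal (V x) \<partial>\<mu>) + b / (1 - lam)"

lemma V_bound_nonneg: "0 \<le> V_bound"
  using lam b_pos by (simp add: V_bound_def)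

lemma path_component: "j \<le> n \<Longrightarrow> (\<lambda>h. h j) \<in> path_space n \<rightarrow>\<^sub>M M"
  by (rule measurable_component_singleton) simp

lemma nn_integral_V_\<Phi>: "(\<integral>\<^sup>+\<omega>. ennreal (V (\<Phi> n \<omega>)) \<partial>\<Omega>) \<le> ennreal V_bound"
proof (induction n)
  case 0
  have "(\<integral>\<^sup>+\<omega>. ennreal (V (\<Phi> 0 \<omega>)) \<partial>\<Omega>) = (\<integral>\<^sup>+x. ennreal (V x) \<partial>\<mu>)"
    unfolding \<Phi>_0[symmetric] by (subst nn_integral_distr) auto
  also have "\<dots> = ennreal (enn2real (\<integral>\<^sup>+x. ennreal (V x) \<partial>\<mu>))"
    using initial by (simp add: ennreal_enn2real_if)
  also have "\<dots> \<le> ennreal V_bound"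
    using lam b_pos by (intro ennreal_leI) (simp add: V_bound_def)
  finally show ?case .
next
  case (Suc n)
  interpret prob_space \<Omega> by (rule prob_\<Omega>)
  have "(\<integral>\<^sup>+\<omega>. ennreal (V (\<Phi> (Suc n) \<omega>)) \<partial>\<Omega>) = (\<integral>\<^sup>+\<omega>. (\<integral>\<^sup>+y. ennreal (V y) \<partial>Q (\<Phi> n \<omega>)) \<partial>\<Omega>)"
  proof (rule nn_integral_step)
    show "(\<lambda>(h, y). ennreal (V y)) \<in> borel_measurable (path_space n \<Otimes>\<^sub>M M)"
      unfolding split_beta by measurable
  qed
  also have "\<dots> \<le> (\<integral>\<^sup>+\<omega>. ennreal lam * ennreal (V (\<Phi> n \<omega>)) + ennreal b \<partial>\<Omega>)"
  proof (rule nn_integral_mono)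
    fix \<omega> assume "\<omega> \<in> space \<Omega>"
    then have x: "\<Phi> n \<omega> \<in> space M" by (rule \<Phi>_space)
    have "ennreal (lam * V (\<Phi> n \<omega>) + b * indicator K (\<Phi> n \<omega>)) \<le> ennreal (lam * V (\<Phi> n \<omega>) + b)"
      using b_pos by (intro ennreal_leI) (auto split: split_indicator)
    also have "\<dots> = ennreal lam * ennreal (V (\<Phi> n \<omega>)) + ennreal b"
      using lam b_pos V_nonneg[OF x] by (simp add: ennreal_mult)
    finally show "(\<integral>\<^sup>+y. ennreal (V y) \<partial>Q (\<Phi> n \<omega>)) \<le> ennreal lam * ennreal (V (\<Phi> n \<omega>)) + ennreal b"
      using drift[OF x] by simp
  qed
  also have "\<dots> = ennreal lam * (\<integral>\<^sup>+\<omega>. ennreal (V (\<Phi> n \<omega>)) \<partial>\<Omega>) + ennreal b"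
    by (simp add: nn_integral_add nn_integral_cmult emeasure_space_1)
  also have "\<dots> \<le> ennreal lam * ennreal V_bound + ennreal b"
    by (intro add_right_mono mult_left_mono Suc) simp
  also have "\<dots> = ennreal (lam * V_bound + b)"
    using lam b_pos V_bound_nonneg by (simp add: ennreal_mult)
  also have "\<dots> \<le> ennreal V_bound"
  proof (rule ennreal_leI)
    define C where "C = b / (1 - lam)"
    have C: "lam * C + b = C" using lam by (simp add: C_def field_simps)
    have "lam * enn2real (\<integral>\<^sup>+x. ennreal (V x) \<partial>\<mu>) \<le> 1 * enn2real (\<integral>\<^sup>+x. ennreal (V x) \<partial>\<mu>)"
      using lam by (intro mult_right_mono) auto
    then show "lam * V_bound + b \<le> V_bound"
      unfolding V_bound_def C_def[symmetric] distrib_left using C by linarith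
  qed
  finally show ?case .
qed

lemma integrable_V_\<Phi>: "integrable \<Omega> (\<lambda>\<omega>. V (\<Phi> n \<omega>))"
  using nn_integral_V_\<Phi>[of n] V_nonneg \<Phi>_space
  by (intro integrableI_nonneg AE_I2) (auto simp: le_less_trans)

lemma expectation_V_le: "(\<integral>\<omega>. V (\<Phi> n \<omega>) \<partial>\<Omega>) \<le> V_bound"
proof -
  have "ennreal (\<integral>\<omega>. V (\<Phi> n \<omega>) \<partial>\<Omega>) \<le> ennreal V_bound"
    using nn_integral_V_\<Phi>[of n] V_nonneg \<Phi>_space
    by (subst nn_integral_eq_integral[symmetric, OF integrable_V_\<Phi>]) (auto intro!: AE_I2)
  then show ?thesis using V_bound_nonneg by (simp add: ennreal_le_iff)
qed

lemma integrable_\<Phi>: "dominated M V g \<Longrightarrow> integrable \<Omega> (\<lambda>\<omega>. g (\<Phi> n \<omega>))"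
proof -
  assume g: "dominated M V g"
  obtain c where c: "0 \<le> c" "\<And>x. x \<in> space M \<Longrightarrow> \<bar>g x\<bar> \<le> c * V x" using g by (auto elim: dominatedE)
  have [measurable]: "g \<in> borel_measurable M" by (rule dominatedD[OF g])
  show ?thesis
  proof (rule Bochner_Integration.integrable_bound[where f = "\<lambda>\<omega>. c * V (\<Phi> n \<omega>)"])
    show "AE \<omega> in \<Omega>. norm (g (\<Phi> n \<omega>)) \<le> norm (c * V (\<Phi> n \<omega>))"
      using c(2)[OF \<Phi>_space] by (intro AE_I2) (simp, meson abs_ge_self order_trans)
  qed (use integrable_V_\<Phi> in auto)
qed

lemma expectation_\<Phi>_le:
  assumes g: "dominated M V g" and c: "0 \<le> c" "\<And>x. x \<in> space M \<Longrightarrow> \<bar>g x\<bar> \<le> c * V x"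
  shows "\<bar>\<integral>\<omega>. g (\<Phi> n \<omega>) \<partial>\<Omega>\<bar> \<le> c * V_bound"
proof -
  have "\<bar>\<integral>\<omega>. g (\<Phi> n \<omega>) \<partial>\<Omega>\<bar> \<le> (\<integral>\<omega>. \<bar>g (\<Phi> n \<omega>)\<bar> \<partial>\<Omega>)" by (rule integral_abs_bound)
  also have "\<dots> \<le> (\<integral>\<omega>. c * V (\<Phi> n \<omega>) \<partial>\<Omega>)"
    by (rule integral_mono[OF integrable_abs[OF integrable_\<Phi>[OF g]]])
      (use integrable_V_\<Phi> c(2) \<Phi>_space in auto)
  also have "\<dots> \<le> c * V_bound"
    using mult_left_mono[OF expectation_V_le c(1)] by simp
  finally show ?thesis .
qed

lemma expectation_step:
  assumes g: "dominated M V g"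
  shows "(\<integral>\<omega>. g (\<Phi> (Suc n) \<omega>) \<partial>\<Omega>) = (\<integral>\<omega>. E g (\<Phi> n \<omega>) \<partial>\<Omega>)"
proof -
  have [measurable]: "g \<in> borel_measurable M" by (rule dominatedD[OF g])
  show ?thesis
    unfolding kernel_app_def
    by (rule integral_step[where k = "\<lambda>h y. g y"])
      (use integrable_dominated[OF g] \<Phi>_space integrable_\<Phi>[OF g] in auto)
qed

text \<open>Poisson's equation makes the sum of the centred means telescope to a bounded quantity.\<close>
lemma cesaro_expectation:
  assumes G: "dominated M V G" and u: "dominated M V u"
    and poisson: "\<And>x. x \<in> space M \<Longrightarrow> G x - E G x = u x - a"
  shows "(\<lambda>n. (1 / real n) * (\<Sum>j<n. \<integral>\<omega>. u (\<Phi> j \<omega>) \<partial>\<Omega>)) \<longlonglongrightarrow> a"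
proof -
  interpret prob_space \<Omega> by (rule prob_\<Omega>)
  obtain c where c: "0 \<le> c" "\<And>x. x \<in> space M \<Longrightarrow> \<bar>G x\<bar> \<le> c * V x" using G by (auto elim: dominatedE)
  define e where "e n = (\<integral>\<omega>. G (\<Phi> n \<omega>) \<partial>\<Omega>)" for n
  have u_eq: "(\<integral>\<omega>. u (\<Phi> j \<omega>) \<partial>\<Omega>) = e j - e (Suc j) + a" for j
  proof -
    have "(\<integral>\<omega>. u (\<Phi> j \<omega>) \<partial>\<Omega>) = (\<integral>\<omega>. G (\<Phi> j \<omega>) - E G (\<Phi> j \<omega>) + a \<partial>\<Omega>)"
      by (rule Bochner_Integration.integral_cong) (use poisson \<Phi>_space in auto)
    also have "\<dots> = e j - e (Suc j) + a"
      by (simp add: e_def expectation_step G integrable_\<Phi> dominated_E prob_space)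
    finally show ?thesis .
  qed
  have eq: "(1 / real n) * (\<Sum>j<n. \<integral>\<omega>. u (\<Phi> j \<omega>) \<partial>\<Omega>) = (e 0 - e n) / real n + a" if "1 \<le> n" for n
    using that unfolding u_eq sum.distrib sum_lessThan_telescope'
    by (simp add: field_simps)
  have "(\<lambda>n. (e 0 - e n) / real n) \<longlonglongrightarrow> 0"
  proof (rule Lim_null_comparison)
    show "\<forall>\<^sub>F n in sequentially. norm ((e 0 - e n) / real n) \<le> (2 * (c * V_bound)) / real n"
    proof (intro always_eventually allI)
      fix n
      have "\<bar>e 0 - e n\<bar> \<le> 2 * (c * V_bound)"
        using expectation_\<Phi>_le[OF G c, of 0] expectation_\<Phi>_le[OF G c, of n] unfolding e_def by linarith
      then show "norm ((e 0 - e n) / real n) \<le> (2 * (c * V_bound)) / real n"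
        by (simp add: divide_right_mono)
    qed
  qed (rule lim_const_over_n)
  from tendsto_add[OF this tendsto_const[of a]]
  have "(\<lambda>n. (e 0 - e n) / real n + a) \<longlonglongrightarrow> a" by simp
  then show ?thesis
    by (rule Lim_transform_eventually) (use eq in \<open>auto simp: eventually_sequentially intro!: exI[of _ 1]\<close>)
qed

text \<open>The functions \<open>q\<close> for which \<open>q (\<Phi> n) (\<Phi> (n + 1))\<close> are martingale increments, with variances
  bounded in \<open>n\<close>.\<close>
definition fair :: "('a \<Rightarrow> 'a \<Rightarrow> real) \<Rightarrow> bool" where
  "fair q \<longleftrightarrow> (\<lambda>(x, y). q x y) \<in> borel_measurable (M \<Otimes>\<^sub>M M) \<and>
    (\<forall>x\<in>space M. integrable (Q x) (\<lambda>y. (q x y)\<^sup>2) \<and> (\<integral>y. q x y \<partial>Q x) = 0) \<and>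
    (\<exists>c\<ge>0. \<forall>x\<in>space M. (\<integral>y. (q x y)\<^sup>2 \<partial>Q x) \<le> c * V x)"

abbreviation increment :: "('a \<Rightarrow> 'a \<Rightarrow> real) \<Rightarrow> nat \<Rightarrow> 'w \<Rightarrow> real" where
  "increment q j \<omega> \<equiv> q (\<Phi> j \<omega>) (\<Phi> (Suc j) \<omega>)"

lemma fair_measurable: "fair q \<Longrightarrow> (\<lambda>(x, y). q x y) \<in> borel_measurable (M \<Otimes>\<^sub>M M)"
  by (simp add: fair_def)

lemma fair_square_integrable:
  assumes q: "fair q" and x: "x \<in> space M"
  shows "square_integrable (Q x) (q x)"
proof -
  have "q x \<in> borel_measurable M"
    using measurable_compose[OF measurable_Pair1'[OF x] fair_measurable[OF q]] by simp
  then have "q x \<in> borel_measurable (Q x)"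
    using sets_Q[OF x] by (simp cong: measurable_cong_sets)
  then show ?thesis using q x by (simp add: fair_def square_integrable_def)
qed

lemma square_integrable_integrable:
  assumes q: "square_integrable N q" and N: "prob_space N"
  shows "integrable N q"
proof -
  interpret prob_space N by (rule N)
  show ?thesis
    using square_integrable_mult[OF q, of "\<lambda>_. 1"] by (simp add: square_integrable_def)
qed

lemma increment_square_integrable:
  assumes q: "fair q"
  shows "square_integrable \<Omega> (increment q n)"
    and "0 \<le> c \<Longrightarrow> (\<And>x. x \<in> space M \<Longrightarrow> (\<integral>y. (q x y)\<^sup>2 \<partial>Q x) \<le> c * V x) \<Longrightarrow>
      (\<integral>\<omega>. (increment q n \<omega>)\<^sup>2 \<partial>\<Omega>) \<le> c * V_bound"
proof -
  note qm [measurable] = fair_measurable[OF q]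
  have meas: "increment q n \<in> borel_measurable \<Omega>" by measurable
  have k: "(\<lambda>(h, y). q (h n) y) \<in> borel_measurable (path_space n \<Otimes>\<^sub>M M)" by measurable
  have nn: "(\<integral>\<^sup>+\<omega>. ennreal ((increment q n \<omega>)\<^sup>2) \<partial>\<Omega>) \<le> ennreal (c * V_bound)"
    if c: "0 \<le> c" "\<And>x. x \<in> space M \<Longrightarrow> (\<integral>y. (q x y)\<^sup>2 \<partial>Q x) \<le> c * V x" for c
  proof -
    have "(\<integral>\<^sup>+\<omega>. ennreal ((increment q n \<omega>)\<^sup>2) \<partial>\<Omega>) = (\<integral>\<^sup>+\<omega>. (\<integral>\<^sup>+y. ennreal ((q (\<Phi> n \<omega>) y)\<^sup>2) \<partial>Q (\<Phi> n \<omega>)) \<partial>\<Omega>)"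
      using nn_integral_step[where k = "\<lambda>h y. ennreal ((q (h n) y)\<^sup>2)" and n = n] k by simp
    also have "\<dots> \<le> (\<integral>\<^sup>+\<omega>. ennreal (c * V (\<Phi> n \<omega>)) \<partial>\<Omega>)"
    proof (rule nn_integral_mono)
      fix \<omega> assume "\<omega> \<in> space \<Omega>"
      then have x: "\<Phi> n \<omega> \<in> space M" by (rule \<Phi>_space)
      have "(\<integral>\<^sup>+y. ennreal ((q (\<Phi> n \<omega>) y)\<^sup>2) \<partial>Q (\<Phi> n \<omega>)) = ennreal (\<integral>y. (q (\<Phi> n \<omega>) y)\<^sup>2 \<partial>Q (\<Phi> n \<omega>))"
        using q x by (intro nn_integral_eq_integral) (auto simp: fair_def)
      then show "(\<integral>\<^sup>+y. ennreal ((q (\<Phi> n \<omega>) y)\<^sup>2) \<partial>Q (\<Phi> n \<omega>)) \<le> ennreal (c * V (\<Phi> n \<omega>))"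
        using c(2)[OF x] by (simp add: ennreal_leI)
    qed
    also have "\<dots> = ennreal c * (\<integral>\<^sup>+\<omega>. ennreal (V (\<Phi> n \<omega>)) \<partial>\<Omega>)"
      using c(1) by (subst nn_integral_cmult[symmetric]) (auto simp: ennreal_mult' intro!: nn_integral_cong)
    also have "\<dots> \<le> ennreal c * ennreal V_bound"
      by (intro mult_left_mono nn_integral_V_\<Phi>) simp
    also have "\<dots> = ennreal (c * V_bound)" using c(1) by (simp add: ennreal_mult')
    finally show ?thesis .
  qed
  obtain c0 where c0: "0 \<le> c0" "\<And>x. x \<in> space M \<Longrightarrow> (\<integral>y. (q x y)\<^sup>2 \<partial>Q x) \<le> c0 * V x"
    using q by (auto simp: fair_def)
  have "(\<integral>\<^sup>+\<omega>. ennreal ((increment q n \<omega>)\<^sup>2) \<partial>\<Omega>) < \<infinity>"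
    using nn[OF c0] by (auto simp: le_less_trans)
  then have int: "integrable \<Omega> (\<lambda>\<omega>. (increment q n \<omega>)\<^sup>2)"
    by (intro integrableI_nonneg) (use meas in auto)
  then show "square_integrable \<Omega> (increment q n)"
    using meas by (simp add: square_integrable_def)
  show "(\<integral>\<omega>. (increment q n \<omega>)\<^sup>2 \<partial>\<Omega>) \<le> c * V_bound"
    if c: "0 \<le> c" "\<And>x. x \<in> space M \<Longrightarrow> (\<integral>y. (q x y)\<^sup>2 \<partial>Q x) \<le> c * V x"
  proof -
    have "ennreal (\<integral>\<omega>. (increment q n \<omega>)\<^sup>2 \<partial>\<Omega>) \<le> ennreal (c * V_bound)"
      using nn[OF c] nn_integral_eq_integral[OF int] by simp
    then show ?thesis using c V_bound_nonneg by (simp add: ennreal_le_iff)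
  qed
qed

text \<open>Conditionally on the past the increment has mean zero, and the factor in front of it is a
  function of the past.\<close>
lemma increment_orthogonal:
  assumes q: "fair q" and \<phi> [measurable]: "\<phi> \<in> borel_measurable (path_space n)"
    and sq: "square_integrable \<Omega> (\<lambda>\<omega>. \<phi> (hist n \<omega>))"
  shows "(\<integral>\<omega>. \<phi> (hist n \<omega>) * increment q n \<omega> \<partial>\<Omega>) = 0"
proof -
  note qm [measurable] = fair_measurable[OF q]
  have "(\<integral>\<omega>. \<phi> (hist n \<omega>) * increment q n \<omega> \<partial>\<Omega>)
      = (\<integral>\<omega>. (\<integral>y. \<phi> (hist n \<omega>) * q (hist n \<omega> n) y \<partial>Q (\<Phi> n \<omega>)) \<partial>\<Omega>)"
  proof (subst integral_step[where k = "\<lambda>h y. \<phi> h * q (h n) y", symmetric])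
    show "(\<lambda>(h, y). \<phi> h * q (h n) y) \<in> borel_measurable (path_space n \<Otimes>\<^sub>M M)" by measurable
    show "integrable (Q (\<Phi> n \<omega>)) (\<lambda>y. \<phi> (hist n \<omega>) * q (hist n \<omega> n) y)" if "\<omega> \<in> space \<Omega>" for \<omega>
      using square_integrable_integrable[OF fair_square_integrable[OF q] prob_Q] \<Phi>_space[OF that] by simp
    show "integrable \<Omega> (\<lambda>\<omega>. \<phi> (hist n \<omega>) * q (hist n \<omega> n) (\<Phi> (Suc n) \<omega>))"
      using square_integrable_mult[OF sq increment_square_integrable(1)[OF q]] by simp
  qed simp
  also have "\<dots> = (\<integral>\<omega>. 0 \<partial>\<Omega>)"
    by (rule Bochner_Integration.integral_cong) (use q \<Phi>_space in \<open>auto simp: fair_def\<close>)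
  finally show ?thesis by simp
qed

lemma increment_mean_zero: "fair q \<Longrightarrow> (\<integral>\<omega>. increment q n \<omega> \<partial>\<Omega>) = 0"
proof -
  assume q: "fair q"
  interpret prob_space \<Omega> by (rule prob_\<Omega>)
  show ?thesis
    using increment_orthogonal[OF q, of "\<lambda>_. 1"] by (simp add: square_integrable_def)
qed

lemma increments_product:
  assumes q1: "fair q1" and q2: "fair q2"
  shows "(\<integral>\<omega>. increment q1 i \<omega> * increment q2 j \<omega> \<partial>\<Omega>) =
    (if i = j then \<integral>\<omega>. (\<integral>y. q1 (\<Phi> j \<omega>) y * q2 (\<Phi> j \<omega>) y \<partial>Q (\<Phi> j \<omega>)) \<partial>\<Omega> else 0)"
proof -
  note [measurable] = fair_measurable[OF q1] fair_measurable[OF q2]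
  have earlier: "(\<integral>\<omega>. increment p i \<omega> * increment q j \<omega> \<partial>\<Omega>) = 0"
    if p: "fair p" and q: "fair q" and "i < j" for p q i j
  proof -
    note pm [measurable] = fair_measurable[OF p]
    have 1: "i \<le> j" "Suc i \<le> j" using \<open>i < j\<close> by auto
    have "(\<integral>\<omega>. (\<lambda>h. p (h i) (h (Suc i))) (hist j \<omega>) * increment q j \<omega> \<partial>\<Omega>) = 0"
    proof (rule increment_orthogonal[OF q])
      have [measurable]: "(\<lambda>h. h i) \<in> path_space j \<rightarrow>\<^sub>M M" "(\<lambda>h. h (Suc i)) \<in> path_space j \<rightarrow>\<^sub>M M"
        using 1 by (auto intro: path_component)
      show "(\<lambda>h. p (h i) (h (Suc i))) \<in> borel_measurable (path_space j)" by measurable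
      show "square_integrable \<Omega> (\<lambda>\<omega>. p (hist j \<omega> i) (hist j \<omega> (Suc i)))"
        using increment_square_integrable(1)[OF p, of i] 1 by simp
    qed
    then show ?thesis using 1 by simp
  qed
  consider "i < j" | "j < i" | "i = j" by linarith
  then show ?thesis
  proof cases
    case 1 then show ?thesis using earlier[OF q1 q2] by simp
  next
    case 2 then show ?thesis using earlier[OF q2 q1 2] by (simp add: mult.commute)
  next
    case 3
    have "(\<integral>\<omega>. increment q1 j \<omega> * increment q2 j \<omega> \<partial>\<Omega>)
        = (\<integral>\<omega>. (\<integral>y. q1 (hist j \<omega> j) y * q2 (hist j \<omega> j) y \<partial>Q (\<Phi> j \<omega>)) \<partial>\<Omega>)"
    proof (subst integral_step[where k = "\<lambda>h y. q1 (h j) y * q2 (h j) y", symmetric])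
      show "(\<lambda>(h, y). q1 (h j) y * q2 (h j) y) \<in> borel_measurable (path_space j \<Otimes>\<^sub>M M)" by measurable
      show "integrable (Q (\<Phi> j \<omega>)) (\<lambda>y. q1 (hist j \<omega> j) y * q2 (hist j \<omega> j) y)" if "\<omega> \<in> space \<Omega>" for \<omega>
        using square_integrable_mult[OF fair_square_integrable[OF q1] fair_square_integrable[OF q2]] \<Phi>_space[OF that]
        by simp
      show "integrable \<Omega> (\<lambda>\<omega>. q1 (hist j \<omega> j) (\<Phi> (Suc j) \<omega>) * q2 (hist j \<omega> j) (\<Phi> (Suc j) \<omega>))"
        using square_integrable_mult[OF increment_square_integrable(1)[OF q1] increment_square_integrable(1)[OF q2]]
        by simp
    qed simp
    then show ?thesis using 3 by simp
  qed
qed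

text \<open>The predictable covariation: only the diagonal of the double sum survives.\<close>
lemma expectation_martingale_product:
  assumes q1: "fair q1" and q2: "fair q2"
  shows "(\<integral>\<omega>. (\<Sum>i<n. increment q1 i \<omega>) * (\<Sum>j<n. increment q2 j \<omega>) \<partial>\<Omega>) =
    (\<Sum>j<n. \<integral>\<omega>. (\<integral>y. q1 (\<Phi> j \<omega>) y * q2 (\<Phi> j \<omega>) y \<partial>Q (\<Phi> j \<omega>)) \<partial>\<Omega>)"
proof -
  have "(\<integral>\<omega>. (\<Sum>i<n. increment q1 i \<omega>) * (\<Sum>j<n. increment q2 j \<omega>) \<partial>\<Omega>)
    = (\<Sum>i<n. \<Sum>j<n. \<integral>\<omega>. increment q1 i \<omega> * increment q2 j \<omega> \<partial>\<Omega>)"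
    unfolding sum_product
    by (simp add: square_integrable_mult increment_square_integrable(1)[OF q1] increment_square_integrable(1)[OF q2])
  also have "\<dots> = (\<Sum>j<n. \<integral>\<omega>. (\<integral>y. q1 (\<Phi> j \<omega>) y * q2 (\<Phi> j \<omega>) y \<partial>Q (\<Phi> j \<omega>)) \<partial>\<Omega>)"
    unfolding increments_product[OF q1 q2] by (simp add: sum.delta)
  finally show ?thesis .
qed

lemma fair_centred:
  assumes g: "g \<in> borel_measurable M" and g2: "dominated M V (\<lambda>x. (g x)\<^sup>2)"
  shows "fair (\<lambda>x y. g y - E g x)"
proof -
  have dg: "dominated M V g"
  proof (rule dominated_mono[OF g dominated_add[OF dominated_const[of 1] g2]])
    fix x
    have "0 \<le> (\<bar>g x\<bar> - 1)\<^sup>2" "\<bar>g x\<bar>\<^sup>2 = (g x)\<^sup>2" by simp_all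
    then show "\<bar>g x\<bar> \<le> 1 + (g x)\<^sup>2" unfolding power2_diff by (auto simp: power2_eq_square) 
  qed
  have [measurable]: "E g \<in> borel_measurable M" by (rule E_measurable[OF g])
  have dE2: "dominated M V (E (\<lambda>x. (g x)\<^sup>2))" by (rule dominated_E[OF g2])
  then obtain c where c: "0 \<le> c" "\<And>x. x \<in> space M \<Longrightarrow> \<bar>E (\<lambda>x. (g x)\<^sup>2) x\<bar> \<le> c * V x" by (auto elim: dominatedE)
  have expand: "(g y - E g x)\<^sup>2 = (g y)\<^sup>2 - 2 * E g x * g y + (E g x)\<^sup>2" for x y
    by (simp add: power2_diff)
  have int: "integrable (Q x) (\<lambda>y. (g y - E g x)\<^sup>2)" if x: "x \<in> space M" for x
  proof -
    interpret prob_space "Q x" by (rule prob_Q[OF x])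
    show ?thesis unfolding expand
      using integrable_dominated[OF dg x] integrable_dominated[OF g2 x] by simp
  qed
  have le: "(\<integral>y. (g y - E g x)\<^sup>2 \<partial>Q x) \<le> c * V x" if x: "x \<in> space M" for x
  proof -
    interpret prob_space "Q x" by (rule prob_Q[OF x])
    have "(\<integral>y. (g y - E g x)\<^sup>2 \<partial>Q x) = E (\<lambda>x. (g x)\<^sup>2) x - 2 * E g x * E g x + (E g x)\<^sup>2"
      unfolding expand
      using integrable_dominated[OF dg x] integrable_dominated[OF g2 x] by (simp add: kernel_app_def prob_space)
    also have "\<dots> \<le> E (\<lambda>x. (g x)\<^sup>2) x" by (simp add: power2_eq_square)
    finally show ?thesis using c(2)[OF x] by linarith
  qed
  have zero: "(\<integral>y. g y - E g x \<partial>Q x) = 0" if x: "x \<in> space M" for x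
  proof -
    interpret prob_space "Q x" by (rule prob_Q[OF x])
    show ?thesis using integrable_dominated[OF dg x] by (simp add: kernel_app_def prob_space)
  qed
  have "(\<lambda>(x, y). g y - E g x) \<in> borel_measurable (M \<Otimes>\<^sub>M M)" using g by measurable
  then show ?thesis unfolding fair_def using int le zero c(1) by blast
qed

end

context drift_chain
begin

lemma square_integrable_\<Phi>:
  assumes g: "g \<in> borel_measurable M" and g2: "dominated M V (\<lambda>x. (g x)\<^sup>2)"
  shows "square_integrable \<Omega> (\<lambda>\<omega>. g (\<Phi> n \<omega>))"
proof -
  have "(\<lambda>\<omega>. g (\<Phi> n \<omega>)) \<in> borel_measurable \<Omega>" by (rule measurable_compose[OF \<Phi> g])
  then show ?thesis using integrable_\<Phi>[OF g2] by (simp add: square_integrable_def)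
qed

text \<open>With \<open>S\<^sub>n\<close> the sum of the increments of \<open>q\<close> and \<open>A\<^sub>n\<close> that of the increments of
  \<open>g y - E g x\<close>, the product splits as
  \<open>time_avg f \<Phi> n * S\<^sub>n = a S\<^sub>n + (g (\<Phi> 0) - g (\<Phi> n)) S\<^sub>n / n + A\<^sub>n S\<^sub>n / n\<close>.
  The first term has mean zero. The last one is the covariation, whose limit is the Cesaro limit
  \<open>l\<close>. In the middle term the second moment of \<open>S\<^sub>n\<close> grows linearly and that of the difference is
  bounded, so its mean is of order \<open>1 / sqrt n\<close>.\<close>
lemma score_covariance_limit:
  assumes q: "fair q"
    and g: "g \<in> borel_measurable M" and g2: "dominated M V (\<lambda>x. (g x)\<^sup>2)"
    and f: "\<And>x. x \<in> space M \<Longrightarrow> f x = a + (g x - E g x)"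
    and G: "dominated M V G" and u: "dominated M V (\<lambda>x. \<integral>y. g y * q x y \<partial>Q x)"
    and poisson: "\<And>x. x \<in> space M \<Longrightarrow> G x - E G x = (\<integral>y. g y * q x y \<partial>Q x) - l"
  shows "integrable \<Omega> (\<lambda>\<omega>. time_avg f \<Phi> n \<omega> * (\<Sum>j<n. increment q j \<omega>))"
    and "(\<lambda>n. \<integral>\<omega>. time_avg f \<Phi> n \<omega> * (\<Sum>j<n. increment q j \<omega>) \<partial>\<Omega>) \<longlonglongrightarrow> l"
proof -
  interpret prob_space \<Omega> by (rule prob_\<Omega>)
  let ?q2 = "\<lambda>x y. g y - E g x"
  define S where "S n \<omega> = (\<Sum>j<n. increment q j \<omega>)" for n \<omega>
  define A where "A n \<omega> = (\<Sum>j<n. increment ?q2 j \<omega>)" for n \<omega>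
  define d where "d n \<omega> = g (\<Phi> 0 \<omega>) - g (\<Phi> n \<omega>)" for n \<omega>
  note q2 = fair_centred[OF g g2]
  have sS: "square_integrable \<Omega> (S n)" for n
    unfolding S_def[abs_def] by (intro square_integrable_sum increment_square_integrable(1) q)
  have sA: "square_integrable \<Omega> (A n)" for n
    unfolding A_def[abs_def] by (rule square_integrable_sum) (rule increment_square_integrable(1)[OF q2])
  have sd: "square_integrable \<Omega> (d n)" for n
    unfolding d_def[abs_def] by (intro square_integrable_diff square_integrable_\<Phi> g g2)
  have iS: "integrable \<Omega> (S n)" for n
    by (rule square_integrable_integrable[OF sS prob_\<Omega>])
  note iAS = square_integrable_mult[OF sA sS] and idS = square_integrable_mult[OF sd sS]
  have decomp: "time_avg f \<Phi> n \<omega> * S n \<omega> = a * S n \<omega> + (1 / real n) * (d n \<omega> * S n \<omega>) + (1 / real n) * (A n \<omega> * S n \<omega>)"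
    if \<omega>: "\<omega> \<in> space \<Omega>" and n: "1 \<le> n" for n \<omega>
  proof -
    have "(\<Sum>j<n. f (\<Phi> j \<omega>)) = (\<Sum>j<n. a + (g (\<Phi> j \<omega>) - g (\<Phi> (Suc j) \<omega>)) + increment ?q2 j \<omega>)"
      by (rule sum.cong) (use f[OF \<Phi>_space[OF \<omega>]] in auto)
    also have "\<dots> = real n * a + d n \<omega> + A n \<omega>"
      unfolding sum.distrib using sum_lessThan_telescope'[of "\<lambda>j. g (\<Phi> j \<omega>)" n]
      by (simp add: d_def A_def)
    finally have "time_avg f \<Phi> n \<omega> = a + (1 / real n) * d n \<omega> + (1 / real n) * A n \<omega>"
      using n by (simp add: time_avg_def field_simps)
    then show ?thesis by (simp add: algebra_simps)
  qed
  have int: "integrable \<Omega> (\<lambda>\<omega>. time_avg f \<Phi> n \<omega> * S n \<omega>)" for n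
  proof (cases "1 \<le> n")
    case True
    have "integrable \<Omega> (\<lambda>\<omega>. a * S n \<omega> + (1 / real n) * (d n \<omega> * S n \<omega>) + (1 / real n) * (A n \<omega> * S n \<omega>))"
      using iS iAS idS by simp
    moreover have "integrable \<Omega> (\<lambda>\<omega>. time_avg f \<Phi> n \<omega> * S n \<omega>) \<longleftrightarrow>
        integrable \<Omega> (\<lambda>\<omega>. a * S n \<omega> + (1 / real n) * (d n \<omega> * S n \<omega>) + (1 / real n) * (A n \<omega> * S n \<omega>))"
      by (rule Bochner_Integration.integrable_cong) (use decomp True in auto)
    ultimately show ?thesis by blast
  next
    case False
    then have "n = 0" by simp
    then show ?thesis by (simp add: S_def)
  qed
  then show "integrable \<Omega> (\<lambda>\<omega>. time_avg f \<Phi> n \<omega> * (\<Sum>j<n. increment q j \<omega>))"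
    by (simp add: S_def)
  have ES: "(\<integral>\<omega>. S n \<omega> \<partial>\<Omega>) = 0" for n
    unfolding S_def
    by (subst Bochner_Integration.integral_sum)
      (auto simp: increment_mean_zero[OF q] intro: square_integrable_integrable[OF increment_square_integrable(1)[OF q] prob_\<Omega>])
  define r where "r n = (1 / real n) * (\<integral>\<omega>. d n \<omega> * S n \<omega> \<partial>\<Omega>)" for n
  define v where "v n = (1 / real n) * (\<Sum>j<n. \<integral>\<omega>. (\<integral>y. g y * q (\<Phi> j \<omega>) y \<partial>Q (\<Phi> j \<omega>)) \<partial>\<Omega>)" for n
  have inner: "(\<integral>y. ?q2 x y * q x y \<partial>Q x) = (\<integral>y. g y * q x y \<partial>Q x)" if x: "x \<in> space M" for x
  proof -
    interpret Qx: prob_space "Q x" by (rule prob_Q[OF x])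
    have sg: "square_integrable (Q x) g"
      using integrable_dominated[OF g2 x] g sets_Q[OF x]
      by (simp add: square_integrable_def cong: measurable_cong_sets)
    note sq = fair_square_integrable[OF q x]
    have "(\<integral>y. ?q2 x y * q x y \<partial>Q x) = (\<integral>y. g y * q x y - E g x * q x y \<partial>Q x)"
      by (simp add: left_diff_distrib)
    also have "\<dots> = (\<integral>y. g y * q x y \<partial>Q x) - E g x * (\<integral>y. q x y \<partial>Q x)"
      using square_integrable_mult[OF sg sq] square_integrable_integrable[OF sq prob_Q[OF x]] by simp
    finally show ?thesis using q x by (simp add: fair_def)
  qed
  have EAS: "(\<integral>\<omega>. A n \<omega> * S n \<omega> \<partial>\<Omega>) = (\<Sum>j<n. \<integral>\<omega>. (\<integral>y. g y * q (\<Phi> j \<omega>) y \<partial>Q (\<Phi> j \<omega>)) \<partial>\<Omega>)" for n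
    unfolding A_def S_def expectation_martingale_product[OF q2 q]
    by (rule sum.cong[OF refl], rule Bochner_Integration.integral_cong[OF refl], rule inner, rule \<Phi>_space)
  have ES_eq: "(\<integral>\<omega>. time_avg f \<Phi> n \<omega> * S n \<omega> \<partial>\<Omega>) = r n + v n" if n: "1 \<le> n" for n
  proof -
    have "(\<integral>\<omega>. time_avg f \<Phi> n \<omega> * S n \<omega> \<partial>\<Omega>) =
      (\<integral>\<omega>. a * S n \<omega> + (1 / real n) * (d n \<omega> * S n \<omega>) + (1 / real n) * (A n \<omega> * S n \<omega>) \<partial>\<Omega>)"
      by (rule Bochner_Integration.integral_cong) (use decomp n in auto)
    also have "\<dots> = a * (\<integral>\<omega>. S n \<omega> \<partial>\<Omega>) + (1 / real n) * (\<integral>\<omega>. d n \<omega> * S n \<omega> \<partial>\<Omega>) + (1 / real n) * (\<integral>\<omega>. A n \<omega> * S n \<omega> \<partial>\<Omega>)"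
      using iS iAS idS by simp
    finally show ?thesis by (simp only: ES EAS r_def v_def mult_zero_right add_0)
  qed
  have v: "v \<longlonglongrightarrow> l"
    unfolding v_def[abs_def] by (rule cesaro_expectation[OF G u poisson])
  have r: "r \<longlonglongrightarrow> 0"
  proof -
    obtain c1 where c1: "0 \<le> c1" "\<And>x. x \<in> space M \<Longrightarrow> \<bar>(g x)\<^sup>2\<bar> \<le> c1 * V x" using g2 by (auto elim: dominatedE)
    obtain c2 where c2: "0 \<le> c2" "\<And>x. x \<in> space M \<Longrightarrow> (\<integral>y. (q x y)\<^sup>2 \<partial>Q x) \<le> c2 * V x"
      using q by (auto simp: fair_def)
    define k1 where "k1 = 4 * (c1 * V_bound)"
    define k2 where "k2 = c2 * V_bound"
    have S2: "(\<integral>\<omega>. (S n \<omega>)\<^sup>2 \<partial>\<Omega>) \<le> real n * k2" for n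
    proof -
      have "(\<integral>\<omega>. (S n \<omega>)\<^sup>2 \<partial>\<Omega>) = (\<Sum>j<n. \<integral>\<omega>. (\<integral>y. q (\<Phi> j \<omega>) y * q (\<Phi> j \<omega>) y \<partial>Q (\<Phi> j \<omega>)) \<partial>\<Omega>)"
        unfolding S_def power2_eq_square by (rule expectation_martingale_product[OF q q])
      also have "\<dots> = (\<Sum>j<n. \<integral>\<omega>. (increment q j \<omega>)\<^sup>2 \<partial>\<Omega>)"
        using increments_product[OF q q] by (simp add: power2_eq_square)
      also have "\<dots> \<le> (\<Sum>j<n. k2)"
        unfolding k2_def by (rule sum_mono) (rule increment_square_integrable(2)[OF q c2])
      finally show ?thesis by simp
    qed
    have d2: "(\<integral>\<omega>. (d n \<omega>)\<^sup>2 \<partial>\<Omega>) \<le> k1" for n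
    proof -
      have ig: "integrable \<Omega> (\<lambda>\<omega>. (g (\<Phi> j \<omega>))\<^sup>2)" for j by (rule integrable_\<Phi>[OF g2])
      have sq: "(s - t)\<^sup>2 \<le> 2 * s\<^sup>2 + 2 * t\<^sup>2" for s t :: real
        using zero_le_power2[of "s + t"] by (simp add: power2_sum power2_diff)
      have "(\<integral>\<omega>. (d n \<omega>)\<^sup>2 \<partial>\<Omega>) \<le> (\<integral>\<omega>. 2 * (g (\<Phi> 0 \<omega>))\<^sup>2 + 2 * (g (\<Phi> n \<omega>))\<^sup>2 \<partial>\<Omega>)"
        by (rule integral_mono) (use sd ig sq in \<open>auto simp: square_integrable_def d_def\<close>)
      also have "\<dots> = 2 * (\<integral>\<omega>. (g (\<Phi> 0 \<omega>))\<^sup>2 \<partial>\<Omega>) + 2 * (\<integral>\<omega>. (g (\<Phi> n \<omega>))\<^sup>2 \<partial>\<Omega>)"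
        using ig by simp
      also have "\<dots> \<le> k1"
        using expectation_\<Phi>_le[OF g2 c1, of 0] expectation_\<Phi>_le[OF g2 c1, of n] unfolding k1_def by linarith
      finally show ?thesis .
    qed
    have bound: "norm (r n) \<le> (k1 + k2) / 2 * (1 / sqrt (real n))" if n: "1 \<le> n" for n
    proof -
      have n0: "0 < sqrt (real n)" using n by simp
      \<comment> \<open>The weights balance the bounded second moment of \<open>d n\<close> against the linearly growing one of
        \<open>S n\<close>, so that both sides contribute the order \<open>sqrt n\<close>.\<close>
      have amgm: "\<bar>s * t\<bar> \<le> (sqrt (real n) * s\<^sup>2 + t\<^sup>2 / sqrt (real n)) / 2" for s t :: real
      proof -
        have "0 \<le> (sqrt (real n) * \<bar>s\<bar> - \<bar>t\<bar>)\<^sup>2 / sqrt (real n)" using n0 by simp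
        also have "\<dots> = sqrt (real n) * s\<^sup>2 + t\<^sup>2 / sqrt (real n) - 2 * \<bar>s * t\<bar>"
          using n0 by (simp add: power2_eq_square abs_mult field_simps)
        finally show ?thesis by simp
      qed
      have "\<bar>\<integral>\<omega>. d n \<omega> * S n \<omega> \<partial>\<Omega>\<bar> \<le> (\<integral>\<omega>. \<bar>d n \<omega> * S n \<omega>\<bar> \<partial>\<Omega>)" by (rule integral_abs_bound)
      also have "\<dots> \<le> (\<integral>\<omega>. (sqrt (real n) * (d n \<omega>)\<^sup>2 + (S n \<omega>)\<^sup>2 / sqrt (real n)) / 2 \<partial>\<Omega>)"
        by (rule integral_mono) (use idS sd sS amgm in \<open>auto simp: square_integrable_def\<close>)
      also have "\<dots> = (sqrt (real n) * (\<integral>\<omega>. (d n \<omega>)\<^sup>2 \<partial>\<Omega>) + (\<integral>\<omega>. (S n \<omega>)\<^sup>2 \<partial>\<Omega>) / sqrt (real n)) / 2"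
        using sd[of n] sS[of n] by (simp add: square_integrable_def)
      also have "\<dots> \<le> (sqrt (real n) * k1 + (real n * k2) / sqrt (real n)) / 2"
        using n0 by (intro divide_right_mono add_mono mult_left_mono d2 S2) auto
      also have "\<dots> = (k1 + k2) / 2 * sqrt (real n)"
      proof -
        have "(real n * k2) / sqrt (real n) = k2 * sqrt (real n)"
          using real_div_sqrt[of "real n"] by (simp add: mult.commute flip: times_divide_eq_right)
        then show ?thesis by (simp add: algebra_simps)
      qed
      finally have "(1 / real n) * \<bar>\<integral>\<omega>. d n \<omega> * S n \<omega> \<partial>\<Omega>\<bar> \<le> (1 / real n) * ((k1 + k2) / 2 * sqrt (real n))"
        by (intro mult_left_mono) auto
      also have "\<dots> = (k1 + k2) / 2 * (1 / sqrt (real n))"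
      proof -
        have "sqrt (real n) / real n = 1 / sqrt (real n)"
          using n0 n by (simp add: field_simps flip: power2_eq_square)
        moreover have "(1 / real n) * ((k1 + k2) / 2 * sqrt (real n)) = (k1 + k2) / 2 * (sqrt (real n) / real n)"
          by simp
        ultimately show ?thesis by (simp only:)
      qed
      finally show ?thesis by (simp add: r_def abs_mult)
    qed
    show ?thesis
    proof (rule Lim_null_comparison)
      show "\<forall>\<^sub>F n in sequentially. norm (r n) \<le> (k1 + k2) / 2 * (1 / sqrt (real n))"
        using bound by (auto simp: eventually_sequentially intro!: exI[of _ 1])
      have "(\<lambda>n. 1 / sqrt (real n)) \<longlonglongrightarrow> 0"
        by (intro tendsto_divide_0[OF tendsto_const] filterlim_compose[OF filterlim_at_top_imp_at_infinity sqrt_at_top]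
            filterlim_real_sequentially filterlim_at_top_imp_at_infinity filterlim_compose[OF sqrt_at_top])
      then show "(\<lambda>n. (k1 + k2) / 2 * (1 / sqrt (real n))) \<longlonglongrightarrow> 0"
        by (rule tendsto_mult_right_zero)
    qed
  qed
  have "(\<lambda>n. r n + v n) \<longlonglongrightarrow> l" using tendsto_add[OF r v] by simp
  then have "(\<lambda>n. \<integral>\<omega>. time_avg f \<Phi> n \<omega> * S n \<omega> \<partial>\<Omega>) \<longlonglongrightarrow> l"
    by (rule Lim_transform_eventually) (use ES_eq in \<open>auto simp: eventually_sequentially intro!: exI[of _ 1]\<close>)
  then show "(\<lambda>n. \<integral>\<omega>. time_avg f \<Phi> n \<omega> * (\<Sum>j<n. increment q j \<omega>) \<partial>\<Omega>) \<longlonglongrightarrow> l"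
    by (simp add: S_def)
qed

end

section \<open>Differentiating the stationary mean\<close>

text \<open>Here \<open>e h\<close> bounds the weighted norm of \<open>(R h - Q) / h - D\<close>. The central identity \<open>expand\<close> holds
  for every Poisson pair \<open>(G, w)\<close> of the base kernel. It is used twice: for an arbitrary dominated
  function it yields convergence of \<open>\<rho> h\<close> to \<open>\<rho> 0\<close>, and for \<open>(g, f)\<close> it yields the
  difference quotient itself.\<close>
lemma (in small_drift_kernel) stationary_derivative:
  fixes R :: "real \<Rightarrow> 'a \<Rightarrow> 'a measure" and \<rho> :: "real \<Rightarrow> 'a measure"
    and D :: "('a \<Rightarrow> real) \<Rightarrow> 'a \<Rightarrow> real" and e :: "real \<Rightarrow> real"
  assumes inv0: "invariant_dist M Q (\<rho> 0)"
    and near: "\<forall>\<^sub>F h in at 0. drift_kernel M (R h) V K lam b \<and> invariant_dist M (R h) (\<rho> h)"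
    and D: "\<And>g. dominated M V g \<Longrightarrow> dominated M V (D g)"
    and e: "(e \<longlongrightarrow> 0) (at 0)" "\<And>h. 0 \<le> e h"
    and quotient: "\<forall>\<^sub>F h in at 0. \<forall>g c x. g \<in> borel_measurable M \<longrightarrow> 0 \<le> c \<longrightarrow>
      (\<forall>y\<in>space M. \<bar>g y\<bar> \<le> c * V y) \<longrightarrow> x \<in> space M \<longrightarrow>
      \<bar>(kernel_app (R h) g x - E g x) / h - D g x\<bar> \<le> (c * e h) * V x"
    and g: "dominated M V g" and poisson: "\<And>x. x \<in> space M \<Longrightarrow> g x - E g x = f x - (\<integral>x. f x \<partial>\<rho> 0)"
    and f: "dominated M V f"
  shows "((\<lambda>h. \<integral>x. f x \<partial>\<rho> h) has_real_derivative (\<integral>x. D g x \<partial>\<rho> 0)) (at 0)"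
proof -
  define B where "B = b / (1 - lam)"
  have B: "0 \<le> B" using lam b_pos by (simp add: B_def)
  define T where "T h w x = (kernel_app (R h) w x - E w x) / h - D w x" for h w x
  \<comment> \<open>The distances \<open>h\<close> at which all hypotheses on the perturbed kernel are available.\<close>
  define good where "good h \<longleftrightarrow> h \<noteq> 0 \<and> drift_kernel M (R h) V K lam b \<and> invariant_dist M (R h) (\<rho> h) \<and>
    (\<forall>g c x. g \<in> borel_measurable M \<longrightarrow> 0 \<le> c \<longrightarrow>
      (\<forall>y\<in>space M. \<bar>g y\<bar> \<le> c * V y) \<longrightarrow> x \<in> space M \<longrightarrow> \<bar>T h g x\<bar> \<le> (c * e h) * V x)" for h
  have ev: "\<forall>\<^sub>F h in at 0. good h"
    using near quotient eventually_neq_at_within[of 0 0 UNIV] unfolding good_def T_def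
    by eventually_elim blast
  have expand: "(\<integral>x. w x \<partial>\<rho> h) - a = h * ((\<integral>x. T h G x \<partial>\<rho> h) + (\<integral>x. D G x \<partial>\<rho> h))"
    and T_bound: "0 \<le> c \<Longrightarrow> (\<And>x. x \<in> space M \<Longrightarrow> \<bar>G x\<bar> \<le> c * V x) \<Longrightarrow> \<bar>\<integral>x. T h G x \<partial>\<rho> h\<bar> \<le> c * e h * B"
    and D_bound: "0 \<le> c' \<Longrightarrow> (\<And>x. x \<in> space M \<Longrightarrow> \<bar>D G x\<bar> \<le> c' * V x) \<Longrightarrow> \<bar>\<integral>x. D G x \<partial>\<rho> h\<bar> \<le> c' * B"
    if h: "good h" and G: "dominated M V G" and w: "dominated M V w"
      and eq: "\<And>x. x \<in> space M \<Longrightarrow> G x - E G x = w x - a" for h G w a c c'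
  proof -
    interpret R: drift_kernel M "R h" V K lam b using h by (simp add: good_def)
    have inv: "invariant_dist M (R h) (\<rho> h)" and h0: "h \<noteq> 0" using h by (auto simp: good_def)
    have sp: "space (\<rho> h) = space M" and pr: "prob_space (\<rho> h)"
      using inv by (auto simp: invariant_dist_def space_prob_algebra dest: sets_eq_imp_space_eq)
    interpret pr: prob_space "\<rho> h" by (rule pr)
    note int = R.invariant_integrable[OF inv]
    have dT: "dominated M V (T h G)"
      unfolding T_def[abs_def] divide_inverse mult.commute[of _ "inverse h"]
      by (intro dominated_intros R.dominated_E dominated_E D G)
    have "(\<integral>x. w x \<partial>\<rho> h) - a = (\<integral>x. w x - a \<partial>\<rho> h)"
      using int[OF w] by (simp add: pr.prob_space)
    also have "\<dots> = (\<integral>x. G x - E G x \<partial>\<rho> h)"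
      by (rule Bochner_Integration.integral_cong) (simp_all add: eq sp)
    also have "\<dots> = (\<integral>x. R.E G x - E G x \<partial>\<rho> h)"
      using int[OF G] int[OF dominated_E[OF G]] int[OF R.dominated_E[OF G]] R.invariant_E[OF inv G] by simp
    also have "\<dots> = (\<integral>x. h * (T h G x + D G x) \<partial>\<rho> h)"
      using h0 by (intro Bochner_Integration.integral_cong) (simp_all add: T_def)
    also have "\<dots> = h * ((\<integral>x. T h G x \<partial>\<rho> h) + (\<integral>x. D G x \<partial>\<rho> h))"
      using int[OF dT] int[OF D[OF G]] by simp
    finally show "(\<integral>x. w x \<partial>\<rho> h) - a = h * ((\<integral>x. T h G x \<partial>\<rho> h) + (\<integral>x. D G x \<partial>\<rho> h))" .
    show "\<bar>\<integral>x. T h G x \<partial>\<rho> h\<bar> \<le> c * e h * B" if c: "0 \<le> c" "\<And>x. x \<in> space M \<Longrightarrow> \<bar>G x\<bar> \<le> c * V x"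
    proof -
      have "\<bar>T h G x\<bar> \<le> (c * e h) * V x" if "x \<in> space M" for x
        using h dominatedD[OF G] c that unfolding good_def by blast
      then show ?thesis
        using R.invariant_abs_le[OF inv dominatedD[OF dT], of "c * e h"] c(1) e(2)[of h] by (simp add: B_def)
    qed
    show "\<bar>\<integral>x. D G x \<partial>\<rho> h\<bar> \<le> c' * B" if c': "0 \<le> c'" "\<And>x. x \<in> space M \<Longrightarrow> \<bar>D G x\<bar> \<le> c' * V x"
      unfolding B_def by (rule R.invariant_abs_le[OF inv dominatedD[OF D[OF G]] c'])
  qed
  have weak: "((\<lambda>h. \<integral>x. u x \<partial>\<rho> h) \<longlongrightarrow> (\<integral>x. u x \<partial>\<rho> 0)) (at 0)" if u: "dominated M V u" for u
  proof -
    obtain G where G: "dominated M V G" "\<And>x. x \<in> space M \<Longrightarrow> G x - E G x = u x - (\<integral>x. u x \<partial>\<rho> 0)"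
      by (rule poisson_equation[OF inv0 u]) blast
    obtain c where c: "0 \<le> c" "\<And>x. x \<in> space M \<Longrightarrow> \<bar>G x\<bar> \<le> c * V x" using G(1) by (auto elim: dominatedE)
    obtain c' where c': "0 \<le> c'" "\<And>x. x \<in> space M \<Longrightarrow> \<bar>D G x\<bar> \<le> c' * V x"
      using D[OF G(1)] by (auto elim: dominatedE)
    have "((\<lambda>h. (\<integral>x. u x \<partial>\<rho> h) - (\<integral>x. u x \<partial>\<rho> 0)) \<longlongrightarrow> 0) (at 0)"
    proof (rule Lim_null_comparison)
      show "\<forall>\<^sub>F h in at 0. norm ((\<integral>x. u x \<partial>\<rho> h) - (\<integral>x. u x \<partial>\<rho> 0)) \<le> \<bar>h\<bar> * (c * e h * B + c' * B)"
        using ev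
      proof eventually_elim
        case (elim h)
        have "\<bar>(\<integral>x. T h G x \<partial>\<rho> h) + (\<integral>x. D G x \<partial>\<rho> h)\<bar> \<le> c * e h * B + c' * B"
          using T_bound[OF elim G(1) u G(2) c] D_bound[OF elim G(1) u G(2) c'] by linarith
        then show ?case
          using expand[OF elim G(1) u G(2)] by (simp add: abs_mult mult_left_mono)
      qed
      have "((\<lambda>h. \<bar>h\<bar> * (c * e h * B + c' * B)) \<longlongrightarrow> \<bar>0\<bar> * (c * 0 * B + c' * B)) (at 0)"
        by (intro tendsto_intros e)
      then show "((\<lambda>h. \<bar>h\<bar> * (c * e h * B + c' * B)) \<longlongrightarrow> 0) (at 0)" by simp
    qed
    then show ?thesis by (simp add: LIM_zero_iff)
  qed
  obtain c where c: "0 \<le> c" "\<And>x. x \<in> space M \<Longrightarrow> \<bar>g x\<bar> \<le> c * V x" using g by (auto elim: dominatedE)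
  have "((\<lambda>h. \<integral>x. T h g x \<partial>\<rho> h) \<longlongrightarrow> 0) (at 0)"
  proof (rule Lim_null_comparison)
    show "\<forall>\<^sub>F h in at 0. norm (\<integral>x. T h g x \<partial>\<rho> h) \<le> c * e h * B"
      using ev by eventually_elim (simp, rule T_bound[OF _ g f poisson c])
    have "((\<lambda>h. c * e h * B) \<longlongrightarrow> c * 0 * B) (at 0)" by (intro tendsto_intros e)
    then show "((\<lambda>h. c * e h * B) \<longlongrightarrow> 0) (at 0)" by simp
  qed
  from tendsto_add[OF this weak[OF D[OF g]]]
  have "((\<lambda>h. (\<integral>x. T h g x \<partial>\<rho> h) + (\<integral>x. D g x \<partial>\<rho> h)) \<longlongrightarrow> (\<integral>x. D g x \<partial>\<rho> 0)) (at 0)" by simp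
  then have "((\<lambda>h. ((\<integral>x. f x \<partial>\<rho> h) - (\<integral>x. f x \<partial>\<rho> 0)) / h) \<longlongrightarrow> (\<integral>x. D g x \<partial>\<rho> 0)) (at 0)"
  proof (rule Lim_transform_eventually)
    show "\<forall>\<^sub>F h in at 0. (\<integral>x. T h g x \<partial>\<rho> h) + (\<integral>x. D g x \<partial>\<rho> h) = ((\<integral>x. f x \<partial>\<rho> h) - (\<integral>x. f x \<partial>\<rho> 0)) / h"
      using ev by eventually_elim (subst expand[OF _ g f poisson], auto simp: good_def)
  qed
  then show ?thesis by (simp add: DERIV_def)
qed

section \<open>The square root of the weight\<close>

text \<open>Jensen's inequality, in the form that the variance of \<open>sqrt (V y)\<close> under \<open>Q x\<close> is nonnegative,
  followed by subadditivity of the square root.\<close>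
lemma (in drift_kernel) sqrt_drift_kernel:
  "drift_kernel M Q (\<lambda>x. sqrt (V x)) K (sqrt lam) (sqrt b)"
proof
  fix x assume x: "x \<in> space M"
  interpret prob_space "Q x" by (rule prob_Q[OF x])
  have ds: "dominated M V (\<lambda>x. sqrt (V x))"
  proof (rule dominatedI[where c = 1])
    show "\<bar>sqrt (V x)\<bar> \<le> 1 * V x" if "x \<in> space M" for x
    proof -
      have "sqrt (V x) * 1 \<le> sqrt (V x) * sqrt (V x)"
        using V_ge_1[OF that] by (intro mult_left_mono) auto
      then show ?thesis using V_nonneg[OF that] by simp
    qed
  qed auto
  note int_s = integrable_dominated[OF ds x]
  define s where "s = E (\<lambda>x. sqrt (V x)) x"
  have s0: "0 \<le> s" unfolding s_def by (rule E_nonneg[OF _ x]) (simp add: V_nonneg)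
  have "0 \<le> (\<integral>y. (sqrt (V y) - s)\<^sup>2 \<partial>Q x)" by simp
  also have "\<dots> = (\<integral>y. V y - 2 * s * sqrt (V y) + s\<^sup>2 \<partial>Q x)"
    by (rule Bochner_Integration.integral_cong) (simp_all add: power2_diff space_Q[OF x] V_nonneg)
  also have "\<dots> = E V x - 2 * s * s + s\<^sup>2"
    using int_s integrable_V[OF x] by (simp add: kernel_app_def s_def prob_space)
  finally have "s\<^sup>2 \<le> E V x" by (simp add: power2_eq_square)
  also have "\<dots> \<le> lam * V x + b * indicator K x" by (rule E_V_le[OF x])
  finally have "s \<le> sqrt (lam * V x + b * indicator K x)" by (rule real_le_rsqrt)
  also have "\<dots> \<le> sqrt (lam * V x) + sqrt (b * indicator K x)"
    by (rule sqrt_add_le_add_sqrt) (use lam b_pos V_nonneg[OF x] in auto)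
  also have "\<dots> = sqrt lam * sqrt (V x) + sqrt b * indicator K x"
    by (auto simp: real_sqrt_mult split: split_indicator)
  finally have "s \<le> sqrt lam * sqrt (V x) + sqrt b * indicator K x" .
  moreover have "(\<integral>\<^sup>+y. ennreal (sqrt (V y)) \<partial>Q x) = ennreal s"
    unfolding s_def kernel_app_def
    by (rule nn_integral_eq_integral[OF int_s AE_I2]) (simp add: space_Q[OF x] V_nonneg)
  ultimately show "(\<integral>\<^sup>+y. ennreal (sqrt (V y)) \<partial>Q x) \<le> ennreal (sqrt lam * sqrt (V x) + sqrt b * indicator K x)"
    by (simp add: ennreal_leI)
qed (use lam b_pos V_ge_1 kernel K_sets in auto)

lemma (in small_drift_kernel) sqrt_small_drift_kernel:
  "small_drift_kernel M Q (\<lambda>x. sqrt (V x)) K (sqrt lam) (sqrt b) m \<delta> \<nu>"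
  using sqrt_drift_kernel m \<delta> \<nu> minorization nonempty
  by (auto simp: small_drift_kernel_def small_drift_kernel_axioms_def)

lemma (in drift_kernel) sqrt_V_le: "x \<in> space M \<Longrightarrow> sqrt (V x) \<le> V x"
  using V_ge_1[of x] mult_left_mono[of 1 "sqrt (V x)" "sqrt (V x)"] by simp

lemma dominated_sqrt_square:
  assumes V: "\<And>x. x \<in> space M \<Longrightarrow> 0 \<le> V x" and g: "dominated M (\<lambda>x. sqrt (V x)) g"
  shows "dominated M V (\<lambda>x. (g x)\<^sup>2)"
proof -
  obtain c where c: "0 \<le> c" "\<And>x. x \<in> space M \<Longrightarrow> \<bar>g x\<bar> \<le> c * sqrt (V x)" using g by (auto elim: dominatedE)
  show ?thesis
  proof (rule dominatedI[where c = "c\<^sup>2"])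
    show "(\<lambda>x. (g x)\<^sup>2) \<in> borel_measurable M" using dominatedD[OF g] by measurable
    show "\<bar>(g x)\<^sup>2\<bar> \<le> c\<^sup>2 * V x" if x: "x \<in> space M" for x
      using power_mono[OF c(2)[OF x], of 2] V[OF x] by (simp add: power_mult_distrib)
  qed simp
qed

section \<open>Weighted operator norms and densities\<close>

lemma wnorm_le:
  assumes "\<And>x. x \<in> space M \<Longrightarrow> 0 < h x" "\<And>x. x \<in> space M \<Longrightarrow> \<bar>g x\<bar> \<le> c * h x"
  shows "wnorm M h g \<le> ennreal c"
  unfolding wnorm_def using assms by (intro SUP_least ennreal_leI) (simp add: pos_divide_le_eq)

lemma wnorm_bound:
  assumes "wnorm M h g < \<infinity>" "x \<in> space M" "0 < h x"
  shows "\<bar>g x\<bar> \<le> enn2real (wnorm M h g) * h x"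
proof -
  have "ennreal (\<bar>g x\<bar> / h x) \<le> wnorm M h g"
    unfolding wnorm_def using assms(2) by (rule SUP_upper)
  then have "\<bar>g x\<bar> / h x \<le> enn2real (wnorm M h g)"
    using assms by (metis enn2real_ennreal enn2real_mono abs_ge_zero divide_nonneg_pos infinity_ennreal_def)
  then show ?thesis using assms(3) by (simp add: pos_divide_le_eq)
qed

text \<open>The operator norm is a supremum over functions of norm exactly one, so a general \<open>g\<close> has to be
  rescaled by its norm; functions of norm zero vanish on the space and are covered by \<open>null\<close>.\<close>
lemma kernel_norm_bound:
  assumes V: "\<And>x. x \<in> space M \<Longrightarrow> 0 < V x"
    and hom: "\<And>a g. T (\<lambda>y. a * g y) x = a * T g x"
    and null: "\<And>g. (\<And>y. y \<in> space M \<Longrightarrow> g y = 0) \<Longrightarrow> T g x = 0"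
    and fin: "kernel_norm M V T < \<infinity>"
    and g: "g \<in> borel_measurable M" and c: "0 \<le> c" "\<And>y. y \<in> space M \<Longrightarrow> \<bar>g y\<bar> \<le> c * V y"
    and x: "x \<in> space M"
  shows "\<bar>T g x\<bar> \<le> (c * enn2real (kernel_norm M V T)) * V x"
proof -
  have le: "wnorm M V g \<le> ennreal c" by (rule wnorm_le[OF V c(2)])
  then have wfin: "wnorm M V g < \<infinity>" by (auto simp: le_less_trans)
  define r where "r = enn2real (wnorm M V g)"
  have r: "wnorm M V g = ennreal r" using wfin by (simp add: r_def)
  have r0: "0 \<le> r" by (simp add: r_def)
  have rc: "r \<le> c" using le c(1) unfolding r by (simp add: ennreal_le_iff)
  show ?thesis
  proof (cases "r = 0")
    case True
    have "T g x = 0"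
      by (rule null) (use wnorm_bound[OF wfin _ V] True in \<open>auto simp: r_def\<close>)
    then show ?thesis using c V[OF x] by simp
  next
    case False
    then have rp: "0 < r" using r0 by simp
    define g' where "g' = (\<lambda>y. (1 / r) * g y)"
    have "wnorm M V g' = (SUP y\<in>space M. ennreal (1 / r) * ennreal (\<bar>g y\<bar> / V y))"
      unfolding wnorm_def
    proof (rule SUP_cong[OF refl])
      fix y assume "y \<in> space M"
      then have "0 < V y" by (rule V)
      then show "ennreal (\<bar>g' y\<bar> / V y) = ennreal (1 / r) * ennreal (\<bar>g y\<bar> / V y)"
        using rp by (simp add: g'_def abs_mult ennreal_mult' flip: ennreal_mult)
    qed
    also have "\<dots> = ennreal (1 / r) * wnorm M V g"
      unfolding wnorm_def by (rule SUP_mult_left_ennreal[symmetric])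
    also have "\<dots> = 1" unfolding r using rp by (simp flip: ennreal_mult)
    finally have w: "wnorm M V g' = 1" .
    have m: "g' \<in> borel_measurable M" unfolding g'_def using g by measurable
    have "wnorm M V (T g') \<le> kernel_norm M V T"
      unfolding kernel_norm_def by (rule SUP_upper) (use w m in simp)
    then have "\<bar>T g' x\<bar> \<le> enn2real (kernel_norm M V T) * V x"
      using wnorm_bound[of M V "T g'" x] x V[OF x] fin enn2real_mono[of "wnorm M V (T g')" "kernel_norm M V T"]
      by (smt (verit) infinity_ennreal_def le_less_trans mult_right_mono)
    moreover have "T g x = r * T g' x"
      unfolding g'_def hom using rp by simp
    ultimately have "\<bar>T g x\<bar> \<le> r * (enn2real (kernel_norm M V T) * V x)"
      using rp by (simp add: abs_mult)
    also have "\<dots> \<le> c * (enn2real (kernel_norm M V T) * V x)"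
      using rc V[OF x] by (intro mult_right_mono) auto
    finally show ?thesis by (simp add: mult.assoc)
  qed
qed

text \<open>For the transfer of \<open>p \<theta>\<^sub>0 x y = 1\<close>, which holds only for almost every \<open>y\<close>, to the path of the
  chain.\<close>
lemma (in drift_chain) AE_step:
  assumes R [measurable]: "Measurable.pred (M \<Otimes>\<^sub>M M) (\<lambda>(x, y). R x y)"
    and ae: "\<And>x. x \<in> space M \<Longrightarrow> AE y in Q x. R x y"
  shows "AE \<omega> in \<Omega>. R (\<Phi> n \<omega>) (\<Phi> (Suc n) \<omega>)"
proof -
  let ?k = "\<lambda>h y. indicator {(x, y). \<not> R x y} (h n, y) :: ennreal"
  have Rm: "Measurable.pred (N \<Otimes>\<^sub>M M) (\<lambda>z. R (f (fst z)) (snd z))" if "f \<in> N \<rightarrow>\<^sub>M M" for f :: "'c \<Rightarrow> 'a" and N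
    using measurable_compose[OF _ R, of "\<lambda>z. (f (fst z), snd z)" "N \<Otimes>\<^sub>M M"] that by simp
  have k: "(\<lambda>(h, y). ?k h y) \<in> borel_measurable (path_space n \<Otimes>\<^sub>M M)"
    using Rm[OF path_component[OF order_refl]] by (simp add: split_beta indicator_def)
  have meas: "Measurable.pred \<Omega> (\<lambda>\<omega>. R (\<Phi> n \<omega>) (\<Phi> (Suc n) \<omega>))"
    using measurable_compose[OF _ R, of "\<lambda>\<omega>. (\<Phi> n \<omega>, \<Phi> (Suc n) \<omega>)" \<Omega>] by simp
  have "(\<integral>\<^sup>+\<omega>. ?k (hist n \<omega>) (\<Phi> (Suc n) \<omega>) \<partial>\<Omega>) = (\<integral>\<^sup>+\<omega>. (\<integral>\<^sup>+y. ?k (hist n \<omega>) y \<partial>Q (\<Phi> n \<omega>)) \<partial>\<Omega>)"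
    by (rule nn_integral_step[OF k])
  also have "\<dots> = (\<integral>\<^sup>+\<omega>. 0 \<partial>\<Omega>)"
  proof (rule nn_integral_cong)
    fix \<omega> assume "\<omega> \<in> space \<Omega>"
    then have x: "\<Phi> n \<omega> \<in> space M" by (rule \<Phi>_space)
    have "(\<integral>\<^sup>+y. ?k (hist n \<omega>) y \<partial>Q (\<Phi> n \<omega>)) = (\<integral>\<^sup>+y. 0 \<partial>Q (\<Phi> n \<omega>))"
      by (rule nn_integral_cong_AE) (use ae[OF x] in eventually_elim, simp)
    then show "(\<integral>\<^sup>+y. ?k (hist n \<omega>) y \<partial>Q (\<Phi> n \<omega>)) = 0" by simp
  qed
  finally have z: "(\<integral>\<^sup>+\<omega>. indicator {(x, y). \<not> R x y} (\<Phi> n \<omega>, \<Phi> (Suc n) \<omega>) \<partial>\<Omega>) = 0" by simp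
  have "AE \<omega> in \<Omega>. indicator {(x, y). \<not> R x y} (\<Phi> n \<omega>, \<Phi> (Suc n) \<omega>) = (0 :: ennreal)"
    using z meas by (subst (asm) nn_integral_0_iff_AE) (simp_all add: indicator_def)
  then show ?thesis by eventually_elim (simp split: split_indicator_asm)
qed

lemma coord_line_0 [simp]: "coord_line \<theta> i 0 = \<theta>"
  by (simp add: coord_line_def)

lemma partial_deriv_DERIV:
  assumes "grad_exists F \<theta>"
  shows "((\<lambda>h. F (coord_line \<theta> i h)) has_real_derivative partial_deriv i F \<theta>) (at 0)"
  using assms by (simp add: grad_exists_def partial_deriv_def DERIV_deriv_iff_field_differentiable)

text \<open>The product rule keeps the remaining factors \<open>p \<theta>\<^sub>0\<close>: a density of \<open>P \<theta>\<^sub>0 x\<close> with respect to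
  itself may differ from one on a null set.\<close>
lemma partial_deriv_likelihood:
  assumes "\<And>j. grad_exists (\<lambda>\<theta>. p \<theta> (\<Phi> j \<omega>) (\<Phi> (Suc j) \<omega>)) \<theta>\<^sub>0"
  shows "partial_deriv i (\<lambda>\<theta>. likelihood p \<Phi> n \<theta> \<omega>) \<theta>\<^sub>0 =
    (\<Sum>j<n. dens_deriv p \<theta>\<^sub>0 i (\<Phi> j \<omega>) (\<Phi> (Suc j) \<omega>) *
      (\<Prod>k\<in>{..<n} - {j}. p \<theta>\<^sub>0 (\<Phi> k \<omega>) (\<Phi> (Suc k) \<omega>)))"
proof -
  have lik: "likelihood p \<Phi> n \<theta> \<omega> = (\<Prod>j<n. p \<theta> (\<Phi> j \<omega>) (\<Phi> (Suc j) \<omega>))" for \<theta>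
    unfolding likelihood_def by (simp add: prod.atLeast1_atMost_eq)
  have "((\<lambda>h. likelihood p \<Phi> n (coord_line \<theta>\<^sub>0 i h) \<omega>) has_real_derivative
    (\<Sum>j<n. dens_deriv p \<theta>\<^sub>0 i (\<Phi> j \<omega>) (\<Phi> (Suc j) \<omega>) *
      (\<Prod>k\<in>{..<n} - {j}. p (coord_line \<theta>\<^sub>0 i 0) (\<Phi> k \<omega>) (\<Phi> (Suc k) \<omega>)))) (at 0)"
    unfolding lik dens_deriv_def
    by (rule has_field_derivative_prod) (rule partial_deriv_DERIV[OF assms])
  then show ?thesis
    unfolding partial_deriv_def[of _ "\<lambda>\<theta>. likelihood p \<Phi> n \<theta> \<omega>"] by (simp add: DERIV_imp_deriv)
qed

lemma eventually_coord_line_param_box: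
  assumes "\<forall>\<^sub>F h in at 0. coord_line \<theta>\<^sub>0 i h \<in> \<Theta>" "\<epsilon> > 0"
  shows "\<forall>\<^sub>F h in at 0. coord_line \<theta>\<^sub>0 i h \<in> param_box \<Theta> \<theta>\<^sub>0 \<epsilon>"
proof -
  have "\<forall>\<^sub>F h in at 0. \<bar>h\<bar> < \<epsilon>"
    using assms(2) by (auto simp: eventually_at dist_real_def)
  with assms(1) show ?thesis
  proof eventually_elim
    case (elim h)
    have "\<bar>coord_line \<theta>\<^sub>0 i h $ k - \<theta>\<^sub>0 $ k\<bar> \<le> \<bar>h\<bar>" for k
      by (simp add: coord_line_def axis_def)
    then have "\<bar>coord_line \<theta>\<^sub>0 i h $ k - \<theta>\<^sub>0 $ k\<bar> < \<epsilon>" for k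
      using elim(2) by (rule le_less_trans)
    then show ?case using elim(1) by (auto simp: param_box_def)
  qed
qed

lemma vec_integral_componentwise:
  fixes X :: "'a \<Rightarrow> real ^ 'd"
  assumes X: "\<And>i. integrable N (\<lambda>\<omega>. X \<omega> $ i)"
  shows "integrable N X" and "integral\<^sup>L N X $ i = (\<integral>\<omega>. X \<omega> $ i \<partial>N)"
proof -
  have eq: "X = (\<lambda>\<omega>. \<Sum>i\<in>UNIV. (X \<omega> $ i) *\<^sub>R axis i 1)"
    by (rule ext) (simp add: vec_eq_iff axis_def if_distrib cong: if_cong)
  have "integrable N (\<lambda>\<omega>. \<Sum>i\<in>UNIV. (X \<omega> $ i) *\<^sub>R axis i (1::real))"
    using X by (intro Bochner_Integration.integrable_sum integrable_scaleR_left) auto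
  then show int: "integrable N X" using eq by simp
  show "integral\<^sup>L N X $ i = (\<integral>\<omega>. X \<omega> $ i \<partial>N)"
    by (rule integral_bounded_linear[symmetric, OF bounded_linear_vec_nth int])
qed

text \<open>The derivative is a pointwise limit of difference quotients along a sequence of parameters at
  which the densities are jointly measurable.\<close>
lemma borel_measurable_dens_deriv:
  assumes box: "\<forall>\<^sub>F h in at 0. coord_line \<theta>\<^sub>0 i h \<in> B" "\<theta>\<^sub>0 \<in> B"
    and meas: "\<And>\<theta>. \<theta> \<in> B \<Longrightarrow> (\<lambda>(x, y). p \<theta> x y) \<in> borel_measurable (M \<Otimes>\<^sub>M M)"
    and diff: "\<And>x y. x \<in> space M \<Longrightarrow> y \<in> space M \<Longrightarrow> grad_exists (\<lambda>\<theta>. p \<theta> x y) \<theta>\<^sub>0"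
  shows "(\<lambda>(x, y). dens_deriv p \<theta>\<^sub>0 i x y) \<in> borel_measurable (M \<Otimes>\<^sub>M M)"
proof -
  define s where "s n = inverse (real (Suc n))" for n
  have s: "filterlim s (at 0) sequentially"
    unfolding filterlim_at s_def using LIMSEQ_inverse_real_of_nat by (simp add: s_def)
  from box(1) have "\<forall>\<^sub>F n in sequentially. coord_line \<theta>\<^sub>0 i (s n) \<in> B"
    by (rule eventually_compose_filterlim[OF _ s])
  then obtain N where N: "\<And>n. coord_line \<theta>\<^sub>0 i (s (n + N)) \<in> B"
    unfolding eventually_sequentially by (metis le_add2)
  define F where "F n = (\<lambda>(x, y). (p (coord_line \<theta>\<^sub>0 i (s (n + N))) x y - p \<theta>\<^sub>0 x y) / s (n + N))" for n
  show ?thesis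
  proof (rule borel_measurable_LIMSEQ_real)
    show "F n \<in> borel_measurable (M \<Otimes>\<^sub>M M)" for n
    proof -
      have "(\<lambda>z. (case z of (x, y) \<Rightarrow> p (coord_line \<theta>\<^sub>0 i (s (n + N))) x y)) \<in> borel_measurable (M \<Otimes>\<^sub>M M)"
        "(\<lambda>z. (case z of (x, y) \<Rightarrow> p \<theta>\<^sub>0 x y)) \<in> borel_measurable (M \<Otimes>\<^sub>M M)"
        using meas[OF N] meas[OF box(2)] by auto
      then have "(\<lambda>z. ((case z of (x, y) \<Rightarrow> p (coord_line \<theta>\<^sub>0 i (s (n + N))) x y) - (case z of (x, y) \<Rightarrow> p \<theta>\<^sub>0 x y)) / s (n + N))
        \<in> borel_measurable (M \<Otimes>\<^sub>M M)"
        by (intro borel_measurable_divide borel_measurable_diff borel_measurable_const)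
      then show ?thesis by (simp add: F_def split_beta)
    qed
    fix z assume "z \<in> space (M \<Otimes>\<^sub>M M)"
    then obtain x y where z: "z = (x, y)" "x \<in> space M" "y \<in> space M"
      by (auto simp: space_pair_measure)
    have "((\<lambda>h. (p (coord_line \<theta>\<^sub>0 i h) x y - p \<theta>\<^sub>0 x y) / h) \<longlongrightarrow> dens_deriv p \<theta>\<^sub>0 i x y) (at 0)"
      using partial_deriv_DERIV[OF diff[OF z(2,3)], of i] by (simp add: DERIV_def dens_deriv_def)
    from filterlim_compose[OF this s]
    have "(\<lambda>n. (p (coord_line \<theta>\<^sub>0 i (s n)) x y - p \<theta>\<^sub>0 x y) / s n) \<longlonglongrightarrow> dens_deriv p \<theta>\<^sub>0 i x y" .
    from LIMSEQ_ignore_initial_segment[OF this, of N]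
    show "(\<lambda>n. F n z) \<longlonglongrightarrow> (case z of (x, y) \<Rightarrow> dens_deriv p \<theta>\<^sub>0 i x y)"
      by (simp add: F_def z)
  qed
qed

section \<open>The likelihood ratio estimator of the gradient\<close>

theorem theorem2p10:
  fixes M :: "'x measure" and \<Theta> :: "(real^'d) set" and \<theta>\<^sub>0 :: "real^'d" and \<epsilon> :: real
    and P :: "real^'d \<Rightarrow> 'x \<Rightarrow> 'x measure" and p :: "real^'d \<Rightarrow> 'x \<Rightarrow> 'x \<Rightarrow> real"
    and \<pi> :: "real^'d \<Rightarrow> 'x measure" and f V :: "'x \<Rightarrow> real"
    and K :: "'x set" and \<delta> lam b :: real and m :: nat and \<nu> \<mu> :: "'x measure"
    and \<Omega> :: "'w measure" and \<Phi> :: "nat \<Rightarrow> 'w \<Rightarrow> 'x"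
  assumes countably_generated: "countably_generated M"
    and base_point: "\<theta>\<^sub>0 \<in> \<Theta>" "\<And>i. \<forall>\<^sub>F h in at 0. coord_line \<theta>\<^sub>0 i h \<in> \<Theta>"
    and eps: "\<epsilon> > 0"
    and kernel: "\<And>\<theta>. \<theta> \<in> \<Theta> \<Longrightarrow> P \<theta> \<in> M \<rightarrow>\<^sub>M prob_algebra M"
    and stationary: "\<And>\<theta>. \<theta> \<in> param_box \<Theta> \<theta>\<^sub>0 \<epsilon> \<Longrightarrow> invariant_dist M (P \<theta>) (\<pi> \<theta>)"
    and stationary_unique: "\<And>\<theta> \<rho>. \<theta> \<in> param_box \<Theta> \<theta>\<^sub>0 \<epsilon> \<Longrightarrow> invariant_dist M (P \<theta>) \<rho> \<Longrightarrow> \<rho> = \<pi> \<theta>"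
    and f_meas: "f \<in> borel_measurable M"
    and f_int: "\<And>\<theta>. \<theta> \<in> param_box \<Theta> \<theta>\<^sub>0 \<epsilon> \<Longrightarrow> integrable (\<pi> \<theta>) f"
    and irreducible: "\<And>\<theta>. \<theta> \<in> param_box \<Theta> \<theta>\<^sub>0 \<epsilon> \<Longrightarrow> \<exists>\<psi>. psi_irreducible M (P \<theta>) \<psi>"
    and dens_meas: "\<And>\<theta>. \<theta> \<in> param_box \<Theta> \<theta>\<^sub>0 \<epsilon> \<Longrightarrow>
          (\<lambda>(x, y). p \<theta> x y) \<in> borel_measurable (M \<Otimes>\<^sub>M M)"
    and dens_nonneg: "\<And>\<theta> x y. \<theta> \<in> param_box \<Theta> \<theta>\<^sub>0 \<epsilon> \<Longrightarrow> x \<in> space M \<Longrightarrow> y \<in> space M \<Longrightarrow> p \<theta> x y \<ge> 0"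
    and dens: "\<And>\<theta> x. \<theta> \<in> param_box \<Theta> \<theta>\<^sub>0 \<epsilon> \<Longrightarrow> x \<in> space M \<Longrightarrow>
          P \<theta> x = density (P \<theta>\<^sub>0 x) (\<lambda>y. ennreal (p \<theta> x y))"
    and dens_diff: "\<And>x y. x \<in> space M \<Longrightarrow> y \<in> space M \<Longrightarrow> grad_exists (\<lambda>\<theta>. p \<theta> x y) \<theta>\<^sub>0"
    and minorization_params: "K \<in> sets M" "\<delta> > 0" "m \<ge> 1" "\<nu> \<in> space (prob_algebra M)"
    and minorization: "\<And>\<theta> x A. \<theta> \<in> param_box \<Theta> \<theta>\<^sub>0 \<epsilon> \<Longrightarrow> x \<in> K \<Longrightarrow> A \<in> sets M \<Longrightarrow>
          emeasure (kernel_pow M (P \<theta>) m x) A \<ge> ennreal \<delta> * emeasure \<nu> A"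
    and drift_params: "V \<in> borel_measurable M" "\<And>x. x \<in> space M \<Longrightarrow> V x \<ge> 1" "0 < lam" "lam < 1"
    and drift: "\<And>\<theta> x. \<theta> \<in> param_box \<Theta> \<theta>\<^sub>0 \<epsilon> \<Longrightarrow> x \<in> space M \<Longrightarrow>
          (\<integral>\<^sup>+y. ennreal (V y) \<partial>(P \<theta> x)) \<le> ennreal (lam * V x + b * indicator K x)"
    and deriv_kernel: "\<And>i x. x \<in> space M \<Longrightarrow>
          integrable (P \<theta>\<^sub>0 x) (\<lambda>y. V y * dens_deriv p \<theta>\<^sub>0 i x y)"
    and deriv_kernel_norm: "\<And>i. kernel_norm M V (deriv_kernel_app P p \<theta>\<^sub>0 i) < \<infinity>"
    and deriv_kernel_lim: "\<And>i. ((\<lambda>h. kernel_norm M V (\<lambda>g x.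
          (kernel_app (P (coord_line \<theta>\<^sub>0 i h)) g x - kernel_app (P \<theta>\<^sub>0) g x) / h
            - deriv_kernel_app P p \<theta>\<^sub>0 i g x)) \<longlongrightarrow> 0) (at 0)"
    and second_moment: "\<And>i x. x \<in> space M \<Longrightarrow> integrable (P \<theta>\<^sub>0 x) (\<lambda>y. (dens_deriv p \<theta>\<^sub>0 i x y)\<^sup>2)"
    and second_moment_norm: "\<And>i. wnorm M V (\<lambda>x. \<integral>y. (dens_deriv p \<theta>\<^sub>0 i x y)\<^sup>2 \<partial>(P \<theta>\<^sub>0 x)) < \<infinity>"
    and f_norm: "wnorm M (\<lambda>x. sqrt (V x)) f < \<infinity>"
    and chain: "markov_chain \<Omega> M (P \<theta>\<^sub>0) \<mu> \<Phi>"
    and initial: "\<mu> \<in> space (prob_algebra M)" "(\<integral>\<^sup>+x. ennreal (V x) \<partial>\<mu>) < \<infinity>"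
  shows "grad_exists (\<lambda>\<theta>. \<integral>x. f x \<partial>(\<pi> \<theta>)) \<theta>\<^sub>0
    \<and> (\<forall>n\<ge>1. integrable \<Omega> (\<lambda>\<omega>. time_avg f \<Phi> n \<omega> *\<^sub>R grad (\<lambda>\<theta>. likelihood p \<Phi> n \<theta> \<omega>) \<theta>\<^sub>0))
    \<and> (\<lambda>n. \<integral>\<omega>. time_avg f \<Phi> n \<omega> *\<^sub>R grad (\<lambda>\<theta>. likelihood p \<Phi> n \<theta> \<omega>) \<theta>\<^sub>0 \<partial>\<Omega>)
        \<longlonglongrightarrow> grad (\<lambda>\<theta>. \<integral>x. f x \<partial>(\<pi> \<theta>)) \<theta>\<^sub>0"
proof -
  let ?box = "param_box \<Theta> \<theta>\<^sub>0 \<epsilon>"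
  let ?q = "dens_deriv p \<theta>\<^sub>0"
  let ?D = "deriv_kernel_app P p \<theta>\<^sub>0"
  let ?\<alpha> = "\<lambda>\<theta>. \<integral>x. f x \<partial>(\<pi> \<theta>)"
  \<comment> \<open>Enlarging \<open>b\<close> preserves the drift inequality and makes the constant positive.\<close>
  define b' where "b' = max b 1"
  have drift_kernel: "drift_kernel M (P \<theta>) V K lam b'" if \<theta>: "\<theta> \<in> ?box" for \<theta>
  proof
    show "P \<theta> \<in> M \<rightarrow>\<^sub>M prob_algebra M" using \<theta> kernel by (simp add: param_box_def)
    show "(\<integral>\<^sup>+y. ennreal (V y) \<partial>(P \<theta> x)) \<le> ennreal (lam * V x + b' * indicator K x)" if x: "x \<in> space M" for x
      using drift[OF \<theta> x]
      by (rule order_trans) (auto simp: b'_def intro!: ennreal_leI split: split_indicator)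
  qed (use minorization_params drift_params in \<open>auto simp: b'_def\<close>)
  have box0: "\<theta>\<^sub>0 \<in> ?box" using base_point(1) eps by (simp add: param_box_def)
  have box: "\<forall>\<^sub>F h in at 0. coord_line \<theta>\<^sub>0 i h \<in> ?box" for i
    by (rule eventually_coord_line_param_box[OF base_point(2) eps])
  have inv0: "invariant_dist M (P \<theta>\<^sub>0) (\<pi> \<theta>\<^sub>0)" by (rule stationary[OF box0])
  have "space M \<noteq> {}"
    using initial(1) prob_space.not_empty sets_eq_imp_space_eq by (auto simp: space_prob_algebra) blast
  interpret Q: small_drift_kernel M "P \<theta>\<^sub>0" V K lam b' m \<delta> \<nu>
    by (intro small_drift_kernel.intro small_drift_kernel_axioms.intro drift_kernel[OF box0])
      (use minorization_params minorization[OF box0] \<open>space M \<noteq> {}\<close> in auto)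
  interpret S: small_drift_kernel M "P \<theta>\<^sub>0" "\<lambda>x. sqrt (V x)" K "sqrt lam" "sqrt b'" m \<delta> \<nu>
    by (rule Q.sqrt_small_drift_kernel)
  interpret C: drift_chain M "P \<theta>\<^sub>0" V K lam b' \<Omega> \<Phi> \<mu>
    by unfold_locales (use chain initial in auto)
  have f_sqrt: "dominated M (\<lambda>x. sqrt (V x)) f"
    by (rule dominatedI[OF f_meas enn2real_nonneg wnorm_bound[OF f_norm]]) (use Q.V_pos in auto)
  have sub: "dominated M V w" if "dominated M (\<lambda>x. sqrt (V x)) w" for w
    by (rule dominated_sub_weight[OF that, of 1]) (use Q.sqrt_V_le in auto)
  have f_dom: "dominated M V f" by (rule sub[OF f_sqrt])
  obtain g where g_sqrt: "dominated M (\<lambda>x. sqrt (V x)) g"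
    and g_eq: "\<And>x. x \<in> space M \<Longrightarrow> g x - kernel_app (P \<theta>\<^sub>0) g x = f x - ?\<alpha> \<theta>\<^sub>0"
    by (rule S.poisson_equation[OF inv0 f_sqrt]) blast
  have g_dom: "dominated M V g" by (rule sub[OF g_sqrt])
  have g_sq: "dominated M V (\<lambda>x. (g x)\<^sup>2)"
    by (rule dominated_sqrt_square[OF Q.V_nonneg g_sqrt])
  have spP: "space (P \<theta> x) = space M" if "\<theta> \<in> ?box" "x \<in> space M" for \<theta> x
    by (rule drift_kernel.space_Q[OF drift_kernel[OF that(1)] that(2)])

  \<comment> \<open>The density of \<open>P \<theta>\<^sub>0 x\<close> with respect to itself is unique up to null sets.\<close>
  have p_one: "AE \<omega> in \<Omega>. p \<theta>\<^sub>0 (\<Phi> j \<omega>) (\<Phi> (Suc j) \<omega>) = 1" for j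
  proof (rule C.AE_step)
    show "Measurable.pred (M \<Otimes>\<^sub>M M) (\<lambda>(x, y). p \<theta>\<^sub>0 x y = 1)"
      using dens_meas[OF box0] by (simp add: split_beta)
    fix x assume x: "x \<in> space M"
    interpret Px: prob_space "P \<theta>\<^sub>0 x" by (rule Q.prob_Q[OF x])
    have m: "p \<theta>\<^sub>0 x \<in> borel_measurable (P \<theta>\<^sub>0 x)"
      using measurable_compose[OF measurable_Pair1'[OF x] dens_meas[OF box0]] Q.sets_Q[OF x]
      by (simp cong: measurable_cong_sets)
    have "density (P \<theta>\<^sub>0 x) (\<lambda>y. ennreal (p \<theta>\<^sub>0 x y)) = density (P \<theta>\<^sub>0 x) (\<lambda>_. 1)"
      using dens[OF box0 x] by (simp add: density_1)
    then have "AE y in P \<theta>\<^sub>0 x. ennreal (p \<theta>\<^sub>0 x y) = 1"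
      by (intro Px.density_unique) (use m in auto)
    then show "AE y in P \<theta>\<^sub>0 x. p \<theta>\<^sub>0 x y = 1"
      by (auto simp: ennreal_eq_1)
  qed

  have coord: "(\<lambda>h. ?\<alpha> (coord_line \<theta>\<^sub>0 i h)) field_differentiable (at 0) \<and>
      (\<forall>n. integrable \<Omega> (\<lambda>\<omega>. time_avg f \<Phi> n \<omega> * partial_deriv i (\<lambda>\<theta>. likelihood p \<Phi> n \<theta> \<omega>) \<theta>\<^sub>0)) \<and>
      (\<lambda>n. \<integral>\<omega>. time_avg f \<Phi> n \<omega> * partial_deriv i (\<lambda>\<theta>. likelihood p \<Phi> n \<theta> \<omega>) \<theta>\<^sub>0 \<partial>\<Omega>)
        \<longlonglongrightarrow> partial_deriv i ?\<alpha> \<theta>\<^sub>0" for i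
  proof -
    let ?R = "\<lambda>h. P (coord_line \<theta>\<^sub>0 i h)"
    define T where "T h = (\<lambda>g x. (kernel_app (?R h) g x - kernel_app (P \<theta>\<^sub>0) g x) / h - ?D i g x)" for h
    define e where "e h = enn2real (kernel_norm M V (T h))" for h
    have lim: "((\<lambda>h. kernel_norm M V (T h)) \<longlongrightarrow> 0) (at 0)"
      using deriv_kernel_lim[of i] by (simp add: T_def)
    have e: "(e \<longlongrightarrow> 0) (at 0)"
      unfolding e_def[abs_def] using lim by (intro tendsto_enn2real) auto
    have q_meas: "(\<lambda>(x, y). ?q i x y) \<in> borel_measurable (M \<Otimes>\<^sub>M M)"
      by (rule borel_measurable_dens_deriv[OF box box0 dens_meas dens_diff])
    have D_hom: "?D i (\<lambda>y. a * w y) x = a * ?D i w x" for a w x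
      by (simp add: deriv_kernel_app_def mult.assoc)
    have D_null: "?D i w x = 0" if "\<And>y. y \<in> space M \<Longrightarrow> w y = 0" "x \<in> space M" for w x
    proof -
      have "?D i w x = (\<integral>y. 0 \<partial>P \<theta>\<^sub>0 x)"
        unfolding deriv_kernel_app_def
        by (rule Bochner_Integration.integral_cong) (use that spP[OF box0] in auto)
      then show ?thesis by simp
    qed
    have app_null: "kernel_app (P \<theta>) w x = 0"
      if "\<theta> \<in> ?box" "\<And>y. y \<in> space M \<Longrightarrow> w y = 0" "x \<in> space M" for \<theta> w x
    proof -
      have "kernel_app (P \<theta>) w x = (\<integral>y. 0 \<partial>P \<theta> x)"
        unfolding kernel_app_def
        by (rule Bochner_Integration.integral_cong) (use that spP[OF that(1)] in auto)
      then show ?thesis by simp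
    qed
    have D_dom: "dominated M V (?D i w)" if w: "dominated M V w" for w
    proof -
      obtain c where c: "0 \<le> c" "\<And>x. x \<in> space M \<Longrightarrow> \<bar>w x\<bar> \<le> c * V x" using w by (auto elim: dominatedE)
      have wm: "w \<in> borel_measurable M" by (rule dominatedD[OF w])
      show ?thesis
      proof (rule dominatedI[where c = "c * enn2real (kernel_norm M V (?D i))"])
        have "(\<lambda>z. w (snd z) * (case z of (x, y) \<Rightarrow> ?q i x y)) \<in> borel_measurable (M \<Otimes>\<^sub>M M)"
          by (intro borel_measurable_times q_meas measurable_compose[OF measurable_snd wm])
        then have "(\<lambda>(x, y). w y * ?q i x y) \<in> borel_measurable (M \<Otimes>\<^sub>M M)"
          by (simp add: split_beta)
        then show "?D i w \<in> borel_measurable M"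
          unfolding deriv_kernel_app_def[abs_def] by (rule measurable_integral_kernel[OF _ Q.kernel_sub])
        show "\<bar>?D i w x\<bar> \<le> c * enn2real (kernel_norm M V (?D i)) * V x" if x: "x \<in> space M" for x
          by (rule kernel_norm_bound[OF Q.V_pos D_hom D_null deriv_kernel_norm wm c x]) (use x in auto)
      qed (use c in simp)
    qed
    have T_bound: "\<bar>T h w x\<bar> \<le> (c * e h) * V x"
      if h: "coord_line \<theta>\<^sub>0 i h \<in> ?box" "kernel_norm M V (T h) < \<infinity>"
        and w: "w \<in> borel_measurable M" and c: "0 \<le> c" "\<And>y. y \<in> space M \<Longrightarrow> \<bar>w y\<bar> \<le> c * V y"
        and x: "x \<in> space M" for h w c x
      unfolding e_def
    proof (rule kernel_norm_bound[OF Q.V_pos _ _ h(2) w c x])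
      show "T h (\<lambda>y. a * w y) x = a * T h w x" for a w
        by (simp add: T_def D_hom kernel_app_def right_diff_distrib)
      show "T h w x = 0" if "\<And>y. y \<in> space M \<Longrightarrow> w y = 0" for w
        using app_null[of _ w x] D_null[of w x] h(1) box0 that x by (simp add: T_def)
    qed
    have good: "\<forall>\<^sub>F h in at 0. coord_line \<theta>\<^sub>0 i h \<in> ?box \<and> kernel_norm M V (T h) < \<infinity>"
      using box[of i] order_tendstoD(2)[OF lim zero_less_one]
      by eventually_elim (auto intro: less_trans[OF _ ennreal_one_less_top])
    \<comment> \<open>For the constant test function the difference quotient vanishes, since both kernels are
      probability kernels; so the derivative kernel annihilates constants.\<close>
    have q_mean: "(\<integral>y. ?q i x y \<partial>P \<theta>\<^sub>0 x) = 0" if x: "x \<in> space M" for x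
    proof -
      have "((\<lambda>h::real. \<bar>\<integral>y. ?q i x y \<partial>P \<theta>\<^sub>0 x\<bar>) \<longlongrightarrow> 0) (at 0)"
      proof (rule Lim_null_comparison)
        show "\<forall>\<^sub>F h in at 0. norm \<bar>\<integral>y. ?q i x y \<partial>P \<theta>\<^sub>0 x\<bar> \<le> (1 * e h) * V x"
          using good
        proof eventually_elim
          case (elim h)
          interpret R: drift_kernel M "?R h" V K lam b' using elim drift_kernel by blast
          have "T h (\<lambda>_. 1) x = - (\<integral>y. ?q i x y \<partial>P \<theta>\<^sub>0 x)"
            unfolding T_def R.E_const[OF x] Q.E_const[OF x] by (simp add: deriv_kernel_app_def)
          then show ?case
            using T_bound[of h "\<lambda>_. 1" 1 x] elim x Q.V_ge_1 by simp
        qed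
        have "((\<lambda>h. (1 * e h) * V x) \<longlongrightarrow> (1 * 0) * V x) (at 0)" by (intro tendsto_intros e)
        then show "((\<lambda>h. (1 * e h) * V x) \<longlongrightarrow> 0) (at 0)" by simp
      qed
      then show ?thesis by (simp add: tendsto_const_iff)
    qed
    have q_fair: "C.fair (?q i)"
      unfolding C.fair_def
    proof (intro conjI ballI exI)
      let ?c = "enn2real (wnorm M V (\<lambda>x. \<integral>y. (?q i x y)\<^sup>2 \<partial>(P \<theta>\<^sub>0 x)))"
      show "(\<integral>y. (?q i x y)\<^sup>2 \<partial>P \<theta>\<^sub>0 x) \<le> ?c * V x" if "x \<in> space M" for x
        using wnorm_bound[OF second_moment_norm[of i] that Q.V_pos[OF that]] by linarith
    qed (use q_meas q_mean second_moment in auto)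
    let ?l = "\<integral>x. ?D i g x \<partial>(\<pi> \<theta>\<^sub>0)"
    have deriv: "((\<lambda>h. ?\<alpha> (coord_line \<theta>\<^sub>0 i h)) has_real_derivative ?l) (at 0)"
    proof -
      have "((\<lambda>h. \<integral>x. f x \<partial>\<pi> (coord_line \<theta>\<^sub>0 i h)) has_real_derivative
        (\<integral>x. ?D i g x \<partial>\<pi> (coord_line \<theta>\<^sub>0 i 0))) (at 0)"
      proof (rule Q.stationary_derivative[where R = ?R and e = e and g = g and D = "?D i"
            and \<rho> = "\<lambda>h. \<pi> (coord_line \<theta>\<^sub>0 i h)"])
        show "\<forall>\<^sub>F h in at 0. drift_kernel M (?R h) V K lam b' \<and> invariant_dist M (?R h) (\<pi> (coord_line \<theta>\<^sub>0 i h))"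
          using box[of i] by eventually_elim (use drift_kernel stationary in auto)
        show "\<forall>\<^sub>F h in at 0. \<forall>g c x. g \<in> borel_measurable M \<longrightarrow> 0 \<le> c \<longrightarrow>
          (\<forall>y\<in>space M. \<bar>g y\<bar> \<le> c * V y) \<longrightarrow> x \<in> space M \<longrightarrow>
          \<bar>(kernel_app (?R h) g x - kernel_app (P \<theta>\<^sub>0) g x) / h - ?D i g x\<bar> \<le> (c * e h) * V x"
          using good by eventually_elim (insert T_bound, unfold T_def, blast)
      qed (use inv0 D_dom e g_dom g_eq f_dom in \<open>auto simp: e_def\<close>)
      then show ?thesis by simp
    qed
    obtain G where G: "dominated M V G" "\<And>x. x \<in> space M \<Longrightarrow> G x - kernel_app (P \<theta>\<^sub>0) G x = ?D i g x - ?l"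
      by (rule Q.poisson_equation[OF inv0 D_dom[OF g_dom]]) blast
    have f_rep: "f x = ?\<alpha> \<theta>\<^sub>0 + (g x - kernel_app (P \<theta>\<^sub>0) g x)" if "x \<in> space M" for x
      using g_eq[OF that] by simp
    note score = C.score_covariance_limit[OF q_fair dominatedD[OF g_dom] g_sq f_rep G(1)
        D_dom[OF g_dom, unfolded deriv_kernel_app_def[abs_def]] G(2)[unfolded deriv_kernel_app_def]]
    define X where "X n \<omega> = time_avg f \<Phi> n \<omega> * partial_deriv i (\<lambda>\<theta>. likelihood p \<Phi> n \<theta> \<omega>) \<theta>\<^sub>0" for n \<omega>
    define Y where "Y n \<omega> = time_avg f \<Phi> n \<omega> * (\<Sum>j<n. ?q i (\<Phi> j \<omega>) (\<Phi> (Suc j) \<omega>))" for n \<omega>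
    have step_meas: "(\<lambda>\<omega>. k (\<Phi> j \<omega>) (\<Phi> (Suc j) \<omega>)) \<in> borel_measurable \<Omega>"
      if "(\<lambda>(x, y). k x y) \<in> borel_measurable (M \<Otimes>\<^sub>M M)" for k :: "'x \<Rightarrow> 'x \<Rightarrow> real" and j
      using measurable_compose[OF measurable_Pair[OF C.\<Phi>[of j] C.\<Phi>[of "Suc j"]] that] by simp
    have avg_meas: "time_avg f \<Phi> n \<in> borel_measurable \<Omega>" for n
      unfolding time_avg_def[abs_def]
      by (intro borel_measurable_times borel_measurable_const borel_measurable_sum measurable_compose[OF C.\<Phi> f_meas])
    have pd: "partial_deriv i (\<lambda>\<theta>. likelihood p \<Phi> n \<theta> \<omega>) \<theta>\<^sub>0 =
      (\<Sum>j<n. ?q i (\<Phi> j \<omega>) (\<Phi> (Suc j) \<omega>) * (\<Prod>k\<in>{..<n} - {j}. p \<theta>\<^sub>0 (\<Phi> k \<omega>) (\<Phi> (Suc k) \<omega>)))"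
      if "\<omega> \<in> space \<Omega>" for \<omega> n
      by (rule partial_deriv_likelihood) (intro dens_diff C.\<Phi>_space that)
    \<comment> \<open>\<open>X n\<close> carries the factors \<open>p \<theta>\<^sub>0\<close> of the product rule, \<open>Y n\<close> is the martingale; they agree only
      almost surely, so the measurability of both is required.\<close>
    have X_meas: "X n \<in> borel_measurable \<Omega>" for n
    proof -
      have "(\<lambda>\<omega>. time_avg f \<Phi> n \<omega> * (\<Sum>j<n. ?q i (\<Phi> j \<omega>) (\<Phi> (Suc j) \<omega>) *
          (\<Prod>k\<in>{..<n} - {j}. p \<theta>\<^sub>0 (\<Phi> k \<omega>) (\<Phi> (Suc k) \<omega>)))) \<in> borel_measurable \<Omega>"
        by (intro borel_measurable_times borel_measurable_sum borel_measurable_prod avg_meas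
            step_meas q_meas dens_meas[OF box0])
      then show ?thesis
        by (rule measurable_cong[THEN iffD1, rotated]) (simp add: X_def pd)
    qed
    have Y_meas: "Y n \<in> borel_measurable \<Omega>" for n
      unfolding Y_def[abs_def] by (intro borel_measurable_times borel_measurable_sum avg_meas step_meas q_meas)
    have XY: "AE \<omega> in \<Omega>. X n \<omega> = Y n \<omega>" for n
    proof -
      have "AE \<omega> in \<Omega>. \<forall>j. p \<theta>\<^sub>0 (\<Phi> j \<omega>) (\<Phi> (Suc j) \<omega>) = 1"
        using p_one by (simp add: AE_all_countable)
      then show ?thesis
        using AE_space by eventually_elim (simp add: X_def Y_def pd)
    qed
    have int_Y: "integrable \<Omega> (Y n)" for n
      using score(1)[of n] by (simp add: Y_def[abs_def])
    have "integrable \<Omega> (X n)" for n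
      using integrable_cong_AE[OF X_meas Y_meas XY] int_Y by blast
    moreover have "(\<lambda>n. integral\<^sup>L \<Omega> (X n)) \<longlonglongrightarrow> ?l"
      using score(2) integral_cong_AE[OF X_meas Y_meas XY]
      by (simp add: Y_def[abs_def] deriv_kernel_app_def)
    moreover have "partial_deriv i ?\<alpha> \<theta>\<^sub>0 = ?l"
      unfolding partial_deriv_def by (rule DERIV_imp_deriv[OF deriv])
    moreover have "(\<lambda>h. ?\<alpha> (coord_line \<theta>\<^sub>0 i h)) field_differentiable (at 0)"
      using deriv unfolding field_differentiable_def by blast
    ultimately show ?thesis by (simp add: X_def[abs_def])
  qed

  let ?X = "\<lambda>n \<omega>. time_avg f \<Phi> n \<omega> *\<^sub>R grad (\<lambda>\<theta>. likelihood p \<Phi> n \<theta> \<omega>) \<theta>\<^sub>0"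
  have comp: "(\<lambda>\<omega>. ?X n \<omega> $ i) = (\<lambda>\<omega>. time_avg f \<Phi> n \<omega> * partial_deriv i (\<lambda>\<theta>. likelihood p \<Phi> n \<theta> \<omega>) \<theta>\<^sub>0)" for n i
    by (simp add: grad_def)
  have int_comp: "integrable \<Omega> (\<lambda>\<omega>. ?X n \<omega> $ i)" for n i
    unfolding comp using coord by blast
  show ?thesis
  proof (intro conjI allI impI)
    show "grad_exists ?\<alpha> \<theta>\<^sub>0"
      unfolding grad_exists_def using coord by blast
    show "integrable \<Omega> (?X n)" for n
      by (rule vec_integral_componentwise(1)) (rule int_comp)
    show "(\<lambda>n. integral\<^sup>L \<Omega> (?X n)) \<longlonglongrightarrow> grad ?\<alpha> \<theta>\<^sub>0"
    proof (rule vec_tendstoI)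
      show "(\<lambda>n. integral\<^sup>L \<Omega> (?X n) $ i) \<longlonglongrightarrow> grad ?\<alpha> \<theta>\<^sub>0 $ i" for i
        unfolding vec_integral_componentwise(2)[OF int_comp] comp using coord by (simp add: grad_def)
    qed
  qed
qed

end
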